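(* Let $c_1,c_2,c_3$ be positive integers and let $P$ be the $(c_1,c_2,c_3)$-generalized double circle. Then $\mathcal T(P,Q,f_0)\le 1$ for every point set $Q$ in general position with $|Q|=|P|$ and $|\mathrm{CH}(Q)|=3$ such that no three lines, each through two points of $Q$ with the six points distinct, are concurrent, and every cyclic bijection $f_0$ from the hull vertices of $P$ to those of $Q$.
   Context: All point sets are in the plane; general position means no three points collinear. A triangulation of a point set is a maximal set of pairwise non-crossing segments with endpoints in the set. For a bijection $f$ between point sets, a compatible triangulation with respect to $f$ is a pair of triangulations $(T_1,T_2)$ with $(p,p')\in T_1$ iff $(f(p),f(p'))\in T_2$. A bijection $f_0$ between the convex hull vertices of $P$ and $Q$ is cyclic if it maps hull edges to hull edges and non-edges to non-edges. $\mathcal T(P,Q,f_0)$ is the minimum $k$ such that there exist point sets $S_P,S_Q$ with $|S_P|=|S_Q|=k$, $S_P\cap P=\emptyset$, $S_Q\cap Q=\emptyset$, $P\cup S_P$ and $Q\cup S_Q$ in general position, $S_P$ inside the convex hull of $P$ and $S_Q$ inside the convex hull of $Q$ (so the hulls are unchanged), and a compatible triangulation of $(P\cup S_P,Q\cup S_Q)$ with respect to some bijection $f:P\cup S_P\to Q\cup S_Q$ extending $f_0$ (where $f$ need not map original points to original points). A $(c_1,c_2,c_3)$-generalized double circle is a point set with $3+c_1+c_2+c_3$ points whose convex hull is the triangle $P_1P_2P_3$ (indices mod 3), such that for each $i$ there are $c_i$ points $A_{i,1},\dots,A_{i,c_i}$ placed along the edge $P_iP_{i+1}$, slightly offset towards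 the interior, the polygon $P_iA_{i,1}\dots A_{i,c_i}P_{i+1}$ is convex, and the closed chain $P_1A_{1,1}\dots A_{1,c_1}P_2A_{2,1}\dots A_{2,c_2}P_3A_{3,1}\dots A_{3,c_3}P_1$ is an unavoidable spanning cycle, i.e. each of its edges belongs to every triangulation of the point set. *)

theory Defs
  imports "HOL-Analysis.Analysis" "HOL-Library.Extended_Nat"
begin

type_synonym point = "real^2"

definition general_position :: "point set \<Rightarrow> bool" where
  "general_position S \<longleftrightarrow>
     (\<forall>a\<in>S. \<forall>b\<in>S. \<forall>c\<in>S. a \<noteq> b \<and> b \<noteq> c \<and> a \<noteq> c \<longrightarrow> \<not> collinear {a, b, c})"

definition no_three_concurrent_lines :: "point set \<Rightarrow> bool" where
  "no_three_concurrent_lines S \<longleftrightarrow>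
     (\<forall>a b c d e f. set [a, b, c, d, e, f] \<subseteq> S \<and> distinct [a, b, c, d, e, f] \<longrightarrow>
        affine hull {a, b} \<inter> affine hull {c, d} \<inter> affine hull {e, f} = {})"

text \<open>A segment is represented by the unordered pair of its (distinct) endpoints.\<close>

definition segments :: "point set \<Rightarrow> point set set" where
  "segments S = {{p, q} |p q. p \<in> S \<and> q \<in> S \<and> p \<noteq> q}"

definition crossing :: "point set \<Rightarrow> point set \<Rightarrow> bool" where
  "crossing e e' \<longleftrightarrow>
     e \<noteq> e' \<and> (\<exists>p q r s. e = {p, q} \<and> e' = {r, s} \<and> open_segment p q \<inter> open_segment r s \<noteq> {})"

definition pairwise_noncrossing :: "point set set \<Rightarrow> bool" where
  "pairwise_noncrossing T \<longleftrightarrow> (\<forall>e\<in>T. \<forall>e'\<in>T. \<not> crossing e e')"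

definition triangulation :: "point set \<Rightarrow> point set set \<Rightarrow> bool" where
  "triangulation S T \<longleftrightarrow> T \<subseteq> segments S \<and> pairwise_noncrossing T \<and>
     (\<forall>T'. T \<subseteq> T' \<and> T' \<subseteq> segments S \<and> pairwise_noncrossing T' \<longrightarrow> T' = T)"

definition compatible_triangulation ::
  "point set \<Rightarrow> point set \<Rightarrow> (point \<Rightarrow> point) \<Rightarrow> point set set \<Rightarrow> point set set \<Rightarrow> bool" where
  "compatible_triangulation P Q f T1 T2 \<longleftrightarrow> triangulation P T1 \<and> triangulation Q T2 \<and>
     (\<forall>p\<in>P. \<forall>p'\<in>P. {p, p'} \<in> T1 \<longleftrightarrow> {f p, f p'} \<in> T2)"

definition hull_vertices :: "point set \<Rightarrow> point set" where
  "hull_vertices S = {v. v extreme_point_of (convex hull S)}"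

definition hull_edges :: "point set \<Rightarrow> point set set" where
  "hull_edges S = {{p, q} |p q. p \<in> hull_vertices S \<and> q \<in> hull_vertices S \<and>
     closed_segment p q edge_of (convex hull S)}"

definition cyclic_bijection :: "point set \<Rightarrow> point set \<Rightarrow> (point \<Rightarrow> point) \<Rightarrow> bool" where
  "cyclic_bijection P Q f0 \<longleftrightarrow> bij_betw f0 (hull_vertices P) (hull_vertices Q) \<and>
     (\<forall>p\<in>hull_vertices P. \<forall>p'\<in>hull_vertices P.
        {p, p'} \<in> hull_edges P \<longleftrightarrow> {f0 p, f0 p'} \<in> hull_edges Q)"

definition compatible_with_steiner_points ::
  "point set \<Rightarrow> point set \<Rightarrow> (point \<Rightarrow> point) \<Rightarrow> nat \<Rightarrow> bool" where
  "compatible_with_steiner_points P Q f0 k \<longleftrightarrow>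
     (\<exists>SP SQ f T1 T2.
        finite SP \<and> finite SQ \<and> card SP = k \<and> card SQ = k \<and>
        SP \<inter> P = {} \<and> SQ \<inter> Q = {} \<and>
        general_position (P \<union> SP) \<and> general_position (Q \<union> SQ) \<and>
        SP \<subseteq> convex hull P \<and> SQ \<subseteq> convex hull Q \<and>
        bij_betw f (P \<union> SP) (Q \<union> SQ) \<and> (\<forall>p\<in>hull_vertices P. f p = f0 p) \<and>
        compatible_triangulation (P \<union> SP) (Q \<union> SQ) f T1 T2)"

text \<open>The minimum is taken in the extended naturals, so that it is \<open>\<infinity>\<close> (and not a junk
  natural number) if no number of Steiner points suffices.\<close>

definition steiner_number :: "point set \<Rightarrow> point set \<Rightarrow> (point \<Rightarrow> point) \<Rightarrow> enat" where
  "steiner_number P Q f0 = Inf {enat k |k. compatible_with_steiner_points P Q f0 k}"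

definition cycle_edges :: "point list \<Rightarrow> point set set" where
  "cycle_edges vs = {{vs ! i, vs ! (Suc i mod length vs)} |i. i < length vs}"

text \<open>A closed polygon, given by its vertices in cyclic order, is (strictly) convex if it is the
  boundary of the convex hull of its vertices and every vertex is a corner; the latter is implied
  because the endpoints of hull edges are hull vertices.\<close>

definition convex_polygon :: "point list \<Rightarrow> bool" where
  "convex_polygon vs \<longleftrightarrow> distinct vs \<and> cycle_edges vs = hull_edges (set vs)"

definition unavoidable :: "point set \<Rightarrow> point set \<Rightarrow> bool" where
  "unavoidable S e \<longleftrightarrow> (\<forall>T. triangulation S T \<longrightarrow> e \<in> T)"

text \<open>The informal requirement that the points of \<open>A1\<close>, \<open>A2\<close>, \<open>A3\<close> lie along the three hull
  edges, only slightly offset towards the interior, is made precise by the last four conjuncts;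
  these points are interior to the hull by general position.\<close>

definition generalized_double_circle :: "nat \<Rightarrow> nat \<Rightarrow> nat \<Rightarrow> point set \<Rightarrow> bool" where
  "generalized_double_circle c1 c2 c3 S \<longleftrightarrow> general_position S \<and>
     (\<exists>P1 P2 P3 A1 A2 A3.
        length A1 = c1 \<and> length A2 = c2 \<and> length A3 = c3 \<and>
        distinct (P1 # A1 @ P2 # A2 @ P3 # A3) \<and>
        S = set (P1 # A1 @ P2 # A2 @ P3 # A3) \<and>
        convex hull S = convex hull {P1, P2, P3} \<and>
        convex_polygon (P1 # A1 @ [P2]) \<and>
        convex_polygon (P2 # A2 @ [P3]) \<and>
        convex_polygon (P3 # A3 @ [P1]) \<and>
        (\<forall>e \<in> cycle_edges (P1 # A1 @ P2 # A2 @ P3 # A3). unavoidable S e))"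

end

theory Submission
  imports Defs
begin

text \<open>The Steiner point of \<open>P\<close> is a generic point of the kernel of the unavoidable spanning cycle;
  the kernel is nonempty by Helly's theorem. The Steiner point \<open>s\<close> of \<open>Q\<close> is chosen such that the
  three triangles spanned by \<open>s\<close> and a hull edge contain exactly the prescribed numbers of points.
  In barycentric coordinates \<open>y\<close>, a point \<open>p\<close> lies in the triangle over the edge minimizing
  \<open>y\<^sub>c(p) / y\<^sub>c(s)\<close>, so \<open>s\<close> is a system of dual prices for an assignment of the points to the edges
  with given capacities that minimizes the product of the \<open>y\<^sub>c(p)\<close>. Prices with strict inequalities
  exist because optimality is strict: equality for a swap of two points would give three collinear
  points, and equality for a cyclic exchange of three points would give, by Ceva's theorem, three
  concurrent lines. Both pictures are now star-shaped with respect to the Steiner point. All edges at the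
  Steiner point are drawn; each of the three pockets of \<open>Q\<close> is a radially monotone polygon and is
  triangulated recursively, and the same combinatorial triangulation works in the convex pockets
  of \<open>P\<close>.\<close>

section \<open>Orientation of point triples\<close>

text \<open>Unavoidability is used in one form only: no segment between points of \<open>P\<close>
  crosses an edge of the cycle. The work lies in deducing that every point off a chain is on the
  inner side of all chords of that chain, which makes the half-planes of the cycle edges meet.

  A chord of a pocket may be drawn if the chain vertices between its ends lie on the side of the
  Steiner point; then it misses all spokes. In \<open>Q\<close> this restricts the pocket
  triangulations, but in \<open>P\<close> the chains bend inwards and every chord qualifies. So a
  triangulation found for \<open>Q\<close> can be copied to \<open>P\<close>, and the two sets have
  to agree only in the number of points per chain.

  Triangulations are maximal non-crossing sets, so each segment left out must be shown to be
  crossed: chords of one chain by a spoke or a side at the apex of a pocket triangle, segments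
  between chains by the spoke to a hull vertex.

  With three edges to choose from, exchange cycles have length two or three. The prices are
  therefore found by hand from five cycle inequalities; read as ratios of barycentric coordinates
  they give a point, which is then perturbed to a generic one.\<close>

definition other_axis :: "2 \<Rightarrow> 2" where
  "other_axis k = (if k = 1 then 2 else 1)"

text \<open>Exchanging the axes reverses the orientation; this is how a bijection \<open>f\<^sub>0\<close> that reverses the
  cyclic order of the hull vertices is covered.\<close>

definition orient :: "2 \<Rightarrow> point \<Rightarrow> point \<Rightarrow> point \<Rightarrow> real" where
  "orient k p q r = (q $ k - p $ k) * (r $ other_axis k - p $ other_axis k)
     - (q $ other_axis k - p $ other_axis k) * (r $ k - p $ k)"

lemma forall_axes: "(\<forall>i::2. R i) \<longleftrightarrow> R k \<and> R (other_axis k)"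
  using exhaust_2[of k] by (auto simp: forall_2 other_axis_def)

lemma point_eq_iff: "(p::point) = q \<longleftrightarrow> p $ k = q $ k \<and> p $ other_axis k = q $ other_axis k"
  by (simp add: vec_eq_iff forall_axes[of _ k])

lemma orient_rotate: "orient k q r p = orient k p q r"
  unfolding orient_def by algebra

lemma orient_rotate': "orient k r p q = orient k p q r"
  unfolding orient_def by algebra

lemma orient_swap: "orient k q p r = - orient k p q r"
  unfolding orient_def by algebra

lemma orient_swap': "orient k p r q = - orient k p q r"
  unfolding orient_def by algebra

lemma orient_swap_axes: "orient (other_axis k) p q r = - orient k p q r"
proof -
  have "other_axis (other_axis k) = k"
    using exhaust_2[of k] by (auto simp: other_axis_def)
  then show ?thesis
    unfolding orient_def by (simp add: algebra_simps)
qed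

lemma orient_degenerate [simp]: "orient k p p q = 0" "orient k p q p = 0" "orient k q p p = 0"
  unfolding orient_def by algebra+

lemma orient_sum: "orient k a b x + orient k b c x + orient k c a x = orient k a b c"
  unfolding orient_def by algebra

lemma orient_affine:
  "orient k a b ((1 - t) *\<^sub>R x + t *\<^sub>R y) = (1 - t) * orient k a b x + t * orient k a b y"
  unfolding orient_def by simp algebra

text \<open>Divided by \<open>orient k a b c\<close>, the factors \<open>orient k b c y\<close>,
  \<open>orient k c a y\<close> and \<open>orient k a b y\<close> are the barycentric coordinates of
  \<open>y\<close>, and \<open>orient k p q\<close> is affine. Denominators are cleared so that only
  signs have to be compared.\<close>

lemma orient_barycentric:
  "orient k a b c * orient k p q y
     = orient k b c y * orient k p q a + orient k c a y * orient k p q b + orient k a b y * orient k p q c"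
  unfolding orient_def by algebra

lemma collinear_iff_orient: "collinear {p, q, r} \<longleftrightarrow> orient k p q r = 0"
proof (cases "p = r")
  case True
  then show ?thesis by (simp add: insert_commute)
next
  case False
  have "collinear {p, q, r} \<longleftrightarrow> (\<exists>u. q = u *\<^sub>R p + (1 - u) *\<^sub>R r)"
    using False by (simp add: collinear_3_expand)
  also have "\<dots> \<longleftrightarrow> orient k p q r = 0"
  proof
    assume "\<exists>u. q = u *\<^sub>R p + (1 - u) *\<^sub>R r"
    then obtain u where u: "q = u *\<^sub>R p + (1 - u) *\<^sub>R r" by blast
    show "orient k p q r = 0"
      unfolding u orient_def by simp algebra
  next
    assume 0: "orient k p q r = 0"
    show "\<exists>u. q = u *\<^sub>R p + (1 - u) *\<^sub>R r"
    proof (cases "p $ k = r $ k")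
      case True
      with False have ne: "p $ other_axis k \<noteq> r $ other_axis k" by (simp add: point_eq_iff[of _ _ k])
      with 0 True have q: "q $ k = r $ k" by (auto simp: orient_def)
      define u where "u = (q $ other_axis k - r $ other_axis k) / (p $ other_axis k - r $ other_axis k)"
      have uo: "u * (p $ other_axis k - r $ other_axis k) = q $ other_axis k - r $ other_axis k"
        using ne by (simp add: u_def)
      have "q = u *\<^sub>R p + (1 - u) *\<^sub>R r"
        using uo True q unfolding point_eq_iff[of _ _ k]
        by (simp add: algebra_simps)
      then show ?thesis ..
    next
      case ne: False
      define u where "u = (q $ k - r $ k) / (p $ k - r $ k)"
      have uk: "u * (p $ k - r $ k) = q $ k - r $ k" using ne by (simp add: u_def)
      have "(p $ k - r $ k) * (u * (p $ other_axis k - r $ other_axis k)) 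
          = (p $ k - r $ k) * (q $ other_axis k - r $ other_axis k)"
        using 0 uk unfolding orient_def by algebra
      then have uo: "u * (p $ other_axis k - r $ other_axis k) = q $ other_axis k - r $ other_axis k"
        using ne by simp
      have "q = u *\<^sub>R p + (1 - u) *\<^sub>R r"
        using uk uo unfolding point_eq_iff[of _ _ k]
        by (simp add: algebra_simps)
      then show ?thesis ..
    qed
  qed
  finally show ?thesis .
qed

lemma general_position_orient:
  assumes "general_position X" "p \<in> X" "q \<in> X" "r \<in> X" "p \<noteq> q" "q \<noteq> r" "p \<noteq> r"
  shows "orient k p q r \<noteq> 0"
  using assms unfolding general_position_def by (simp add: collinear_iff_orient[of _ _ _ k])

lemma general_positionI:
  assumes "\<And>p q r. \<lbrakk>p \<in> X; q \<in> X; r \<in> X; p \<noteq> q; q \<noteq> r; p \<noteq> r\<rbrakk> \<Longrightarrow> orient k p q r \<noteq> 0"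
  shows "general_position X"
  using assms unfolding general_position_def by (simp add: collinear_iff_orient[of _ _ _ k])

section \<open>Crossing segments and sides of a line\<close>

lemma crossing_iff:
  "crossing {p, q} {r, s} \<longleftrightarrow> {p, q} \<noteq> {r, s} \<and> open_segment p q \<inter> open_segment r s \<noteq> {}"
proof
  assume "crossing {p, q} {r, s}"
  then show "{p, q} \<noteq> {r, s} \<and> open_segment p q \<inter> open_segment r s \<noteq> {}"
    unfolding crossing_def doubleton_eq_iff by (elim conjE exE) (auto simp: open_segment_commute doubleton_eq_iff)
next
  assume "{p, q} \<noteq> {r, s} \<and> open_segment p q \<inter> open_segment r s \<noteq> {}"
  then show "crossing {p, q} {r, s}"
    unfolding crossing_def by blast
qed

lemma crossing_commute: "crossing e f \<longleftrightarrow> crossing f e"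
  unfolding crossing_def by blast

lemma in_open_segmentE:
  assumes "x \<in> open_segment p q"
  obtains t where "0 < t" "t < 1" "x = (1 - t) *\<^sub>R p + t *\<^sub>R q"
  using assms by (auto simp: in_segment)

lemma orient_open_segment_pos:
  assumes "x \<in> open_segment p q" "orient k a b p \<ge> 0" "orient k a b q \<ge> 0"
    "orient k a b p > 0 \<or> orient k a b q > 0"
  shows "orient k a b x > 0"
proof -
  obtain t where t: "0 < t" "t < 1" "x = (1 - t) *\<^sub>R p + t *\<^sub>R q"
    using assms(1) by (rule in_open_segmentE)
  have "(1 - t) * orient k a b p \<ge> 0" "t * orient k a b q \<ge> 0"
    "(1 - t) * orient k a b p > 0 \<or> t * orient k a b q > 0"
    using t assms by auto
  then show ?thesis unfolding t(3) orient_affine by linarith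
qed

lemma orient_open_segment_zero:
  assumes "x \<in> open_segment p q" shows "orient k p q x = 0"
proof -
  obtain t where t: "0 < t" "t < 1" "x = (1 - t) *\<^sub>R p + t *\<^sub>R q"
    using assms(1) by (rule in_open_segmentE)
  show ?thesis unfolding t(3) orient_affine by simp
qed

text \<open>The ends of each segment are strictly on different sides of the line through the other,
  and Cramer's rule yields the common point with both parameters strictly between 0 and 1.\<close>

lemma crossingI:
  assumes "orient k a b c > 0" "orient k a b d < 0" "orient k c d a * orient k c d b < 0"
  shows "crossing {a, b} {c, d}"
proof -
  let ?A = "orient k c d a" and ?B = "orient k c d b"
  let ?C = "orient k a b c" and ?D = "orient k a b d"
  define t where "t = ?A / (?A - ?B)"
  define r where "r = ?C / (?C - ?D)"
  have sgn: "?A < 0 \<and> ?B > 0 \<or> ?A > 0 \<and> ?B < 0"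
    using assms(3) by (auto simp: mult_less_0_iff)
  then have t: "0 < t" "t < 1" "t * (?A - ?B) = ?A"
    by (auto simp: t_def divide_simps)
  have r: "0 < r" "r < 1" "r * (?C - ?D) = ?C"
    using assms(1,2) by (auto simp: r_def divide_simps)
  \<comment> \<open>Both differences are the cross product of the directions \<open>b - a\<close>
    and \<open>d - c\<close>, which up to sign is the denominator of both \<open>t\<close> and
    \<open>r\<close>.\<close>
  have rel: "?A - ?B = ?D - ?C" unfolding orient_def by algebra
  have ne: "?A - ?B \<noteq> 0" using sgn by auto
  have coord: "(?A - ?B) * ((1 - t) * x + t * y) = (?A - ?B) * x - ?A * (x - y)" for x y
  proof -
    have "(?A - ?B) * ((1 - t) * x + t * y) = (?A - ?B) * x - (t * (?A - ?B)) * (x - y)"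
      by (simp add: algebra_simps)
    then show ?thesis unfolding t(3) .
  qed
  have coord': "(?A - ?B) * ((1 - r) * x + r * y) = (?A - ?B) * x + ?C * (x - y)" for x y
  proof -
    have "(?A - ?B) * ((1 - r) * x + r * y) = (?A - ?B) * x + (r * (?C - ?D)) * (x - y)"
      unfolding rel by (simp add: algebra_simps)
    then show ?thesis unfolding r(3) .
  qed
  have "(?A - ?B) * ((1 - t) * a $ j + t * b $ j) = (?A - ?B) * ((1 - r) * c $ j + r * d $ j)"
    if "j = k \<or> j = other_axis k" for j
    unfolding coord coord' using that
  proof 
    assume j: "j = k" show "(?A - ?B) * a $ j - ?A * (a $ j - b $ j) = (?A - ?B) * c $ j + ?C * (c $ j - d $ j)"
      unfolding orient_def j by algebra
  next
    assume j: "j = other_axis k" show "(?A - ?B) * a $ j - ?A * (a $ j - b $ j) = (?A - ?B) * c $ j + ?C * (c $ j - d $ j)"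
      unfolding orient_def j by algebra
  qed
  then have eq: "(1 - t) *\<^sub>R a + t *\<^sub>R b = (1 - r) *\<^sub>R c + r *\<^sub>R d"
    using ne unfolding point_eq_iff[of _ _ k] by simp
  have "a \<noteq> b" "c \<noteq> d" using assms by auto
  then have "(1 - t) *\<^sub>R a + t *\<^sub>R b \<in> open_segment a b" "(1 - t) *\<^sub>R a + t *\<^sub>R b \<in> open_segment c d"
    using t r eq by (auto simp: in_segment)
  moreover have "{a, b} \<noteq> {c, d}" using assms by (auto simp: doubleton_eq_iff)
  ultimately show ?thesis unfolding crossing_iff by blast
qed

lemma not_crossing_common_endpoint:
  assumes "orient k p a b \<noteq> 0"
  shows "\<not> crossing {p, a} {p, b}"
proof
  assume "crossing {p, a} {p, b}"
  then obtain x where x: "x \<in> open_segment p a" "x \<in> open_segment p b"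
    unfolding crossing_iff by blast
  obtain t where t: "0 < t" "t < 1" "x = (1 - t) *\<^sub>R p + t *\<^sub>R b"
    using x(2) by (rule in_open_segmentE)
  have "orient k p a x = 0" using x(1) by (rule orient_open_segment_zero)
  then have "t * orient k p a b = 0" unfolding t(3) orient_affine by simp
  with t assms show False by simp
qed

lemma segmentsI: "p \<in> X \<Longrightarrow> q \<in> X \<Longrightarrow> p \<noteq> q \<Longrightarrow> {p, q} \<in> segments X"
  unfolding segments_def by blast

section \<open>Triangulations of star-shaped configurations\<close>

text \<open>Triangulations of a polygon with vertices \<open>i\<close> to \<open>j\<close>, encoded
  by index pairs alone so that the same one can be drawn in two point sets. The rule
  \<open>split\<close> cuts off the triangle with apex \<open>l\<close> on the base
  \<open>(i, j)\<close>; the base and all chain edges belong to the set.\<close>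

inductive polygon_triangulation :: "nat \<Rightarrow> nat \<Rightarrow> (nat \<times> nat) set \<Rightarrow> bool" where
  edge: "polygon_triangulation i (Suc i) {(i, Suc i)}"
| split: "\<lbrakk>polygon_triangulation i l A; polygon_triangulation l j B\<rbrakk>
    \<Longrightarrow> polygon_triangulation i j (insert (i, j) (A \<union> B))"

lemma polygon_triangulation_less: "polygon_triangulation i j D \<Longrightarrow> i < j"
  by (induction rule: polygon_triangulation.induct) auto

lemma polygon_triangulation_base: "polygon_triangulation i j D \<Longrightarrow> (i, j) \<in> D"
  by (induction rule: polygon_triangulation.induct) auto

lemma polygon_triangulation_range:
  "polygon_triangulation i j D \<Longrightarrow> (a, b) \<in> D \<Longrightarrow> i \<le> a \<and> a < b \<and> b \<le> j"
proof (induction arbitrary: a b rule: polygon_triangulation.induct)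
  case (split i l A j B)
  from split.hyps[THEN polygon_triangulation_less] split.IH split.prems show ?case
    by fastforce
qed auto

lemma polygon_triangulation_laminar:
  assumes "polygon_triangulation i j D" "(a, b) \<in> D" "(c, d) \<in> D"
  shows "b \<le> c \<or> d \<le> a \<or> a \<le> c \<and> d \<le> b \<or> c \<le> a \<and> b \<le> d"
  using assms
proof (induction arbitrary: a b c d rule: polygon_triangulation.induct)
  case (split i l A j B)
  have A: "i \<le> x \<and> x < y \<and> y \<le> l" if "(x, y) \<in> A" for x y
    using polygon_triangulation_range[OF split.hyps(1) that] .
  have B: "l \<le> x \<and> x < y \<and> y \<le> j" if "(x, y) \<in> B" for x y
    using polygon_triangulation_range[OF split.hyps(2) that] .
  have l: "i < l" "l < j" using split.hyps[THEN polygon_triangulation_less] by auto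
  consider "(a, b) = (i, j)" | "(c, d) = (i, j)" | "(a, b) \<in> A" "(c, d) \<in> A"
    | "(a, b) \<in> A" "(c, d) \<in> B" | "(a, b) \<in> B" "(c, d) \<in> A" | "(a, b) \<in> B" "(c, d) \<in> B"
    using split.prems by blast
  then show ?case
  proof cases
    case 1
    then show ?thesis using A[of c d] B[of c d] l split.prems(2) by auto
  next
    case 2
    then show ?thesis using A[of a b] B[of a b] l split.prems(1) by auto
  next
    case 3
    then show ?thesis by (rule split.IH(1))
  next
    case 4
    then show ?thesis using A[of a b] B[of c d] by auto
  next
    case 5
    then show ?thesis using A[of c d] B[of a b] by auto
  next
    case 6
    then show ?thesis by (rule split.IH(2))
  qed
qed auto

text \<open>Descend to the subpolygon whose apex \<open>l\<close> separates \<open>a\<close> from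
  \<open>b\<close>. The pairs \<open>(p, l)\<close> and \<open>(l, q)\<close> are the sides of the
  triangle cut off there; its base \<open>(p, q)\<close> is in \<open>D\<close> and hence is not
  \<open>(a, b)\<close>. These sides will block a missing diagonal.\<close>

lemma polygon_triangulation_split:
  assumes "polygon_triangulation i j D" "i \<le> a" "a < b" "b \<le> j" "(a, b) \<notin> D"
  shows "\<exists>p l q. (p, l) \<in> D \<and> (l, q) \<in> D \<and> p \<le> a \<and> a < l \<and> l < b \<and> b \<le> q \<and> (p, q) \<noteq> (a, b)"
  using assms
proof (induction arbitrary: a b rule: polygon_triangulation.induct)
  case (split i l A j B)
  consider "b \<le> l" | "l \<le> a" | "a < l" "l < b" by linarith
  then show ?case
  proof cases
    case 1
    from split.IH(1)[OF split.prems(1,2) 1] split.prems show ?thesis by blast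
  next
    case 2
    from split.IH(2)[OF 2 split.prems(2,3)] split.prems show ?thesis by blast
  next
    case 3
    have "(i, l) \<in> A" "(l, j) \<in> B" using split.hyps[THEN polygon_triangulation_base] by auto
    with 3 split.prems show ?thesis by blast
  qed
qed auto

section \<open>Cyclic indices modulo 3\<close>

lemma mod_3_cases: "d mod 3 = c mod 3 \<or> d mod 3 = Suc c mod 3 \<or> c mod 3 = Suc d mod (3::nat)"
proof -
  have "d mod 3 < 3" "c mod 3 < 3" by simp_all
  then have "d mod 3 = 0 \<or> d mod 3 = 1 \<or> d mod 3 = 2" "c mod 3 = 0 \<or> c mod 3 = 1 \<or> c mod 3 = 2"
    by linarith+
  then show ?thesis by (auto simp: mod_Suc)
qed

lemma periodic_cong_mod_3:
  fixes f :: "nat \<Rightarrow> 'a"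
  assumes per: "\<And>c. f (c + 3) = f c" and "c mod 3 = d mod 3"
  shows "f c = f d"
proof -
  have mult: "f (r + 3 * q) = f r" for r q
  proof (induction q)
    case (Suc q)
    then show ?case using per[of "r + 3 * q"] by (simp add: algebra_simps)
  qed simp
  have "f c = f (c mod 3)" for c using mult[of "c mod 3" "c div 3"] by simp
  from this[of c] this[of d] assms(2) show ?thesis by simp
qed

text \<open>Chain \<open>c\<close> runs from one hull vertex to the next and is seen from
  \<open>s\<close> in strictly increasing angular order, over less than a half turn. The index
  \<open>c\<close> ranges over all naturals with period 3, so the three chains are interchangeable
  and the statements need no modular arithmetic. The chains may have any shape, as those of
  \<open>Q\<close> do.\<close>

locale star_configuration =
  fixes k :: 2 and s :: point and u :: "nat \<Rightarrow> nat \<Rightarrow> point" and m :: "nat \<Rightarrow> nat"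
  assumes u_periodic: "u (c + 3) = u c" and m_periodic: "m (c + 3) = m c"
    and u_join: "u c (m c) = u (Suc c) 0"
    and m_pos: "0 < m c"
    and radial: "i < j \<Longrightarrow> j \<le> m c \<Longrightarrow> orient k s (u c i) (u c j) > 0"
    and in_hull: "i \<le> m d \<Longrightarrow> orient k (u c 0) (u (Suc c) 0) (u d i) \<ge> 0"
    and gp: "general_position (insert s {u c i |c i. i \<le> m c})"
begin

text \<open>Among three chains any two are equal or cyclically adjacent, so crossing arguments
  between chains reduce to adjacent ones.\<close>

lemma chain_cases:
  obtains "u d = u c" "m d = m c" | "u d = u (Suc c)" "m d = m (Suc c)"
  | "u c = u (Suc d)" "m c = m (Suc d)"
proof -
  note eq = periodic_cong_mod_3[of u, OF u_periodic] periodic_cong_mod_3[of m, OF m_periodic]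
  from mod_3_cases[of d c] show ?thesis
  proof (elim disjE)
    assume "d mod 3 = c mod 3" note e = eq[OF this] show ?thesis by (rule that(1)[OF e])
  next
    assume "d mod 3 = Suc c mod 3" note e = eq[OF this] show ?thesis by (rule that(2)[OF e])
  next
    assume "c mod 3 = Suc d mod 3" note e = eq[OF this] show ?thesis by (rule that(3)[OF e])
  qed
qed

lemma u_third: "u (Suc (Suc c)) (m (Suc (Suc c))) = u c 0"
  using u_join[of "Suc (Suc c)"] u_periodic[of c] by (simp add: numeral_3_eq_3)

lemma radial_weak:
  assumes "i \<le> j" "j \<le> m c" shows "orient k s (u c i) (u c j) \<ge> 0"
  using assms radial[of i j c] by (cases "i = j") auto

lemma u_distinct: "i < j \<Longrightarrow> j \<le> m c \<Longrightarrow> u c i \<noteq> u c j"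
  using radial[of i j c] by auto

lemma s_distinct:
  assumes "i \<le> m c" shows "u c i \<noteq> s"
proof (cases "i = 0")
  case True
  then show ?thesis using radial[of 0 "m c" c] m_pos[of c] by auto
next
  case False
  then show ?thesis using radial[of 0 i c] assms by auto
qed

lemma gp_orient:
  assumes "i \<le> m a" "j \<le> m b" "l \<le> m c" "u a i \<noteq> u b j" "u b j \<noteq> u c l" "u a i \<noteq> u c l"
  shows "orient k (u a i) (u b j) (u c l) \<noteq> 0"
  by (rule general_position_orient[OF gp]) (use assms in blast)+

lemma gp_orient_s:
  assumes "j \<le> m b" "l \<le> m c" "u b j \<noteq> u c l"
  shows "orient k s (u b j) (u c l) \<noteq> 0"
  by (rule general_position_orient[OF gp]) (use assms s_distinct in blast)+

text \<open>Both ends lie in the closed sector at \<open>s\<close> spanned by the chain, and not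
  both on the same boundary ray. Chords of different chains therefore live in disjoint open
  sectors.\<close>

lemma wedge:
  assumes "i < j" "j \<le> m c" "x \<in> open_segment (u c i) (u c j)"
  shows "orient k s (u c 0) x > 0" "orient k s (u (Suc c) 0) x < 0"
proof -
  show "orient k s (u c 0) x > 0"
    using orient_open_segment_pos[OF assms(3), of k s "u c 0"] assms radial_weak[of 0 i c] radial[of 0 j c]
    by auto
  have "orient k (u c (m c)) s (u c j) \<ge> 0" "orient k (u c (m c)) s (u c i) > 0"
    using assms radial_weak[of j "m c" c] radial[of i "m c" c]
    by (simp_all add: orient_rotate'[of k "u c (m c)" s])
  then have "orient k (u c (m c)) s x > 0"
    using orient_open_segment_pos[OF assms(3), of k "u c (m c)" s] by auto
  then show "orient k s (u (Suc c) 0) x < 0"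
    unfolding u_join[of c] orient_swap[of k _ s] by simp
qed

text \<open>Scaling about \<open>s\<close> preserves the side of a line through \<open>s\<close>; a
  point of a spoke can thus be replaced by the outer end of the spoke.\<close>

lemma ray_sign:
  assumes "x \<in> open_segment s y" shows "\<exists>t>0. \<forall>a. orient k s a x = t * orient k s a y"
proof -
  obtain t where "0 < t" "t < 1" "x = (1 - t) *\<^sub>R s + t *\<^sub>R y"
    using assms by (rule in_open_segmentE)
  then show ?thesis by (intro exI[of _ t]) (simp add: orient_affine)
qed

lemma star_edges_not_crossing:
  assumes "i \<le> m c" "j \<le> m d"
  shows "\<not> crossing {s, u c i} {s, u d j}"
proof (cases "u c i = u d j")
  case True
  then show ?thesis by (simp add: crossing_iff)
next
  case False
  then have "orient k s (u c i) (u d j) \<noteq> 0"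
    using assms by (intro gp_orient_s)
  then show ?thesis by (rule not_crossing_common_endpoint)
qed

text \<open>A spoke can meet the chord only within the angular range of the chord. There it ends at
  a vertex that \<open>above\<close> puts on the side of \<open>s\<close>, so it stops before
  reaching the line of the chord.\<close>

lemma star_edge_chain_edge_not_crossing:
  assumes ij: "i < j" "j \<le> m c" and l: "l \<le> m d"
    and above: "\<And>l. i < l \<Longrightarrow> l < j \<Longrightarrow> orient k (u c i) (u c j) (u c l) > 0"
  shows "\<not> crossing {s, u d l} {u c i, u c j}"
proof
  assume "crossing {s, u d l} {u c i, u c j}"
  then obtain x where x: "x \<in> open_segment s (u d l)" "x \<in> open_segment (u c i) (u c j)"
    unfolding crossing_iff by blast
  obtain t where t: "t > 0" "\<And>a. orient k s a x = t * orient k s a (u d l)"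
    using ray_sign[OF x(1)] by blast
  have w: "orient k s (u c 0) (u d l) > 0" "orient k s (u (Suc c) 0) (u d l) < 0"
    using wedge[OF ij x(2)] t by (auto simp: zero_less_mult_iff mult_less_0_iff)
  show False
  proof (rule chain_cases[of d c])
    assume d: "u d = u c" "m d = m c"
    have 0: "orient k s (u c l) x = 0"
      using orient_open_segment_zero[OF x(1)] d by simp
    consider "l \<le> i" | "j \<le> l" | "i < l" "l < j" by linarith
    then show False
    proof cases
      case 1
      then have "orient k s (u c l) x > 0"
        using orient_open_segment_pos[OF x(2), of k s "u c l"] radial_weak[of l i c] radial[of l j c] ij
        by auto
      with 0 show False by simp
    next
      case 2
      then have "orient k (u c l) s (u c j) \<ge> 0" "orient k (u c l) s (u c i) > 0"
        using ij l d radial_weak[of j l c] radial[of i l c]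
        by (simp_all add: orient_rotate'[of k "u c l" s])
      then have "orient k (u c l) s x > 0"
        using orient_open_segment_pos[OF x(2), of k "u c l" s] by auto
      with 0 show False by (simp add: orient_swap[of k _ s])
    next
      case 3
      have "orient k (u c i) (u c j) s > 0" using radial[OF ij] by (simp add: orient_rotate[of k _ _ s])
      then have "orient k (u c i) (u c j) x > 0"
        using orient_open_segment_pos[OF x(1), of k "u c i" "u c j"] above[OF 3] d by auto
      with orient_open_segment_zero[OF x(2)] show False by simp
    qed
  next
    assume d: "u d = u (Suc c)" "m d = m (Suc c)"
    with w(2) radial_weak[of 0 l "Suc c"] l show False by simp
  next
    assume d: "u c = u (Suc d)" "m c = m (Suc d)"
    have "orient k s (u d l) (u d (m d)) \<ge> 0" using l by (intro radial_weak) auto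
    then show False using w(1) u_join[of d] d by (simp add: orient_swap'[of k s _ "u d l"])
  qed
qed

lemma different_chains_not_crossing:
  assumes "i < j" "j \<le> m c" "a < b" "b \<le> m (Suc c)"
  shows "\<not> crossing {u c i, u c j} {u (Suc c) a, u (Suc c) b}"
proof
  assume "crossing {u c i, u c j} {u (Suc c) a, u (Suc c) b}"
  then obtain x where "x \<in> open_segment (u c i) (u c j)" "x \<in> open_segment (u (Suc c) a) (u (Suc c) b)"
    unfolding crossing_iff by blast
  with wedge(2)[OF assms(1,2)] wedge(1)[OF assms(3,4)] show False by fastforce
qed

lemma separated_chain_edges_not_crossing:
  assumes "i < j" "j \<le> a" "a < b" "b \<le> m c"
  shows "\<not> crossing {u c i, u c j} {u c a, u c b}"
proof
  assume "crossing {u c i, u c j} {u c a, u c b}"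
  then obtain x where x: "x \<in> open_segment (u c i) (u c j)" "x \<in> open_segment (u c a) (u c b)"
    unfolding crossing_iff by blast
  have "orient k s (u c j) x > 0"
    using orient_open_segment_pos[OF x(2), of k s "u c j"] assms radial_weak[of j a c] radial[of j b c] by auto
  moreover have "orient k (u c j) s (u c i) > 0"
    using radial[of i j c] assms by (simp add: orient_rotate'[of k "u c j" s])
  then have "orient k (u c j) s x > 0"
    using orient_open_segment_pos[OF x(1), of k "u c j" s] by auto
  ultimately show False by (simp add: orient_swap[of k _ s])
qed

text \<open>Each end of the inner chord is on the side of \<open>s\<close> or shared with the outer
  chord, and not both are shared; so its open segment stays off the line of the outer chord.\<close>

lemma nested_chain_edges_not_crossing:
  assumes "i \<le> a" "a < b" "b \<le> j" "j \<le> m c"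
    and above: "\<And>l. i < l \<Longrightarrow> l < j \<Longrightarrow> orient k (u c i) (u c j) (u c l) > 0"
  shows "\<not> crossing {u c i, u c j} {u c a, u c b}"
proof (cases "a = i \<and> b = j")
  case True
  then show ?thesis by (simp add: crossing_iff)
next
  case False
  show ?thesis
  proof
    assume "crossing {u c i, u c j} {u c a, u c b}"
    then obtain x where x: "x \<in> open_segment (u c i) (u c j)" "x \<in> open_segment (u c a) (u c b)"
      unfolding crossing_iff by blast
    have a: "a = i \<or> orient k (u c i) (u c j) (u c a) > 0" using above[of a] assms by force
    have b: "b = j \<or> orient k (u c i) (u c j) (u c b) > 0" using above[of b] assms by force
    have "orient k (u c i) (u c j) x > 0"
      using a b False by (intro orient_open_segment_pos[OF x(2)]) auto
    with orient_open_segment_zero[OF x(1)] show False by simp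
  qed
qed

text \<open>Seen from \<open>s\<close>, the hull vertex lies between the two ends. If the segment
  did not cut the spoke to it, the vertex would be inside the triangle of \<open>s\<close> and the
  ends, which is impossible for a corner of the hull.\<close>

lemma crossing_star_edge:
  assumes v: "i \<le> m d" "i' \<le> m d'"
    and o: "orient k s (u d i) (u (Suc c) 0) > 0" "orient k s (u (Suc c) 0) (u d' i') > 0"
      "orient k s (u d i) (u d' i') > 0"
  shows "crossing {u d i, u d' i'} {s, u (Suc c) 0}"
proof -
  let ?v = "u d i" and ?w = "u d' i'" and ?V = "u (Suc c) 0"
  have 1: "orient k ?v ?w s > 0" using o(3) by (simp add: orient_rotate[of k _ _ s])
  have ne: "orient k ?v ?w ?V \<noteq> 0"
    using o by (intro gp_orient v le0) auto
  \<comment> \<open>The functional of the hull edge ending in \<open>?V\<close>: zero at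
    \<open>?V\<close>, nonnegative at all chain points, positive at \<open>s\<close>.\<close>
  let ?F = "orient k (u c 0) ?V"
  have F: "?F ?v \<ge> 0" "?F ?w \<ge> 0"
    using v by (auto intro: in_hull)
  have Fs: "?F s > 0" 
    using radial[of 0 "m c" c] m_pos[of c] u_join[of c] by (simp add: orient_rotate[of k _ _ s])
  have neg: "orient k ?v ?w ?V < 0"
  proof (rule ccontr)
    assume "\<not> ?thesis"
    with ne have pos: "orient k ?v ?w ?V > 0" by simp
    have "orient k s ?v ?w * ?F ?V = orient k ?v ?w ?V * ?F s + orient k ?w s ?V * ?F ?v + orient k s ?v ?V * ?F ?w"
      by (rule orient_barycentric)
    moreover have "orient k ?w s ?V = orient k s ?V ?w" by (rule orient_rotate')
    moreover have "orient k ?v ?w ?V * ?F s > 0" using pos Fs by simp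
    moreover have "orient k s ?V ?w * ?F ?v \<ge> 0" "orient k s ?v ?V * ?F ?w \<ge> 0" using F o by simp_all
    ultimately show False by simp
  qed
  have "orient k s ?V ?v * orient k s ?V ?w < 0"
    using o by (simp add: orient_swap'[of k s ?v ?V] mult_neg_pos)
  then show ?thesis using 1 neg by (intro crossingI[of k]) auto
qed

text \<open>The turn about \<open>s\<close> of less than a half circle from one point to the other
  passes a hull vertex: the one shared by the two chains, or one met when going round the other
  way.\<close>

lemma crossing_star_edge_of_different_chains:
  assumes i: "i \<le> m c" and j: "j \<le> m (Suc c)"
    and not_same: "\<And>d. \<not> (u c i \<in> u d ` {..m d} \<and> u (Suc c) j \<in> u d ` {..m d})"
  shows "\<exists>d. crossing {u c i, u (Suc c) j} {s, u d 0}"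
proof -
  let ?v = "u c i" and ?w = "u (Suc c) j"
  let ?V0 = "u c 0" and ?V1 = "u (Suc c) 0" and ?V2 = "u (Suc (Suc c)) 0"
  have c3: "u (Suc (Suc (Suc c))) = u c" using u_periodic[of c] by (simp add: numeral_3_eq_3)
  have "i \<noteq> m c"
  proof
    assume "i = m c"
    then have "?v \<in> u (Suc c) ` {..m (Suc c)}" using u_join[of c] by auto
    with not_same[of "Suc c"] j show False by auto
  qed
  with i have im: "i < m c" by simp
  have "j \<noteq> 0"
  proof
    assume "j = 0"
    then have "?w \<in> u c ` {..m c}" using u_join[of c, symmetric] by simp
    with not_same[of c] i show False by auto
  qed
  then have j0: "j > 0" by simp
  have vV1: "orient k s ?v ?V1 > 0" using radial[OF im order_refl] u_join[of c] by simp
  have V1w: "orient k s ?V1 ?w > 0" using radial[OF j0 j] .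
  have V1V2: "orient k s ?V1 ?V2 > 0"
    using radial[of 0 "m (Suc c)" "Suc c"] m_pos[of "Suc c"] u_join[of "Suc c"] by simp
  have V2V0: "orient k s ?V2 ?V0 > 0"
    using radial[of 0 "m (Suc (Suc c))" "Suc (Suc c)"] m_pos[of "Suc (Suc c)"] u_third[of c] by simp
  have "?v \<noteq> ?w" using not_same[of "Suc c"] j by force
  then have "orient k s ?v ?w \<noteq> 0"
    using i j by (intro gp_orient_s)
  then consider "orient k s ?v ?w > 0" | "orient k s ?w ?v > 0"
    using orient_swap'[of k s ?w ?v] by linarith
  then show ?thesis
  proof cases
    case 1
    then have "crossing {?v, ?w} {s, ?V1}" using i j vV1 V1w by (intro crossing_star_edge)
    then show ?thesis by blast
  next
    case wv: 2
    show ?thesis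
    proof (cases "j = m (Suc c)")
      case False
      then have wV2: "orient k s ?w ?V2 > 0" using radial[of j "m (Suc c)" "Suc c"] j u_join[of "Suc c"] by simp
      have "orient k s ?V2 ?v > 0"
      proof (rule ccontr)
        assume "\<not> ?thesis"
        then have 1: "orient k s ?v ?V2 \<ge> 0" by (simp add: orient_swap'[of k s ?V2 ?v])
        \<comment> \<open>Three-term Pluecker relation for the directions from \<open>s\<close>; it
          would make the turn from \<open>?v\<close> to \<open>?w\<close> positive, contrary to the
          present case.\<close>
        have "orient k s ?V1 ?V2 * orient k s ?v ?w 
          = orient k s ?V1 ?w * orient k s ?v ?V2 + orient k s ?v ?V1 * orient k s ?w ?V2"
          unfolding orient_def by algebra
        moreover have "orient k s ?V1 ?w * orient k s ?v ?V2 \<ge> 0" using V1w 1 by simp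
        moreover have "orient k s ?v ?V1 * orient k s ?w ?V2 > 0" using vV1 wV2 by simp
        ultimately have "orient k s ?V1 ?V2 * orient k s ?v ?w > 0" by linarith
        with V1V2 have "orient k s ?v ?w > 0" by (simp add: zero_less_mult_iff)
        with wv show False by (simp add: orient_swap'[of k s ?v ?w])
      qed
      then have "crossing {?w, ?v} {s, ?V2}" using i j wV2 wv by (intro crossing_star_edge)
      then show ?thesis by (auto simp: insert_commute)
    next
      \<comment> \<open>Here \<open>?w\<close> is itself the hull vertex \<open>?V2\<close>, so the
        spoke that is crossed is the one to \<open>?V0\<close>.\<close>
      case True
      then have w: "?w = ?V2" using u_join[of "Suc c"] by simp
      have "i \<noteq> 0"
      proof
        assume "i = 0"
        then have "?v = u (Suc (Suc c)) (m (Suc (Suc c)))" using u_third[of c] by simp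
        moreover have "?w \<in> u (Suc (Suc c)) ` {..m (Suc (Suc c))}" using w by simp
        ultimately show False using not_same[of "Suc (Suc c)"] by simp
      qed
      then have "orient k s (u (Suc (Suc (Suc c))) 0) ?v > 0" using radial[of 0 i c] i c3 by simp
      moreover have "orient k s ?w (u (Suc (Suc (Suc c))) 0) > 0" using w V2V0 c3 by simp
      ultimately have "crossing {?w, ?v} {s, u (Suc (Suc (Suc c))) 0}"
        using i j wv by (intro crossing_star_edge)
      then show ?thesis by (auto simp: insert_commute)
    qed
  qed
qed

text \<open>The vertices \<open>i\<close> and \<open>l\<close> are each on the side of
  \<open>s\<close> of the other chord. By two determinant identities this forces the outer ends
  \<open>a\<close> and \<open>j\<close> to the far sides, so the interleaving chords cross.\<close>

lemma radial_crossing_left: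
  assumes "a < i" "i < l" "l < j" "j \<le> m c"
    and "orient k (u c a) (u c l) (u c i) > 0" "orient k (u c i) (u c j) (u c l) > 0"
  shows "crossing {u c i, u c j} {u c a, u c l}"
proof -
  let ?a = "u c a" and ?i = "u c i" and ?l = "u c l" and ?j = "u c j"
  have pos: "orient k s ?a ?i > 0" "orient k s ?i ?l > 0" "orient k s ?l ?j > 0" "orient k s ?i ?j > 0"
    "orient k s ?a ?l > 0"
    using assms radial by auto
  have "0 = orient k s ?i ?j * orient k ?a ?l ?i + orient k s ?i ?l * orient k ?i ?j ?a
      + orient k s ?a ?i * orient k ?i ?j ?l"
    unfolding orient_def by algebra
  moreover have "orient k s ?i ?j * orient k ?a ?l ?i > 0" "orient k s ?a ?i * orient k ?i ?j ?l > 0"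
    using pos assms by simp_all
  ultimately have "orient k s ?i ?l * orient k ?i ?j ?a < 0" by linarith
  then have 1: "orient k ?i ?j ?a < 0" using pos by (simp add: mult_less_0_iff)
  have "0 = orient k s ?a ?l * orient k ?i ?j ?l + orient k s ?l ?j * orient k ?a ?l ?i
      + orient k s ?i ?l * orient k ?a ?l ?j"
    unfolding orient_def by algebra
  moreover have "orient k s ?a ?l * orient k ?i ?j ?l > 0" "orient k s ?l ?j * orient k ?a ?l ?i > 0"
    using pos assms by simp_all
  ultimately have "orient k s ?i ?l * orient k ?a ?l ?j < 0" by linarith
  then have "orient k ?a ?l ?j < 0" using pos by (simp add: mult_less_0_iff)
  then have "crossing {?a, ?l} {?i, ?j}"
    using assms 1 by (intro crossingI[of k]) (auto simp: mult_neg_pos)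
  then show ?thesis by (simp add: crossing_commute)
qed

lemma radial_crossing_right:
  assumes "i < l" "l < j" "j < b" "b \<le> m c"
    and "orient k (u c l) (u c b) (u c j) > 0" "orient k (u c i) (u c j) (u c l) > 0"
  shows "crossing {u c i, u c j} {u c l, u c b}"
proof -
  let ?b = "u c b" and ?i = "u c i" and ?l = "u c l" and ?j = "u c j"
  have pos: "orient k s ?j ?b > 0" "orient k s ?l ?j > 0" "orient k s ?i ?l > 0" "orient k s ?i ?j > 0"
    "orient k s ?l ?b > 0"
    using assms radial by auto
  have "0 = orient k s ?i ?j * orient k ?l ?b ?j + orient k s ?l ?j * orient k ?i ?j ?b
      + orient k s ?j ?b * orient k ?i ?j ?l"
    unfolding orient_def by algebra
  moreover have "orient k s ?i ?j * orient k ?l ?b ?j > 0" "orient k s ?j ?b * orient k ?i ?j ?l > 0"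
    using pos assms by simp_all
  ultimately have "orient k s ?l ?j * orient k ?i ?j ?b < 0" by linarith
  then have 1: "orient k ?i ?j ?b < 0" using pos by (simp add: mult_less_0_iff)
  have "0 = orient k s ?l ?b * orient k ?i ?j ?l + orient k s ?i ?l * orient k ?l ?b ?j
      + orient k s ?l ?j * orient k ?l ?b ?i"
    unfolding orient_def by algebra
  moreover have "orient k s ?l ?b * orient k ?i ?j ?l > 0" "orient k s ?i ?l * orient k ?l ?b ?j > 0"
    using pos assms by simp_all
  ultimately have "orient k s ?l ?j * orient k ?l ?b ?i < 0" by linarith
  then have "orient k ?l ?b ?i < 0" using pos by (simp add: mult_less_0_iff)
  then have "crossing {?l, ?b} {?j, ?i}"
    using assms 1 by (intro crossingI[of k]) (auto simp: mult_neg_pos orient_swap[of k ?i ?j])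
  then show ?thesis by (subst crossing_commute) (simp add: insert_commute)
qed

end

section \<open>Spokes and pocket diagonals form a triangulation\<close>

locale star_triangulation = star_configuration +
  fixes D :: "nat \<Rightarrow> (nat \<times> nat) set"
  assumes D_periodic: "D (c + 3) = D c"
    and D_triangulation: "polygon_triangulation 0 (m c) (D c)"
    and D_above: "(i, j) \<in> D c \<Longrightarrow> i < l \<Longrightarrow> l < j \<Longrightarrow> orient k (u c i) (u c j) (u c l) > 0"
begin

definition edges :: "point set set" where
  "edges = {{s, u c i} |c i. i \<le> m c} \<union> {{u c i, u c j} |c i j. (i, j) \<in> D c}"

lemma star_edge_in_edges: "i \<le> m c \<Longrightarrow> {s, u c i} \<in> edges"
  unfolding edges_def by blast

lemma chain_edge_in_edges: "(i, j) \<in> D c \<Longrightarrow> {u c i, u c j} \<in> edges"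
  unfolding edges_def by blast

lemma edgesE:
  assumes "e \<in> edges"
  obtains c i where "e = {s, u c i}" "i \<le> m c" | c i j where "e = {u c i, u c j}" "(i, j) \<in> D c"
  using assms unfolding edges_def by blast

lemma D_range: "(i, j) \<in> D c \<Longrightarrow> i < j \<and> j \<le> m c"
  using polygon_triangulation_range[OF D_triangulation] by blast

lemma chain_cases_D:
  obtains "u d = u c" "m d = m c" "D d = D c" | "u d = u (Suc c)" "m d = m (Suc c)" "D d = D (Suc c)"
  | "u c = u (Suc d)" "m c = m (Suc d)" "D c = D (Suc d)"
proof -
  note eq = periodic_cong_mod_3[of u, OF u_periodic] periodic_cong_mod_3[of m, OF m_periodic]
    periodic_cong_mod_3[of D, OF D_periodic]
  from mod_3_cases[of d c] show ?thesis
  proof (elim disjE)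
    assume "d mod 3 = c mod 3" note e = eq[OF this] show ?thesis by (rule that(1)[OF e])
  next
    assume "d mod 3 = Suc c mod 3" note e = eq[OF this] show ?thesis by (rule that(2)[OF e])
  next
    assume "c mod 3 = Suc d mod 3" note e = eq[OF this] show ?thesis by (rule that(3)[OF e])
  qed
qed

lemma chain_edges_not_crossing:
  assumes e: "(i, j) \<in> D c" and f: "(a, b) \<in> D d"
  shows "\<not> crossing {u c i, u c j} {u d a, u d b}"
proof (rule chain_cases_D[of d c])
  assume d: "u d = u c" "m d = m c" "D d = D c"
  have f': "(a, b) \<in> D c" using f d by simp
  note r = D_range[OF e] D_range[OF f']
  consider "j \<le> a" | "b \<le> i" | "i \<le> a" "b \<le> j" | "a \<le> i" "j \<le> b"
    using polygon_triangulation_laminar[OF D_triangulation e f'] by blast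
  then have "\<not> crossing {u c i, u c j} {u c a, u c b}"
  proof cases
    case 1 then show ?thesis using r by (intro separated_chain_edges_not_crossing) auto
  next
    case 2
    then have "\<not> crossing {u c a, u c b} {u c i, u c j}"
      using r by (intro separated_chain_edges_not_crossing) auto
    then show ?thesis by (simp add: crossing_commute)
  next
    case 3 then show ?thesis using r D_above[OF e] by (intro nested_chain_edges_not_crossing) auto
  next
    case 4
    then have "\<not> crossing {u c a, u c b} {u c i, u c j}"
      using r D_above[OF f'] by (intro nested_chain_edges_not_crossing) auto
    then show ?thesis by (simp add: crossing_commute)
  qed
  then show ?thesis using d by simp
next
  assume "u d = u (Suc c)" "m d = m (Suc c)" "D d = D (Suc c)"
  then show ?thesis using different_chains_not_crossing[of i j c a b] D_range[OF e] D_range[OF f] by simp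
next
  assume "u c = u (Suc d)" "m c = m (Suc d)" "D c = D (Suc d)"
  then have "\<not> crossing {u d a, u d b} {u c i, u c j}"
    using different_chains_not_crossing[of a b d i j] D_range[OF e] D_range[OF f] by simp
  then show ?thesis by (simp add: crossing_commute)
qed

lemma edges_pairwise_noncrossing: "pairwise_noncrossing edges"
proof -
  have star_chain: "\<not> crossing {s, u d l} {u c i, u c j}" if "(i, j) \<in> D c" "l \<le> m d" for c d i j l
    using D_range[OF that(1)] D_above[OF that(1)] that(2)
    by (intro star_edge_chain_edge_not_crossing) auto
  show ?thesis
    unfolding pairwise_noncrossing_def
  proof (intro ballI)
    fix e f assume "e \<in> edges" "f \<in> edges"
    from this(1) show "\<not> crossing e f"
    proof (cases rule: edgesE)
      case e: (1 c i)
      from \<open>f \<in> edges\<close> show ?thesis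
        by (cases rule: edgesE) (use e star_edges_not_crossing star_chain in simp_all)
    next
      case e: (2 c i j)
      from \<open>f \<in> edges\<close> show ?thesis
      proof (cases rule: edgesE)
        case (1 d l)
        then show ?thesis using e star_chain by (subst crossing_commute) simp
      next
        case (2 d a b)
        then show ?thesis using e chain_edges_not_crossing by simp
      qed
    qed
  qed
qed

lemma same_chain_crossing:
  assumes "i < j" "j \<le> m c" "(i, j) \<notin> D c"
  shows "\<exists>e\<in>edges. crossing {u c i, u c j} e"
proof -
  obtain a l b where alb: "(a, l) \<in> D c" "(l, b) \<in> D c" "a \<le> i" "i < l" "l < j" "j \<le> b" "(a, b) \<noteq> (i, j)"
    using polygon_triangulation_split[OF D_triangulation _ assms(1,2,3)] by blast
  have b: "b \<le> m c" using D_range[OF alb(2)] by simp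
  have edges: "{s, u c l} \<in> edges" "{u c a, u c l} \<in> edges" "{u c l, u c b} \<in> edges"
    using alb b by (auto intro!: star_edge_in_edges chain_edge_in_edges)
  have "orient k (u c i) (u c j) (u c l) \<noteq> 0"
    using alb b assms u_distinct[of i j c] u_distinct[of i l c] u_distinct[of l j c]
    by (intro gp_orient) auto
  then consider "orient k (u c i) (u c j) (u c l) < 0" | "orient k (u c i) (u c j) (u c l) > 0"
    by linarith
  then show ?thesis
  proof cases
    case 1
    have "orient k (u c i) (u c j) s > 0" using radial[OF assms(1,2)] by (simp add: orient_rotate[of k _ _ s])
    moreover have "orient k s (u c l) (u c i) < 0" "orient k s (u c l) (u c j) > 0"
      using radial[of i l c] radial[of l j c] alb b orient_swap'[of k s "u c i" "u c l"] by auto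
    ultimately have "crossing {u c i, u c j} {s, u c l}"
      using 1 by (intro crossingI[of k]) (auto simp: mult_neg_pos)
    with edges show ?thesis by blast
  next
    case 2
    show ?thesis
    proof (cases "a = i")
      case False
      then have "crossing {u c i, u c j} {u c a, u c l}"
        using alb b 2 D_above[OF alb(1), of i] by (intro radial_crossing_left) auto
      with edges show ?thesis by blast
    next
      \<comment> \<open>Now \<open>b\<close> differs from \<open>j\<close>, because
        \<open>(a, b)\<close> is not \<open>(i, j)\<close>.\<close>
      case True
      then have "crossing {u c i, u c j} {u c l, u c b}"
        using alb b 2 D_above[OF alb(2), of j] by (intro radial_crossing_right) auto
      with edges show ?thesis by blast
    qed
  qed
qed

lemma crossing_edge_exists:
  assumes v: "i \<le> m c" and w: "j \<le> m d" and ne: "u c i \<noteq> u d j"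
    and nin: "{u c i, u d j} \<notin> edges"
  shows "\<exists>e\<in>edges. crossing {u c i, u d j} e"
proof (cases "\<exists>b. u c i \<in> u b ` {..m b} \<and> u d j \<in> u b ` {..m b}")
  case True
  then obtain b i' j' where b: "u c i = u b i'" "i' \<le> m b" "u d j = u b j'" "j' \<le> m b" by auto
  with ne have "i' \<noteq> j'" by auto
  then consider "i' < j'" | "j' < i'" by linarith
  then show ?thesis
  proof cases
    case 1
    have "(i', j') \<notin> D b" using nin b chain_edge_in_edges[of i' j' b] by auto
    then show ?thesis using same_chain_crossing[OF 1 b(4)] b by simp
  next
    case 2
    have "(j', i') \<notin> D b" using nin b chain_edge_in_edges[of j' i' b] by (auto simp: insert_commute)
    then show ?thesis using same_chain_crossing[OF 2 b(2)] b by (simp add: insert_commute)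
  qed
next
  case False
  have star: "{s, u b 0} \<in> edges" for b by (simp add: star_edge_in_edges)
  show ?thesis
  proof (rule chain_cases[of d c])
    assume "u d = u c" "m d = m c"
    with False v w show ?thesis by auto
  next
    assume "u d = u (Suc c)" "m d = m (Suc c)"
    with False v w have "\<exists>b. crossing {u c i, u d j} {s, u b 0}"
      using crossing_star_edge_of_different_chains[of i c j] by simp
    with star show ?thesis by blast
  next
    assume "u c = u (Suc d)" "m c = m (Suc d)"
    with False v w have "\<exists>b. crossing {u d j, u c i} {s, u b 0}"
      using crossing_star_edge_of_different_chains[of j d i] by auto
    with star show ?thesis by (auto simp: insert_commute)
  qed
qed

text \<open>All spokes are present, so a segment that could still be added joins two chain points,
  and \<open>crossing_edge_exists\<close> provides a drawn edge that crosses it.\<close>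

theorem triangulation_edges: "triangulation (insert s {u c i |c i. i \<le> m c}) edges"
proof -
  let ?X = "insert s {u c i |c i. i \<le> m c}"
  have "edges \<subseteq> segments ?X"
  proof
    fix e assume "e \<in> edges"
    then show "e \<in> segments ?X"
    proof (cases rule: edgesE)
      case (1 c i)
      then show ?thesis using s_distinct[of i c] by (auto intro!: segmentsI)
    next
      case (2 c i j)
      then show ?thesis using D_range[of i j c] u_distinct[of i j c] by (force intro!: segmentsI)
    qed
  qed
  moreover have "T' = edges" if T': "edges \<subseteq> T'" "T' \<subseteq> segments ?X" "pairwise_noncrossing T'" for T'
  proof (rule ccontr)
    assume "T' \<noteq> edges"
    then obtain e where e: "e \<in> T'" "e \<notin> edges" using T' by blast
    then obtain p q where pq: "e = {p, q}" "p \<in> ?X" "q \<in> ?X" "p \<noteq> q"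
      using T'(2) unfolding segments_def by blast
    have star: "{s, x} \<in> edges" if "x \<in> ?X" "x \<noteq> s" for x
      using that star_edge_in_edges by blast
    have "p \<noteq> s" using star[of q] pq e by blast
    moreover have "q \<noteq> s" using star[of p] pq e by (simp add: insert_commute) blast
    ultimately
    obtain c i d j where "p = u c i" "i \<le> m c" "q = u d j" "j \<le> m d" using pq by blast
    then obtain f where "f \<in> edges" "crossing e f"
      using crossing_edge_exists[of i c j d] pq(1,4) e(2) by auto
    then show False using T' e unfolding pairwise_noncrossing_def by blast
  qed
  ultimately show ?thesis
    unfolding triangulation_def using edges_pairwise_noncrossing by blast
qed

end

section \<open>Half-planes, generic points and Helly's theorem in the plane\<close>

lemma orient_pos_or_swap_axes:
  assumes "orient k p q r \<noteq> 0"
  obtains k' where "orient k' p q r > 0"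
proof (cases "orient k p q r > 0")
  case True
  then show ?thesis by (rule that)
next
  case False
  then have "orient (other_axis k) p q r > 0" using assms by (simp add: orient_swap_axes)
  then show ?thesis by (rule that)
qed

lemma continuous_orient: "continuous_on A (\<lambda>x. orient k p q x)"
  unfolding orient_def by (intro continuous_intros)

lemma open_orient_pos: "open {x. orient k p q x > 0}"
  by (rule open_Collect_less[OF continuous_on_const continuous_orient])

lemma convex_orient_pos: "convex {x. orient k p q x > 0}"
proof (rule convexI)
  fix x y and a b :: real
  assume *: "x \<in> {x. orient k p q x > 0}" "y \<in> {x. orient k p q x > 0}" "0 \<le> a" "0 \<le> b" "a + b = 1"
  have a: "a = 1 - b" using * by simp
  have "orient k p q (a *\<^sub>R x + b *\<^sub>R y) = a * orient k p q x + b * orient k p q y"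
    unfolding a by (rule orient_affine)
  moreover have "a * orient k p q x \<ge> 0" "b * orient k p q y \<ge> 0"
    "a * orient k p q x > 0 \<or> b * orient k p q y > 0"
    using * by (auto simp: less_le)
  ultimately show "a *\<^sub>R x + b *\<^sub>R y \<in> {x. orient k p q x > 0}" by auto
qed

lemma orient_nonneg_convex_hull:
  assumes "y \<in> convex hull X" "\<And>x. x \<in> X \<Longrightarrow> orient k p q x \<ge> 0"
  shows "orient k p q y \<ge> 0"
proof -
  have "convex {x. orient k p q x \<ge> 0}"
  proof (rule convexI)
    fix x y and a b :: real
    assume *: "x \<in> {x. orient k p q x \<ge> 0}" "y \<in> {x. orient k p q x \<ge> 0}" "0 \<le> a" "0 \<le> b" "a + b = 1"
    have a: "a = 1 - b" using * by simp
    have "orient k p q (a *\<^sub>R x + b *\<^sub>R y) = a * orient k p q x + b * orient k p q y"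
      unfolding a by (rule orient_affine)
    then show "a *\<^sub>R x + b *\<^sub>R y \<in> {x. orient k p q x \<ge> 0}" using * by simp
  qed
  then have "convex hull X \<subseteq> {x. orient k p q x \<ge> 0}"
    using assms(2) by (intro hull_minimal) auto
  with assms(1) show ?thesis by blast
qed

lemma ex_not_on_line:
  assumes "p \<noteq> q" shows "\<exists>r. orient k p q r \<noteq> 0"
proof -
  define r :: point where "r = (\<chi> i. if i = k then p $ k - (q $ other_axis k - p $ other_axis k)
    else p $ other_axis k + (q $ k - p $ k))"
  have "other_axis k \<noteq> k" using exhaust_2[of k] by (auto simp: other_axis_def)
  then have "orient k p q r = (q $ k - p $ k)\<^sup>2 + (q $ other_axis k - p $ other_axis k)\<^sup>2"
    unfolding orient_def r_def by (simp add: power2_eq_square algebra_simps)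
  moreover have "q $ k - p $ k \<noteq> 0 \<or> q $ other_axis k - p $ other_axis k \<noteq> 0"
    using assms by (auto simp: point_eq_iff[of p q k])
  ultimately have "orient k p q r \<noteq> 0" by (auto simp: sum_power2_eq_zero_iff)
  then show ?thesis ..
qed

lemma open_avoids_finitely_many_lines:
  assumes "finite L" "\<And>p q. (p, q) \<in> L \<Longrightarrow> p \<noteq> q" "open U" "U \<noteq> {}"
  shows "\<exists>x\<in>U. \<forall>(p, q)\<in>L. orient k p q x \<noteq> 0"
  using assms
proof (induction L arbitrary: U rule: finite_induct)
  case empty
  then show ?case by auto
next
  case (insert l L)
  obtain p q where l: "l = (p, q)" by (cases l)
  let ?V = "U \<inter> {x. orient k p q x \<noteq> 0}"
  have "open {x. orient k p q x \<noteq> 0}"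
    by (rule open_Collect_neq[OF continuous_orient continuous_on_const])
  then have "open ?V" using insert.prems by blast
  moreover have "?V \<noteq> {}"
  proof -
    obtain x where x: "x \<in> U" using insert.prems by blast
    show ?thesis
    proof (cases "orient k p q x = 0")
      case True
      \<comment> \<open>From a point \<open>x\<close> on the line, move a little towards a point
        \<open>r\<close> off the line: openness keeps the point in \<open>U\<close>, and affinity
        takes it off the line.\<close>
      obtain r where r: "orient k p q r \<noteq> 0" using ex_not_on_line[of p q] insert.prems(1) l by blast
      have "((\<lambda>t. (1 - t) *\<^sub>R x + t *\<^sub>R r) \<longlongrightarrow> (1 - 0) *\<^sub>R x + 0 *\<^sub>R r) (at_right 0)"
        by (intro tendsto_intros)
      then have "\<forall>\<^sub>F t in at_right 0. (1 - t) *\<^sub>R x + t *\<^sub>R r \<in> U"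
        using topological_tendstoD[OF _ insert.prems(2)] x by simp
      moreover have "\<forall>\<^sub>F t in at_right (0::real). t > 0" by (rule eventually_at_right_less)
      ultimately have "\<forall>\<^sub>F t in at_right 0. (1 - t) *\<^sub>R x + t *\<^sub>R r \<in> U \<and> t > 0"
        by eventually_elim auto
      then obtain t where t: "(1 - t) *\<^sub>R x + t *\<^sub>R r \<in> U" "t > 0"
        using eventually_happens'[OF trivial_limit_at_right_real] by blast
      have "orient k p q ((1 - t) *\<^sub>R x + t *\<^sub>R r) \<noteq> 0" unfolding orient_affine using True r t by simp
      with t show ?thesis by blast
    qed (use x in blast)
  qed
  ultimately obtain x where "x \<in> ?V" "\<forall>(p, q)\<in>L. orient k p q x \<noteq> 0"
    using insert.IH[of ?V] insert.prems(1) by blast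
  then show ?case using l by auto
qed

lemma general_position_insert_generic:
  assumes "finite X" "general_position X" "open U" "U \<noteq> {}"
  shows "\<exists>s\<in>U. general_position (insert s X) \<and> (\<forall>p\<in>X. \<forall>q\<in>X. p \<noteq> q \<longrightarrow> orient k p q s \<noteq> 0)"
proof -
  let ?L = "{(p, q). p \<in> X \<and> q \<in> X \<and> p \<noteq> q}"
  have "finite ?L" by (rule finite_subset[of _ "X \<times> X"]) (use assms in auto)
  then have "\<exists>s\<in>U. \<forall>(p, q)\<in>?L. orient k p q s \<noteq> 0"
    by (rule open_avoids_finitely_many_lines) (use assms in auto)
  then obtain s where s: "s \<in> U" "\<forall>(p, q)\<in>?L. orient k p q s \<noteq> 0"
    by blast
  have *: "orient k p q s \<noteq> 0" if "p \<in> X" "q \<in> X" "p \<noteq> q" for p q using s(2) that by auto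
  have "general_position (insert s X)"
  proof (rule general_positionI)
    fix p q r assume "p \<in> insert s X" "q \<in> insert s X" "r \<in> insert s X" and ne: "p \<noteq> q" "q \<noteq> r" "p \<noteq> r"
    then consider "p \<in> X" "q \<in> X" "r \<in> X" | "p = s" "q \<in> X" "r \<in> X" | "q = s" "p \<in> X" "r \<in> X" | "r = s" "p \<in> X" "q \<in> X"
      by auto
    then show "orient k p q r \<noteq> 0"
    proof cases
      case 1 then show ?thesis using assms(2) ne by (intro general_position_orient)
    next
      case 2 then show ?thesis using *[of q r] ne by (simp add: orient_rotate'[of k s q r])
    next
      case 3 then show ?thesis using *[of p r] ne by (simp add: orient_swap'[of k p s r])
    next
      case 4 then show ?thesis using *[of p q] ne by simp
    qed
  qed
  with s(1) * show ?thesis by blast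
qed

text \<open>The indices in \<open>three\<close> may coincide, which settles families with fewer than
  three different sets; the others are instances of Helly's theorem.\<close>

lemma Helly_plane:
  fixes H :: "'i \<Rightarrow> point set"
  assumes "finite I" "\<And>i. i \<in> I \<Longrightarrow> convex (H i)"
    and three: "\<And>i j l. \<lbrakk>i \<in> I; j \<in> I; l \<in> I\<rbrakk> \<Longrightarrow> H i \<inter> H j \<inter> H l \<noteq> {}"
  shows "\<Inter>(H ` I) \<noteq> {}"
proof (cases "card (H ` I) \<ge> 3")
  case True
  show ?thesis
  proof (rule Helly)
    show "card (H ` I) \<ge> DIM(point) + 1" using True by simp
    show "\<forall>s\<in>H ` I. convex s" using assms(2) by blast
    fix t assume t: "t \<subseteq> H ` I" "card t = DIM(point) + 1"
    then have "card t = 3" by simp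
    then obtain X Y Z where XYZ: "t = {X, Y, Z}" by (auto simp: card_3_iff)
    with t(1) have "X \<in> H ` I" "Y \<in> H ` I" "Z \<in> H ` I" by auto
    then obtain i j l where "i \<in> I" "j \<in> I" "l \<in> I" "X = H i" "Y = H j" "Z = H l" by (elim imageE)
    with three[of i j l] show "\<Inter>t \<noteq> {}" unfolding XYZ by (simp add: Int_assoc)
  qed
next
  case False
  then have "card (H ` I) = 0 \<or> card (H ` I) = 1 \<or> card (H ` I) = 2" by linarith
  then consider "H ` I = {}" | "card (H ` I) = 1" | "card (H ` I) = 2"
    using assms(1) by auto
  then show ?thesis
  proof cases
    case 1 then show ?thesis by simp
  next
    case 2
    then obtain X where X: "H ` I = {X}" by (auto simp: card_1_singleton_iff)
    then have "X \<in> H ` I" by simp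
    then obtain i where "i \<in> I" "X = H i" by (elim imageE)
    with three[of i i i] X show ?thesis by simp
  next
    case 3
    then obtain X Y where X: "H ` I = {X, Y}" by (auto simp: card_2_iff)
    then have "X \<in> H ` I" "Y \<in> H ` I" by simp_all
    then obtain i j where "i \<in> I" "X = H i" "j \<in> I" "Y = H j" by (elim imageE)
    with three[of i j j] X show ?thesis by (simp add: Int_assoc)
  qed
qed

section \<open>Unavoidable edges, convex polygons and sides of chords\<close>

lemma finite_segments: "finite S \<Longrightarrow> finite (segments S)"
  by (rule finite_subset[of _ "Pow S"]) (auto simp: segments_def)

lemma ex_triangulation_containing:
  assumes "finite S" "e \<in> segments S"
  shows "\<exists>T. triangulation S T \<and> e \<in> T"
proof -
  let ?\<T> = "{T. T \<subseteq> segments S \<and> pairwise_noncrossing T \<and> e \<in> T}"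
  have fin: "finite ?\<T>" by (rule finite_subset[of _ "Pow (segments S)"]) (use assms finite_segments in auto)
  have "{e} \<in> ?\<T>" using assms(2) by (auto simp: pairwise_noncrossing_def crossing_def)
  from finite_has_maximal2[OF fin this] obtain T where
    T: "T \<in> ?\<T>" and max: "\<forall>T'\<in>?\<T>. T \<subseteq> T' \<longrightarrow> T = T'"
    by (elim bexE conjE)
  have "T' = T" if "T \<subseteq> T'" "T' \<subseteq> segments S" "pairwise_noncrossing T'" for T'
  proof -
    have "T' \<in> ?\<T>" using T that by auto
    with bspec[OF max this] that(1) show ?thesis by simp
  qed
  then have "triangulation S T" using T unfolding triangulation_def by simp
  with T show ?thesis by auto
qed

text \<open>Extend \<open>f\<close> to a triangulation; it contains \<open>e\<close>. This is the
  form in which unavoidability enters the geometry.\<close>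

lemma unavoidable_not_crossing:
  assumes "finite S" "unavoidable S e" "f \<in> segments S"
  shows "\<not> crossing f e"
proof -
  obtain T where T: "triangulation S T" "f \<in> T" using ex_triangulation_containing[OF assms(1,3)] by auto
  then have "e \<in> T" using assms(2) unfolding unavoidable_def by simp
  with T show ?thesis unfolding triangulation_def pairwise_noncrossing_def by simp
qed

text \<open>A hull edge is an exposed face, cut out by a supporting functional a \<bullet> z - b.
  Since \<open>orient k p q\<close> vanishes on the same line it is a multiple of this functional,
  which is negative at all other points of \<open>X\<close>.\<close>

lemma hull_edge_same_side:
  assumes "finite X" "general_position X" "{p, q} \<in> hull_edges X"
    and x: "x \<in> X" "x \<noteq> p" "x \<noteq> q" and y: "y \<in> X" "y \<noteq> p" "y \<noteq> q"
  shows "orient k p q x * orient k p q y > 0"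
proof -
  obtain p' q' where "{p, q} = {p', q'}" "p' \<in> hull_vertices X" "q' \<in> hull_vertices X"
    "closed_segment p' q' edge_of (convex hull X)"
    using assms(3) unfolding hull_edges_def by blast
  then have pq: "p \<in> X" "q \<in> X" "closed_segment p q face_of (convex hull X)" "aff_dim (closed_segment p q) = 1"
    using extreme_point_of_convex_hull unfolding hull_vertices_def edge_of_def
    by (auto simp: doubleton_eq_iff closed_segment_commute)
  then have "p \<noteq> q" by auto
  have off: "z \<notin> closed_segment p q" if "z \<in> X" "z \<noteq> p" "z \<noteq> q" for z
  proof
    assume "z \<in> closed_segment p q"
    then have "z \<in> open_segment p q" using that by (simp add: open_segment_def)
    then have "orient k p q z = 0" by (rule orient_open_segment_zero)
    moreover have "orient k p q z \<noteq> 0"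
      using that pq \<open>p \<noteq> q\<close> by (intro general_position_orient[OF assms(2)]) auto
    ultimately show False by simp
  qed
  have hull: "z \<in> convex hull X" if "z \<in> X" for z using that by (rule hull_inc)
  have "closed_segment p q exposed_face_of (convex hull X)"
    using pq(3) exposed_face_of_polyhedron[OF polyhedron_convex_hull[OF assms(1)]] by blast
  moreover have "closed_segment p q \<noteq> convex hull X" using off[OF x] hull[OF x(1)] by blast
  ultimately obtain a b where ab: "a \<noteq> 0" "convex hull X \<subseteq> {x. a \<bullet> x \<le> b}"
    "closed_segment p q = convex hull X \<inter> {x. a \<bullet> x = b}"
    unfolding exposed_face_of by auto
  have lt: "a \<bullet> z < b" if "z \<in> X" "z \<noteq> p" "z \<noteq> q" for z
    using ab(2,3) off[OF that] hull[OF that(1)] by fastforce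
  have "p \<in> closed_segment p q" "q \<in> closed_segment p q" by auto
  then have eq: "a \<bullet> p = b" "a \<bullet> q = b" using ab(3) by blast+
  have inner: "a \<bullet> z = a $ k * z $ k + a $ other_axis k * z $ other_axis k" for z
    using exhaust_2[of k] by (auto simp: inner_vec_def UNIV_2 other_axis_def)
  \<comment> \<open>As \<open>a\<close> is orthogonal to \<open>q - p\<close>, these identities
    express the proportionality of the two functionals coordinate by coordinate, without
    division.\<close>
  have aux: "a1 * (d1 * y2 - d2 * y1) = - d2 * (a1 * y1 + a2 * y2)"
    "a2 * (d1 * y2 - d2 * y1) = d1 * (a1 * y1 + a2 * y2)"
    if "a1 * d1 + a2 * d2 = 0" for a1 a2 d1 d2 y1 y2 :: real
    using that by algebra+
  have "a $ k * (q $ k - p $ k) + a $ other_axis k * (q $ other_axis k - p $ other_axis k) = 0"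
    using eq unfolding inner by (simp add: algebra_simps)
  note aux = aux[OF this]
  have shift: "a $ k * (z $ k - p $ k) + a $ other_axis k * (z $ other_axis k - p $ other_axis k) = a \<bullet> z - b" for z
    using eq(1) unfolding inner by (simp add: algebra_simps)
  have kz: "a $ k * orient k p q z = - (q $ other_axis k - p $ other_axis k) * (a \<bullet> z - b)" for z
    unfolding orient_def aux shift by simp
  have oz: "a $ other_axis k * orient k p q z = (q $ k - p $ k) * (a \<bullet> z - b)" for z
    unfolding orient_def aux shift by simp
  have "a $ k * (orient k p q x * (a \<bullet> y - b)) = a $ k * (orient k p q y * (a \<bullet> x - b))"
    "a $ other_axis k * (orient k p q x * (a \<bullet> y - b)) = a $ other_axis k * (orient k p q y * (a \<bullet> x - b))"
    using kz[of x] kz[of y] oz[of x] oz[of y] by (simp_all add: mult.assoc[symmetric])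
  moreover have "a $ k \<noteq> 0 \<or> a $ other_axis k \<noteq> 0" using ab(1) by (auto simp: point_eq_iff[of a 0 k])
  ultimately have e: "orient k p q x * (a \<bullet> y - b) = orient k p q y * (a \<bullet> x - b)" by auto
  have "orient k p q x * orient k p q y * (a \<bullet> y - b) = orient k p q y * (orient k p q x * (a \<bullet> y - b))"
    by simp
  also have "\<dots> = (orient k p q y)\<^sup>2 * (a \<bullet> x - b)"
    unfolding e by (simp add: power2_eq_square)
  finally have "orient k p q x * orient k p q y * (a \<bullet> y - b) = (orient k p q y)\<^sup>2 * (a \<bullet> x - b)" .
  moreover have neg: "a \<bullet> y - b < 0" "a \<bullet> x - b < 0" using lt x y by auto
  moreover have "orient k p q y \<noteq> 0"
    using y pq \<open>p \<noteq> q\<close> by (intro general_position_orient[OF assms(2)]) auto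
  ultimately have "orient k p q x * orient k p q y * (a \<bullet> y - b) < 0" by (simp add: mult_pos_neg)
  with neg show ?thesis by (simp add: mult_less_0_iff)
qed

text \<open>Each edge has all other vertices on one side, and consecutive edges lie in a common
  vertex triple, so the sign of the first triple travels along the polygon. General triples follow
  by advancing the last vertex, with a Pluecker relation at \<open>vs ! i\<close>.\<close>

lemma convex_polygon_orient_pos:
  assumes poly: "convex_polygon vs" and gp: "general_position (set vs)"
    and start: "orient k (vs ! 0) (vs ! 1) (vs ! 2) > 0"
    and ijl: "i < j" "j < l" "l < length vs"
  shows "orient k (vs ! i) (vs ! j) (vs ! l) > 0"
proof -
  let ?v = "\<lambda>i. vs ! i"
  have dist: "distinct vs" using poly unfolding convex_polygon_def by simp
  have edge: "{?v i, ?v (Suc i)} \<in> hull_edges (set vs)" if "Suc i < length vs" for i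
  proof -
    have "{?v i, ?v (Suc i)} \<in> cycle_edges vs"
      unfolding cycle_edges_def using that by (intro CollectI exI[of _ i]) auto
    then show ?thesis using poly unfolding convex_polygon_def by simp
  qed
  have same: "orient k (?v i) (?v (Suc i)) (?v x) > 0"
    if "orient k (?v i) (?v (Suc i)) (?v y) > 0" "Suc i < length vs" "x < length vs" "y < length vs"
      "x \<noteq> i" "x \<noteq> Suc i" "y \<noteq> i" "y \<noteq> Suc i" for i x y
  proof -
    have "orient k (?v i) (?v (Suc i)) (?v x) * orient k (?v i) (?v (Suc i)) (?v y) > 0"
      by (rule hull_edge_same_side[OF _ gp edge[OF that(2)]])
        (use that dist in \<open>auto simp: nth_eq_iff_index_eq\<close>)
    with that(1) show ?thesis by (simp add: zero_less_mult_iff)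
  qed
  have sides: "orient k (?v i) (?v (Suc i)) (?v x) > 0"
    if "Suc i < length vs" "x < length vs" "x \<noteq> i" "x \<noteq> Suc i" for i x
    using that
  proof (induction i arbitrary: x)
    case 0
    show ?case
      by (rule same[of 0 2]) (use start 0 ijl in \<open>auto simp: numeral_2_eq_2\<close>)
  next
    case (Suc i)
    have "orient k (?v i) (?v (Suc i)) (?v (Suc (Suc i))) > 0" using Suc by auto
    then have "orient k (?v (Suc i)) (?v (Suc (Suc i))) (?v i) > 0" by (simp add: orient_rotate[of k _ _ "?v i"])
    then show ?case by (rule same) (use Suc.prems in auto)
  qed
  show ?thesis
    using ijl(2,3)
  proof (induction l)
    case (Suc l)
    show ?case
    proof (cases "l = j")
      case True
      have "orient k (?v j) (?v (Suc j)) (?v i) > 0" using sides[of j i] Suc.prems True ijl(1) by auto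
      then show ?thesis using True by (simp add: orient_rotate[of k _ _ "?v i"])
    next
      case False
      with Suc.prems have jl: "j < l" by simp
      then have IH: "orient k (?v i) (?v j) (?v l) > 0" using Suc by auto
      have step: "orient k (?v i) (?v l) (?v (Suc l)) > 0"
        using sides[of l i] Suc.prems jl ijl(1) by (simp add: orient_rotate[of k _ _ "?v i"])
      show ?thesis
      proof (cases "j = Suc i")
        case True
        then show ?thesis using sides[of i "Suc l"] Suc.prems ijl(1) by auto
      next
        case False
        have e: "orient k (?v i) (?v (Suc i)) (?v x) > 0" if "Suc i < x" "x < length vs" for x
          using sides[of i x] that by auto
        have "orient k (?v i) (?v (Suc i)) (?v l) * orient k (?v i) (?v j) (?v (Suc l))
          = orient k (?v i) (?v (Suc i)) (?v (Suc l)) * orient k (?v i) (?v j) (?v l)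
            + orient k (?v i) (?v (Suc i)) (?v j) * orient k (?v i) (?v l) (?v (Suc l))"
          unfolding orient_def by algebra
        moreover have "orient k (?v i) (?v (Suc i)) (?v (Suc l)) * orient k (?v i) (?v j) (?v l) > 0"
          "orient k (?v i) (?v (Suc i)) (?v j) * orient k (?v i) (?v l) (?v (Suc l)) > 0"
          using e IH step False ijl(1) jl Suc.prems by simp_all
        ultimately have "orient k (?v i) (?v (Suc i)) (?v l) * orient k (?v i) (?v j) (?v (Suc l)) > 0"
          by linarith
        moreover have "orient k (?v i) (?v (Suc i)) (?v l) > 0" using e[of l] False ijl(1) jl Suc.prems by simp
        ultimately show ?thesis by (simp add: zero_less_mult_iff)
      qed
    qed
  qed simp
qed

text \<open>Chords are treated from the longest inwards. Suppose \<open>y\<close> is left of a chord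
  but right of the chord with one end moved by one step. Not being inside the triangle formed with
  the skipped chain edge, \<open>y\<close> lies across that edge, and the segment from
  \<open>y\<close> to the fixed end crosses it.\<close>

lemma left_of_chords:
  assumes conv: "\<And>i j l. i < j \<Longrightarrow> j < l \<Longrightarrow> l \<le> m \<Longrightarrow> orient k (u i) (u j) (u l) < 0"
    and base: "orient k (u 0) (u m) y > 0"
    and off: "\<And>i j. i < j \<Longrightarrow> j \<le> m \<Longrightarrow> orient k (u i) (u j) y \<noteq> 0"
    and not_crossing: "\<And>i j. i < m \<Longrightarrow> j \<le> m \<Longrightarrow> \<not> crossing {y, u j} {u i, u (Suc i)}"
    and not_inside: "\<And>i j l. i < j \<Longrightarrow> j < l \<Longrightarrow> l \<le> m \<Longrightarrow>
      \<not> (orient k (u i) (u j) y < 0 \<and> orient k (u j) (u l) y < 0 \<and> orient k (u l) (u i) y < 0)"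
    and "i < j" "j \<le> m"
  shows "orient k (u i) (u j) y > 0"
  using \<open>i < j\<close> \<open>j \<le> m\<close>
proof (induction "m - (j - i)" arbitrary: i j rule: less_induct)
  case less
  consider "i = 0" "j = m" | a where "i = Suc a" | "j < m" using less.prems by (cases i) (auto simp: le_less)
  then show ?case
  proof cases
    case 1
    then show ?thesis using base by simp
  next
    case 2
    have a: "orient k (u a) (u j) y > 0" using less 2 by auto
    have c: "orient k (u a) (u i) (u j) < 0" using conv[of a i j] less.prems 2 by simp
    have sw: "orient k (u j) (u a) y = - orient k (u a) (u j) y" by (rule orient_swap)
    show ?thesis
    proof (rule ccontr)
      assume "\<not> ?thesis"
      with off[OF less.prems] have b: "orient k (u i) (u j) y < 0" by simp
      with not_inside[of a i j] 2 less.prems a sw have "\<not> orient k (u a) (u i) y < 0" by auto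
      with off[of a i] 2 less.prems have "orient k (u a) (u i) y > 0" by simp
      moreover have "orient k y (u j) (u a) < 0" "orient k y (u j) (u i) > 0"
        using a b sw orient_swap[of k "u j" "u i" y] by (simp_all add: orient_rotate[of k _ _ y])
      ultimately have "crossing {u a, u i} {y, u j}"
        using c by (intro crossingI[of k]) (auto simp: mult_neg_pos)
      then show False using not_crossing[of a j] less.prems 2 by (auto simp: crossing_commute)
    qed
  next
    case 3
    let ?c = "u (Suc j)"
    have a: "orient k (u i) ?c y > 0" using less.hyps[of "Suc j" i] less.prems 3 by auto
    have c: "orient k (u i) (u j) ?c < 0" using conv[of i j "Suc j"] less.prems 3 by simp
    have sw: "orient k ?c (u i) y = - orient k (u i) ?c y" by (rule orient_swap)
    show ?thesis
    proof (rule ccontr)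
      assume "\<not> ?thesis"
      with off[OF less.prems] have b: "orient k (u i) (u j) y < 0" by simp
      with not_inside[of i j "Suc j"] 3 less.prems a sw have "\<not> orient k (u j) ?c y < 0" by auto
      with off[of j "Suc j"] 3 less.prems have "orient k (u j) ?c y > 0" by simp
      moreover have "orient k (u j) ?c (u i) < 0" using c by (simp add: orient_rotate[of k _ _ "u i"])
      moreover have "orient k y (u i) (u j) < 0" "orient k y (u i) ?c > 0"
        using a b by (simp_all add: orient_rotate[of k _ _ y])
      ultimately have "crossing {u j, ?c} {y, u i}"
        by (intro crossingI[of k]) (auto simp: mult_neg_pos)
      then show False using not_crossing[of j i] less.prems 3 by (auto simp: crossing_commute)
    qed
  qed
qed

text \<open>Seen from \<open>z\<close>, the point \<open>y\<close> appears between two consecutive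
  chain vertices \<open>u t\<close> and \<open>u (Suc t)\<close>. A point of the triangle would be
  on the chain side of their line while \<open>z\<close> is on the other side, so the segment from
  \<open>y\<close> to \<open>z\<close> would cross this chain edge.\<close>

lemma not_inside_chain_triangle:
  assumes conv: "\<And>i j l. i < j \<Longrightarrow> j < l \<Longrightarrow> l \<le> m \<Longrightarrow> orient k (u i) (u j) (u l) < 0"
    and off: "\<And>i j. i < j \<Longrightarrow> j \<le> m \<Longrightarrow> orient k (u i) (u j) y \<noteq> 0"
    and z: "\<And>i j. i < j \<Longrightarrow> j \<le> m \<Longrightarrow> orient k (u i) (u j) z > 0"
    and wedge: "orient k z (u 0) y > 0" "orient k z (u m) y < 0"
    and off_z: "\<And>i. i \<le> m \<Longrightarrow> orient k z (u i) y \<noteq> 0"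
    and not_crossing: "\<And>i. i < m \<Longrightarrow> \<not> crossing {y, z} {u i, u (Suc i)}"
    and ijl: "i < j" "j < l" "l \<le> m"
  shows "\<not> (orient k (u i) (u j) y < 0 \<and> orient k (u j) (u l) y < 0 \<and> orient k (u l) (u i) y < 0)"
proof
  assume inside: "orient k (u i) (u j) y < 0 \<and> orient k (u j) (u l) y < 0 \<and> orient k (u l) (u i) y < 0"
  have "\<exists>t<m. orient k z (u t) y > 0 \<and> orient k z (u (Suc t)) y < 0"
  proof (rule ccontr)
    assume no: "\<not> ?thesis"
    have "t \<le> m \<Longrightarrow> orient k z (u t) y > 0" for t
    proof (induction t)
      case (Suc t)
      then have "\<not> orient k z (u (Suc t)) y < 0" using no by auto
      then show ?case using off_z[of "Suc t"] Suc.prems by simp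
    qed (use wedge in simp)
    from this[of m] wedge show False by simp
  qed
  then obtain t where t: "t < m" "orient k z (u t) y > 0" "orient k z (u (Suc t)) y < 0" by blast
  let ?F = "orient k (u t) (u (Suc t))"
  have F: "?F (u x) \<le> 0" if "x \<le> m" for x
  proof -
    consider "x < t" | "x = t \<or> x = Suc t" | "Suc t < x" by linarith
    then show ?thesis
    proof cases
      case 1 then show ?thesis using conv[of x t "Suc t"] t(1) by (simp add: orient_rotate[of k _ _ "u x"])
    next
      case 2 then show ?thesis by auto
    next
      case 3 then show ?thesis using conv[of t "Suc t" x] that by simp
    qed
  qed
  have "orient k (u i) (u j) (u l) * ?F y
     = orient k (u j) (u l) y * ?F (u i) + orient k (u l) (u i) y * ?F (u j) + orient k (u i) (u j) y * ?F (u l)"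
    by (rule orient_barycentric)
  moreover have "orient k (u j) (u l) y * ?F (u i) \<ge> 0" "orient k (u l) (u i) y * ?F (u j) \<ge> 0"
    "orient k (u i) (u j) y * ?F (u l) \<ge> 0"
    using inside F[of i] F[of j] F[of l] ijl by (simp_all add: mult_nonpos_nonpos)
  ultimately have "orient k (u i) (u j) (u l) * ?F y \<ge> 0" by linarith
  with conv[OF ijl] have "?F y \<le> 0" by (simp add: zero_le_mult_iff)
  with off[of t "Suc t"] t(1) have Fy: "?F y < 0" by simp
  have "orient k z y (u t) < 0" "orient k z y (u (Suc t)) > 0"
    using t orient_swap'[of k z "u t" y] orient_swap'[of k z "u (Suc t)" y] by auto
  then have "crossing {u t, u (Suc t)} {z, y}"
    using Fy z[of t "Suc t"] t(1) by (intro crossingI[of k]) (auto simp: mult_neg_pos)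
  then show False using not_crossing[OF t(1)] by (simp add: crossing_commute insert_commute)
qed

section \<open>The kernel of a generalized double circle\<close>

lemma in_convex_hull_triangle:
  assumes "orient k a b c > 0" "orient k a b s \<ge> 0" "orient k b c s \<ge> 0" "orient k c a s \<ge> 0"
  shows "s \<in> convex hull {a, b, c}"
proof -
  let ?D = "orient k a b c"
  let ?u = "orient k b c s / ?D" and ?v = "orient k c a s / ?D" and ?w = "orient k a b s / ?D"
  have sum: "orient k b c s + orient k c a s + orient k a b s = ?D"
    using orient_sum[of k a b s c] by simp
  have "?u + ?v + ?w = 1" using sum assms(1) by (simp add: add_divide_distrib[symmetric])
  moreover have "?u \<ge> 0" "?v \<ge> 0" "?w \<ge> 0" using assms by simp_all
  moreover have "s = ?u *\<^sub>R a + ?v *\<^sub>R b + ?w *\<^sub>R c"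
  proof -
    have "?D * s $ k = orient k b c s * a $ k + orient k c a s * b $ k + orient k a b s * c $ k"
      unfolding orient_def by algebra
    moreover have "?D * s $ other_axis k = orient k b c s * a $ other_axis k
       + orient k c a s * b $ other_axis k + orient k a b s * c $ other_axis k"
      unfolding orient_def by algebra
    ultimately show ?thesis
      unfolding point_eq_iff[of s _ k] using assms(1) by (simp add: field_simps)
  qed
  ultimately show ?thesis unfolding convex_hull_3 
    by (intro CollectI exI[of _ ?u] exI[of _ ?v] exI[of _ ?w] conjI)
qed

lemma mod_3_pred:
  assumes "c mod 3 = Suc d mod (3::nat)" shows "Suc (Suc c) mod 3 = d mod 3"
proof -
  have "d mod 3 < 3" by simp
  then have "d mod 3 = 0 \<or> d mod 3 = 1 \<or> d mod 3 = 2" by linarith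
  with assms show ?thesis by (auto simp: mod_Suc)
qed

lemma general_position_subset: "general_position X \<Longrightarrow> Y \<subseteq> X \<Longrightarrow> general_position Y"
  unfolding general_position_def by (simp add: subset_iff)

section \<open>Chains along the edges of a triangle\<close>

definition chain :: "(nat \<Rightarrow> point) \<Rightarrow> (nat \<Rightarrow> point list) \<Rightarrow> nat \<Rightarrow> point list" where
  "chain V A c = V c # A c @ [V (Suc c)]"

definition chain_points :: "(nat \<Rightarrow> point) \<Rightarrow> (nat \<Rightarrow> point list) \<Rightarrow> point set" where
  "chain_points V A = (\<Union>c. set (chain V A c))"

text \<open>The setting common to both point sets: \<open>A c\<close> holds the inner points
  assigned to the edge from \<open>V c\<close> to \<open>V (Suc c)\<close>, and the cyclic order is
  positive with respect to \<open>k\<close>.\<close>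

locale chain_triangle =
  fixes k :: 2 and V :: "nat \<Rightarrow> point" and A :: "nat \<Rightarrow> point list"
  assumes V_periodic: "V (c + 3) = V c" and A_periodic: "A (c + 3) = A c"
    and distinct_cycle: "distinct (V c # A c @ V (Suc c) # A (Suc c) @ V (Suc (Suc c)) # A (Suc (Suc c)))"
    and positive: "orient k (V c) (V (Suc c)) (V (Suc (Suc c))) > 0"
    and points_in_hull: "x \<in> chain_points V A \<Longrightarrow> orient k (V c) (V (Suc c)) x \<ge> 0"
    and points_gp: "general_position (chain_points V A)"
begin

abbreviation u :: "nat \<Rightarrow> nat \<Rightarrow> point" where "u c i \<equiv> chain V A c ! i"

abbreviation m :: "nat \<Rightarrow> nat" where "m c \<equiv> Suc (length (A c))"

lemma V_third: "V (Suc (Suc (Suc c))) = V c"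
  using V_periodic[of c] by (simp add: numeral_3_eq_3)

lemma u_zero: "u c 0 = V c"
  by (simp add: chain_def)

lemma u_last: "u c (m c) = V (Suc c)"
  by (simp add: chain_def nth_append)

lemma length_chain: "length (chain V A c) = Suc (m c)"
  by (simp add: chain_def)

lemma set_chain: "set (chain V A c) = {u c i |i. i \<le> m c}"
  unfolding set_conv_nth length_chain by (auto simp: less_Suc_eq_le)

lemma u_in_chain: "i \<le> m c \<Longrightarrow> u c i \<in> set (chain V A c)"
  by (auto simp: set_chain)

lemma points_eq: "chain_points V A = {u c i |c i. i \<le> m c}"
  unfolding chain_points_def set_chain by blast

lemma u_in_points: "i \<le> m c \<Longrightarrow> u c i \<in> chain_points V A"
  unfolding points_eq by blast

lemma V_in_points: "V c \<in> chain_points V A"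
  using u_in_points[of 0 c] by (simp add: u_zero)

lemma chain_mod_cong: "c mod 3 = d mod 3 \<Longrightarrow> chain V A c = chain V A d"
proof (rule periodic_cong_mod_3[of "chain V A"])
  show "chain V A (c + 3) = chain V A c" for c
    using V_periodic[of c] V_periodic[of "Suc c"] A_periodic[of c] by (simp add: chain_def)
qed

lemma finite_points: "finite (chain_points V A)"
proof -
  have "chain V A (c mod 3) = chain V A c" "c mod 3 < 3" for c
    by (simp_all add: chain_mod_cong[of "c mod 3" c])
  then have "set (chain V A c) \<subseteq> (\<Union>d<3. set (chain V A d))" for c
    using UN_upper[of "c mod 3" "{..<3}" "\<lambda>d. set (chain V A d)"] by simp
  then have "chain_points V A \<subseteq> (\<Union>d<3. set (chain V A d))"
    unfolding chain_points_def by blast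
  then show ?thesis by (rule finite_subset) simp
qed

lemma distinct_chain: "distinct (chain V A c)"
  using distinct_cycle[of c] by (auto simp: chain_def)

lemma u_eq_iff: "i \<le> m c \<Longrightarrow> j \<le> m c \<Longrightarrow> u c i = u c j \<longleftrightarrow> i = j"
  using distinct_chain[of c] by (intro nth_eq_iff_index_eq) (simp_all add: length_chain)

lemma V_distinct: "V c \<noteq> V (Suc c)" "V c \<noteq> V (Suc (Suc c))" "V (Suc (Suc c)) \<noteq> V c"
  using distinct_cycle[of c] by auto

lemma opposite_vertex_notin_chain: "V (Suc (Suc c)) \<notin> set (chain V A c)"
  using distinct_cycle[of c] by (auto simp: chain_def)

lemma A_notin_chain:
  assumes "w \<in> set (A c)" "d mod 3 \<noteq> c mod 3"
  shows "w \<notin> set (chain V A d)"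
proof -
  have "w \<notin> set (chain V A (Suc c))" "w \<notin> set (chain V A (Suc (Suc c)))"
    using distinct_cycle[of c] assms(1) V_third[of c] by (auto simp: chain_def)
  moreover have "d mod 3 = Suc c mod 3 \<or> Suc (Suc c) mod 3 = d mod 3"
    using mod_3_cases[of d c] mod_3_pred[of c d] assms(2) by blast
  ultimately show ?thesis using chain_mod_cong[of d "Suc c"] chain_mod_cong[of "Suc (Suc c)" d] by auto
qed

lemma A_in_points: "w \<in> set (A c) \<Longrightarrow> w \<in> chain_points V A"
  unfolding chain_points_def by (auto simp: chain_def)

lemma orient_neq_0:
  assumes "p \<in> chain_points V A" "q \<in> chain_points V A" "r \<in> chain_points V A" "p \<noteq> q" "q \<noteq> r" "p \<noteq> r"
  shows "orient k p q r \<noteq> 0"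
  using general_position_orient[OF points_gp assms] .

lemma strictly_in_hull:
  assumes "x \<in> chain_points V A" "x \<noteq> V c" "x \<noteq> V (Suc c)"
  shows "orient k (V c) (V (Suc c)) x > 0"
proof -
  have "orient k (V c) (V (Suc c)) x \<noteq> 0"
    using assms V_distinct by (intro orient_neq_0 V_in_points) auto
  then show ?thesis using points_in_hull[OF assms(1), of c] by simp
qed

lemma star_configurationI:
  assumes radial: "\<And>c i j. i < j \<Longrightarrow> j \<le> m c \<Longrightarrow> orient k s (u c i) (u c j) > 0"
    and gp: "general_position (insert s (chain_points V A))"
  shows "star_configuration k s u m"
proof (rule star_configuration.intro)
  show "(!) (chain V A (c + 3)) = (!) (chain V A c)" for c
    by (rule arg_cong[of _ _ nth], rule chain_mod_cong) simp
  show "m (c + 3) = m c" for c using A_periodic[of c] by simp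
  show "u c (m c) = u (Suc c) 0" for c by (simp only: u_last u_zero)
  show "0 < m c" for c by simp
  show "orient k s (u c i) (u c j) > 0" if "i < j" "j \<le> m c" for c i j using that by (rule radial)
  show "orient k (u c 0) (u (Suc c) 0) (u d i) \<ge> 0" if "i \<le> m d" for c d i
    using points_in_hull[OF u_in_points[OF that]] by (simp only: u_zero)
  show "general_position (insert s {u c i |c i. i \<le> m c})"
    using gp unfolding points_eq .
qed

end

locale double_circle = chain_triangle +
  assumes A_nonempty: "A c \<noteq> []"
    and convex_chain: "convex_polygon (chain V A c)"
    and unavoidable_edge: "i < m c \<Longrightarrow> unavoidable (chain_points V A) {u c i, u c (Suc i)}"
begin

text \<open>\<open>convex_polygon\<close> leaves the sense of rotation open. The positive sense
  would put the first inner vertex on the outer side of the hull edge, so the chain bends towards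
  the interior.\<close>

lemma chain_concave:
  assumes "i < j" "j < l" "l \<le> m c"
  shows "orient k (u c i) (u c j) (u c l) < 0"
proof -
  have m2: "2 \<le> m c" using A_nonempty[of c] by (cases "A c") auto
  have gp: "general_position (set (chain V A c))"
    by (rule general_position_subset[OF points_gp]) (auto simp: chain_points_def)
  have first: "orient k (u c 0) (u c 1) (u c 2) \<noteq> 0"
    using m2 by (intro orient_neq_0 u_in_points) (auto simp: u_eq_iff)
  have "\<not> orient k (u c 0) (u c 1) (u c 2) > 0"
  proof
    assume "orient k (u c 0) (u c 1) (u c 2) > 0"
    then have "orient k (u c 0) (u c 1) (u c (m c)) > 0"
      by (rule convex_polygon_orient_pos[OF convex_chain gp]) (use m2 in \<open>auto simp: length_chain\<close>)
    moreover have "orient k (u c 0) (u c (m c)) (u c 1) \<ge> 0"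
      unfolding u_zero u_last using m2 by (intro points_in_hull u_in_points) auto
    ultimately show False by (simp add: orient_swap'[of k _ "u c (m c)"])
  qed
  with first have "orient (other_axis k) (u c 0) (u c 1) (u c 2) > 0"
    by (simp add: orient_swap_axes)
  then have "orient (other_axis k) (u c i) (u c j) (u c l) > 0"
    by (rule convex_polygon_orient_pos[OF convex_chain gp]) (use assms in \<open>auto simp: length_chain\<close>)
  then show ?thesis by (simp add: orient_swap_axes)
qed

lemma chain_edge_not_crossing:
  assumes "p \<in> chain_points V A" "q \<in> chain_points V A" "p \<noteq> q" "i < m c"
  shows "\<not> crossing {p, q} {u c i, u c (Suc i)}"
  by (rule unavoidable_not_crossing[OF finite_points unavoidable_edge[OF assms(4)] segmentsI[OF assms(1-3)]])

text \<open>\<open>left_of_chords\<close> is applied first to the opposite hull vertex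
  \<open>?z\<close>, which as a corner is inside no triangle of chain vertices. With
  \<open>?z\<close> as viewpoint, \<open>not_inside_chain_triangle\<close> then keeps the other
  points out of these triangles as well.\<close>

lemma left_of_chain:
  assumes y: "y \<in> chain_points V A" "y \<notin> set (chain V A c)" and ij: "i < j" "j \<le> m c"
  shows "orient k (u c i) (u c j) y > 0"
proof -
  have off: "orient k (u c i) (u c j) y \<noteq> 0"
    if "i < j" "j \<le> m c" "y \<in> chain_points V A" "y \<notin> set (chain V A c)" for i j y
    using that u_in_chain[of i c] u_in_chain[of j c] 
    by (intro orient_neq_0 u_in_points) (auto simp: u_eq_iff)
  have not_crossing: "\<not> crossing {y, u c j} {u c i, u c (Suc i)}"
    if "i < m c" "j \<le> m c" "y \<in> chain_points V A" "y \<notin> set (chain V A c)" for i j y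
    using that u_in_chain[of j c] by (intro chain_edge_not_crossing u_in_points) auto
  have base: "orient k (u c 0) (u c (m c)) y > 0"
    if "y \<in> chain_points V A" "y \<notin> set (chain V A c)" for y
    unfolding u_zero u_last using that by (intro strictly_in_hull) (auto simp: chain_def)
  let ?z = "V (Suc (Suc c))"
  note z_in = V_in_points[of "Suc (Suc c)"] opposite_vertex_notin_chain[of c]
  have z_not_inside: "\<not> (orient k (u c i) (u c j) ?z < 0 \<and> orient k (u c j) (u c l) ?z < 0 \<and> orient k (u c l) (u c i) ?z < 0)"
    if ijl: "i < j" "j < l" "l \<le> m c" for i j l
  proof
    assume inside: "orient k (u c i) (u c j) ?z < 0 \<and> orient k (u c j) (u c l) ?z < 0 \<and> orient k (u c l) (u c i) ?z < 0"
    \<comment> \<open>This functional is zero at \<open>?z\<close>, nonnegative on the chain and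
      positive at \<open>u c i\<close>, as \<open>i < m c\<close>; strictly inside the triangle it
      would be positive.\<close>
    let ?F = "orient k (V (Suc c)) ?z"
    have F: "?F (u c x) \<ge> 0" if "x \<le> m c" for x using that by (intro points_in_hull u_in_points)
    have "u c i \<noteq> u c (m c)" using ijl by (simp add: u_eq_iff)
    then have "?F (u c i) > 0"
      using ijl u_in_chain[of i c] opposite_vertex_notin_chain[of c]
      by (intro strictly_in_hull u_in_points) (auto simp: u_last)
    then have "orient k (u c j) (u c l) ?z * ?F (u c i) < 0"
      using inside by (simp add: mult_neg_pos)
    moreover have "orient k (u c l) (u c i) ?z * ?F (u c j) \<le> 0" "orient k (u c i) (u c j) ?z * ?F (u c l) \<le> 0"
      using inside F[of j] F[of l] ijl by (simp_all add: mult_nonpos_nonneg)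
    moreover have "orient k (u c i) (u c j) (u c l) * ?F ?z
       = orient k (u c j) (u c l) ?z * ?F (u c i) + orient k (u c l) (u c i) ?z * ?F (u c j)
         + orient k (u c i) (u c j) ?z * ?F (u c l)"
      by (rule orient_barycentric)
    ultimately show False by simp
  qed
  have z: "orient k (u c i) (u c j) ?z > 0" if "i < j" "j \<le> m c" for i j
    by (rule left_of_chords[where m = "m c", OF chain_concave base[OF z_in] off[OF _ _ z_in]
          not_crossing[OF _ _ z_in] z_not_inside that])
  show ?thesis
  proof (cases "y = ?z")
    case True
    then show ?thesis using z ij by simp
  next
    case False
    have 1: "orient k ?z (u c 0) y > 0"
      using strictly_in_hull[OF y(1), of "Suc (Suc c)"] False y(2) V_third[of c]
      by (auto simp: u_zero chain_def)
    have "orient k (V (Suc c)) ?z y > 0"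
      using y False by (intro strictly_in_hull) (auto simp: chain_def)
    then have 2: "orient k ?z (u c (m c)) y < 0"
      unfolding u_last by (simp add: orient_swap[of k ?z "V (Suc c)"])
    have 3: "orient k ?z (u c i) y \<noteq> 0" if "i \<le> m c" for i
      using that False y z_in u_in_chain[of i c] by (intro orient_neq_0 u_in_points) auto
    have 4: "\<not> crossing {y, ?z} {u c i, u c (Suc i)}" if "i < m c" for i
      using that False y z_in by (intro chain_edge_not_crossing) auto
    have inside: "\<not> (orient k (u c i) (u c j) y < 0 \<and> orient k (u c j) (u c l) y < 0 \<and> orient k (u c l) (u c i) y < 0)"
      if "i < j" "j < l" "l \<le> m c" for i j l
      by (rule not_inside_chain_triangle[where m = "m c", OF chain_concave off[OF _ _ y] z 1 2 3 4 that])
    show ?thesis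
      by (rule left_of_chords[where m = "m c", OF chain_concave base[OF y] off[OF _ _ y]
            not_crossing[OF _ _ y] inside ij])
  qed
qed

text \<open>By Helly three half-planes suffice. If their edges come from at most two chains, a point
  of \<open>A d\<close> for a chain \<open>d\<close> not among them is in all three. Otherwise take
  on each edge an end that is not a hull vertex: each half-plane has its own end on the boundary and
  the other two inside, hence it contains their centroid.\<close>

lemma kernel_nonempty: "(\<Inter>(c, i)\<in>(SIGMA c:{..<3}. {..<m c}). {x. orient k (u c i) (u c (Suc i)) x > 0}) \<noteq> {}"
proof -
  let ?I = "SIGMA c:{..<3}. {..<m c}"
  let ?H = "\<lambda>(c, i). {x. orient k (u c i) (u c (Suc i)) x > 0}"
  have on: "\<exists>w\<in>set (A c). orient k (u c i) (u c (Suc i)) w = 0" if "i < m c" for c i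
  proof (cases i)
    case 0
    have "u c 1 = A c ! 0" using A_nonempty[of c] by (simp add: chain_def nth_append)
    then show ?thesis using A_nonempty[of c] 0 by (intro bexI[of _ "u c 1"]) auto
  next
    case (Suc j)
    have "u c i = A c ! j" using Suc that by (simp add: chain_def nth_append)
    then show ?thesis using Suc that by (intro bexI[of _ "u c i"]) auto
  qed
  have left: "orient k (u c i) (u c (Suc i)) w > 0" if "i < m c" "w \<in> set (A d)" "c < 3" "d < 3" "c \<noteq> d" for c d i w
    using that A_notin_chain[of w d c] A_in_points[of w d] by (intro left_of_chain) auto
  have "\<Inter>(?H ` ?I) \<noteq> {}"
  proof (rule Helly_plane)
    show "finite ?I" by simp
    show "convex (?H i)" if "i \<in> ?I" for i using that convex_orient_pos by (auto split: prod.split)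
    fix e1 e2 e3 assume "e1 \<in> ?I" "e2 \<in> ?I" "e3 \<in> ?I"
    then obtain c1 i1 c2 i2 c3 i3 where e: "e1 = (c1, i1)" "e2 = (c2, i2)" "e3 = (c3, i3)"
      and c: "c1 < 3" "c2 < 3" "c3 < 3" and i: "i1 < m c1" "i2 < m c2" "i3 < m c3"
      by auto
    show "?H e1 \<inter> ?H e2 \<inter> ?H e3 \<noteq> {}"
    proof (cases "c1 = c2 \<or> c2 = c3 \<or> c1 = c3")
      case True
      then have "card {c1, c2, c3} \<le> 2" by (auto simp: card_insert_if)
      moreover have "card {..<3::nat} \<le> card {c1, c2, c3}" if "{..<3} \<subseteq> {c1, c2, c3}"
        using that by (intro card_mono) auto
      ultimately have "\<not> {..<3} \<subseteq> {c1, c2, c3}" by auto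
      then obtain d where d: "d < 3" "d \<noteq> c1" "d \<noteq> c2" "d \<noteq> c3" by auto
      have "hd (A d) \<in> set (A d)" using A_nonempty by simp
      then have "hd (A d) \<in> ?H e1 \<inter> ?H e2 \<inter> ?H e3"
        using d c i left unfolding e by auto
      then show ?thesis by blast
    next
      case False
      obtain w1 w2 w3 where w: "w1 \<in> set (A c1)" "orient k (u c1 i1) (u c1 (Suc i1)) w1 = 0"
        "w2 \<in> set (A c2)" "orient k (u c2 i2) (u c2 (Suc i2)) w2 = 0"
        "w3 \<in> set (A c3)" "orient k (u c3 i3) (u c3 (Suc i3)) w3 = 0"
        using on i by meson
      have centroid: "orient k p q ((1/3) *\<^sub>R (a + b + d)) = (orient k p q a + orient k p q b + orient k p q d) / 3" for p q a b d
        unfolding orient_def by (simp add: field_simps)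
      have "(1/3) *\<^sub>R (w1 + w2 + w3) \<in> ?H e1 \<inter> ?H e2 \<inter> ?H e3"
        using w c i False left[OF i(1) w(3)] left[OF i(1) w(5)] left[OF i(2) w(1)] left[OF i(2) w(5)]
          left[OF i(3) w(1)] left[OF i(3) w(3)]
        unfolding e by (simp add: centroid)
      then show ?thesis by blast
    qed
  qed
  then show ?thesis .
qed

lemma ex_star_center:
  obtains s where "star_configuration k s u m" "s \<in> convex hull {V 0, V 1, V 2}"
    "general_position (insert s (chain_points V A))"
proof -
  let ?I = "SIGMA c:{..<3}. {..<m c}"
  let ?U = "\<Inter>(c, i)\<in>?I. {x. orient k (u c i) (u c (Suc i)) x > 0}"
  have "open ?U" by (rule open_INT) (auto simp: open_orient_pos split: prod.split)
  then obtain s where s: "s \<in> ?U" "general_position (insert s (chain_points V A))"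
    using general_position_insert_generic[OF finite_points points_gp _ kernel_nonempty] by blast
  have chain_mod: "chain V A (c mod 3) = chain V A c" for c
    by (rule chain_mod_cong) simp
  have edge: "orient k (u c i) (u c (Suc i)) s > 0" if "i < m c" for c i
  proof -
    have "m (c mod 3) = m c" using chain_mod[of c] length_chain[of c] length_chain[of "c mod 3"] by simp
    then have "(c mod 3, i) \<in> ?I" using that by simp
    then have "orient k (u (c mod 3) i) (u (c mod 3) (Suc i)) s > 0" using s(1) by blast
    then show ?thesis unfolding chain_mod .
  qed
  \<comment> \<open>In the induction step the total in \<open>orient_sum\<close> is negative, as the
    chain bends inwards, and the first two terms are positive; so \<open>s\<close> is left of the
    closing chord too.\<close>
  have chord: "orient k (u c i) (u c j) s > 0" if "i < j" "j \<le> m c" for c i j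
    using that
  proof (induction j)
    case (Suc j)
    show ?case
    proof (cases "i = j")
      case True
      then show ?thesis using edge[of j c] Suc.prems by simp
    next
      case False
      then have "orient k (u c i) (u c j) s > 0" "orient k (u c j) (u c (Suc j)) s > 0"
        "orient k (u c i) (u c j) (u c (Suc j)) < 0"
        using Suc edge[of j c] chain_concave[of i j "Suc j" c] by auto
      moreover have "orient k (u c i) (u c j) s + orient k (u c j) (u c (Suc j)) s + orient k (u c (Suc j)) (u c i) s
        = orient k (u c i) (u c j) (u c (Suc j))" by (rule orient_sum)
      ultimately show ?thesis by (simp add: orient_swap[of k "u c i" "u c (Suc j)"])
    qed
  qed simp
  have "star_configuration k s u m"
    using chord s(2) by (intro star_configurationI) (simp_all add: orient_rotate[of k _ _ s, symmetric])
  moreover have pos: "orient k (V c) (V (Suc c)) s > 0" for c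
    using chord[of 0 "m c" c] by (simp only: u_zero u_last)
  have "s \<in> convex hull {V 0, V 1, V 2}"
    using positive[of 0] pos[of 0] pos[of 1] pos[of 2] V_third[of 0]
    by (intro in_convex_hull_triangle[of k]) (auto simp: numeral_2_eq_2)
  ultimately show ?thesis using s(2) that by blast
qed

end

section \<open>Partitioning the interior points\<close>

lemma finite_ex_minimizer:
  fixes f :: "'a \<Rightarrow> 'b::linorder"
  assumes "finite S" "S \<noteq> {}"
  obtains x where "x \<in> S" "\<And>y. y \<in> S \<Longrightarrow> f x \<le> f y"
  using that[OF arg_min_if_finite(1)[OF assms, of f]] arg_min_least[OF assms, of _ f] by blast

text \<open>A minimizer of the product exists since there are finitely many assignments with the
  prescribed class sizes. Permuting the classes of a few points keeps these sizes, and the positive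
  factors of all other points cancel. Cycles of two and three points are recorded, since there are
  three classes.\<close>

lemma optimal_assignment:
  fixes w :: "nat \<Rightarrow> 'a \<Rightarrow> real" and n :: "nat \<Rightarrow> nat"
  assumes fin: "finite I" and card: "card I = n 0 + n 1 + n 2"
    and pos: "\<And>c p. p \<in> I \<Longrightarrow> w c p > 0"
  obtains g where "\<And>p. p \<in> I \<Longrightarrow> g p < (3::nat)" "\<And>c. c < 3 \<Longrightarrow> card {p \<in> I. g p = c} = n c"
    "\<And>p q. \<lbrakk>p \<in> I; q \<in> I; g p \<noteq> g q\<rbrakk> \<Longrightarrow> w (g p) p * w (g q) q \<le> w (g q) p * w (g p) q"
    "\<And>p q r. \<lbrakk>p \<in> I; q \<in> I; r \<in> I; g p \<noteq> g q; g q \<noteq> g r; g p \<noteq> g r\<rbrakk>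
       \<Longrightarrow> w (g p) p * (w (g q) q * w (g r) r) \<le> w (g q) p * (w (g r) q * w (g p) r)"
proof -
  let ?G = "{g \<in> I \<rightarrow>\<^sub>E {..<3}. \<forall>c<3. card {p \<in> I. g p = c} = n c}"
  have "finite ?G" using fin by (simp add: finite_PiE)
  moreover have "?G \<noteq> {}"
  proof -
    obtain B where B: "B \<subseteq> I" "card B = n 0" "finite B"
      using obtain_subset_with_card_n[of "n 0" I] card by auto
    have "card (I - B) = n 1 + n 2" using B fin card by (simp add: card_Diff_subset)
    then obtain C where C: "C \<subseteq> I - B" "card C = n 1" "finite C"
      using obtain_subset_with_card_n[of "n 1" "I - B"] by auto
    let ?g = "\<lambda>p\<in>I. if p \<in> B then 0 else if p \<in> C then 1 else (2::nat)"
    have "card (I - B - C) = n 2"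
      using C fin B \<open>card (I - B) = n 1 + n 2\<close> by (simp add: card_Diff_subset)
    moreover have "{p \<in> I. ?g p = 0} = B" "{p \<in> I. ?g p = 1} = C" "{p \<in> I. ?g p = 2} = I - B - C"
      using B C by auto
    ultimately have "card {p \<in> I. ?g p = 0} = n 0" "card {p \<in> I. ?g p = 1} = n 1" "card {p \<in> I. ?g p = 2} = n 2"
      using B(2) C(2) by simp_all
    moreover have "c = 0 \<or> c = 1 \<or> c = 2" if "c < 3" for c :: nat using that by linarith
    ultimately have "\<forall>c<3. card {p \<in> I. ?g p = c} = n c" by blast
    moreover have "?g \<in> I \<rightarrow>\<^sub>E {..<3}" by auto
    ultimately have "?g \<in> ?G" by blast
    then show ?thesis by blast
  qed
  ultimately obtain g where g: "g \<in> ?G" and min: "\<And>h. h \<in> ?G \<Longrightarrow> (\<Prod>p\<in>I. w (g p) p) \<le> (\<Prod>p\<in>I. w (h p) p)"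
    by (rule finite_ex_minimizer[of ?G "\<lambda>g. \<Prod>p\<in>I. w (g p) p"]) (rule that)
  \<comment> \<open>\<open>count\<close> says that the reassignment on \<open>F\<close> keeps the
    class sizes; it is written with sums of indicators so that the part outside \<open>F\<close>
    splits off.\<close>
  have exchange: "(\<Prod>p\<in>F. w (g p) p) \<le> (\<Prod>p\<in>F. w (h p) p)"
    if F: "F \<subseteq> I" and h: "\<And>p. p \<notin> F \<Longrightarrow> h p = g p" "\<And>p. p \<in> F \<Longrightarrow> h p < 3"
      and count: "\<And>c. (\<Sum>p\<in>F. if h p = c then 1 else 0) = (\<Sum>p\<in>F. if g p = c then 1 else (0::nat))"
    for F h
  proof -
    have "(\<Sum>p\<in>I. if h p = c then 1 else (0::nat)) = (\<Sum>p\<in>I. if g p = c then 1 else 0)" for c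
      unfolding sum.subset_diff[OF F fin] using h(1) count[of c] by simp
    then have "card {p \<in> I. h p = c} = card {p \<in> I. g p = c}" for c
      using fin by (simp add: sum.If_cases Int_def)
    moreover have "h \<in> I \<rightarrow>\<^sub>E {..<3}"
    proof (rule PiE_I)
      show "h p \<in> {..<3}" if "p \<in> I" for p using g h[of p] that by (cases "p \<in> F") auto
      show "h p = undefined" if "p \<notin> I" for p
      proof -
        have "p \<notin> F" using that F by blast
        then show ?thesis using g h(1)[of p] that PiE_arb[of g I "\<lambda>_. {..<3}" p] by simp
      qed
    qed
    ultimately have "h \<in> ?G" using g by simp
    then have "(\<Prod>p\<in>I. w (g p) p) \<le> (\<Prod>p\<in>I. w (h p) p)" by (rule min)
    then have "(\<Prod>p\<in>I-F. w (g p) p) * (\<Prod>p\<in>F. w (g p) p) \<le> (\<Prod>p\<in>I-F. w (g p) p) * (\<Prod>p\<in>F. w (h p) p)"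
      unfolding prod.subset_diff[OF F fin] using h(1) by simp
    moreover have "(\<Prod>p\<in>I-F. w (g p) p) > 0" using pos by (intro prod_pos) auto
    ultimately show ?thesis by simp
  qed
  have g3: "g p < 3" if "p \<in> I" for p using g that by auto
  show ?thesis
  proof (rule that[of g])
    show "card {p \<in> I. g p = c} = n c" if "c < 3" for c using g that by simp
    show "w (g p) p * w (g q) q \<le> w (g q) p * w (g p) q" if "p \<in> I" "q \<in> I" "g p \<noteq> g q" for p q
    proof -
      have "p \<noteq> q" using that by auto
      have "(\<Prod>x\<in>{p, q}. w (g x) x) \<le> (\<Prod>x\<in>{p, q}. w ((g(p := g q, q := g p)) x) x)"
        by (rule exchange) (use that g3 \<open>p \<noteq> q\<close> in \<open>auto split: if_splits\<close>)
      with \<open>p \<noteq> q\<close> show ?thesis by simp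
    qed
    show "w (g p) p * (w (g q) q * w (g r) r) \<le> w (g q) p * (w (g r) q * w (g p) r)"
      if "p \<in> I" "q \<in> I" "r \<in> I" "g p \<noteq> g q" "g q \<noteq> g r" "g p \<noteq> g r" for p q r
    proof -
      have ne: "p \<noteq> q" "q \<noteq> r" "p \<noteq> r" using that by auto
      have "(\<Prod>x\<in>{p, q, r}. w (g x) x) \<le> (\<Prod>x\<in>{p, q, r}. w ((g(p := g q, q := g r, r := g p)) x) x)"
        by (rule exchange) (use that g3 ne in \<open>auto split: if_splits\<close>)
      with ne show ?thesis by simp
    qed
  qed (rule g3)
qed

lemma dense_between:
  fixes a b c d :: real
  assumes "a < c" "a < d" "b < c" "b < d"
  obtains x where "a < x" "b < x" "x < c" "x < d"
proof -
  have "max a b < min c d" using assms by auto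
  then obtain x where "max a b < x" "x < min c d" using dense by blast
  then show ?thesis using that by auto
qed

text \<open>Fourier-Motzkin elimination for the multiplicative potentials \<open>1, a, b\<close>.\<close>

lemma strict_potentials:
  fixes w01 w10 w02 w20 w12 w21 :: real
  assumes pos: "w01 > 0" "w10 > 0" "w02 > 0" "w20 > 0" "w12 > 0" "w21 > 0"
    and two: "w01 * w10 > 1" "w02 * w20 > 1" "w12 * w21 > 1"
    and three: "w01 * w12 * w20 > 1" "w02 * w21 * w10 > 1"
  obtains a b where "a > 0" "b > 0" "a < w01" "1 < a * w10" "b < w02" "1 < b * w20" "b < a * w12" "a < b * w21"
proof -
  \<comment> \<open>Eliminating \<open>b\<close> adds the bounds \<open>1 / (w20 * w12)\<close> and
    \<open>w02 * w21\<close> on \<open>a\<close>. They are compatible by the product of two of the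
    two-cycle inequalities.\<close>
  have "1 * 1 < (w02 * w20) * (w12 * w21)" using two pos by (intro mult_strict_mono) auto
  then have four: "w20 * w12 * (w02 * w21) > 1" by (simp add: mult_ac)
  obtain a where a: "1 / w10 < a" "1 / (w20 * w12) < a" "a < w01" "a < w02 * w21"
    by (rule dense_between[of "1 / w10" w01 "w02 * w21" "1 / (w20 * w12)"])
      (use pos two three four in \<open>auto simp: divide_less_eq mult_ac\<close>)
  have "a > 0" using a(1) pos by (meson less_trans zero_less_divide_1_iff)
  have "a * 1 < a * (w12 * w21)" using \<open>a > 0\<close> two by (intro mult_strict_left_mono) auto
  then have "a < a * w12 * w21" by (simp add: mult_ac)
  then obtain b where b: "1 / w20 < b" "a / w21 < b" "b < w02" "b < a * w12"
    by (rule_tac dense_between[of "1 / w20" w02 "a * w12" "a / w21"])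
      (use pos two a in \<open>auto simp: divide_less_eq mult_ac\<close>)
  have "b > 0" using b(1) pos by (meson less_trans zero_less_divide_1_iff)
  show ?thesis
    by (rule that[of a b]) (use \<open>a > 0\<close> \<open>b > 0\<close> a b pos in \<open>auto simp: divide_less_eq mult_ac\<close>)
qed

text \<open>Converse of Ceva's theorem with an explicit witness: the point with barycentric weights
  \<open>G\<close>, \<open>H\<close>, \<open>F\<close> at \<open>a\<close>, \<open>b\<close>,
  \<open>c\<close> is on the first two lines by the choice of the weights and on the third by
  \<open>eq\<close>.\<close>

lemma concurrent_of_product_eq:
  assumes tri: "orient k a b c > 0"
    and p: "orient k a b p > 0" "orient k b c p > 0" and q: "orient k b c q > 0" "orient k c a q > 0"
    and r: "orient k c a r > 0" "orient k a b r > 0"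
    and eq: "orient k a b p * (orient k b c q * orient k c a r) = orient k b c p * (orient k c a q * orient k a b r)"
  shows "affine hull {b, p} \<inter> affine hull {c, q} \<inter> affine hull {a, r} \<noteq> {}"
proof -
  define F where "F = orient k a b p * orient k b c q"
  define G where "G = orient k b c p * orient k b c q"
  define H where "H = orient k b c p * orient k c a q"
  have pos: "F > 0" "G > 0" "H > 0" using p q by (simp_all add: F_def G_def H_def)
  define N where "N = F + G + H"
  have N: "N > 0" using pos by (simp add: N_def)
  define x where "x = (1 / N) *\<^sub>R (G *\<^sub>R a + H *\<^sub>R b + F *\<^sub>R c)"
  have xi: "N * x $ i = G * a $ i + H * b $ i + F * c $ i" for i
    using N by (simp add: x_def)
  have ox: "N * orient k v w x = G * orient k v w a + H * orient k v w b + F * orient k v w c" for v w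
    using xi[of k] xi[of "other_axis k"] N_def unfolding orient_def by algebra
  have "N * orient k b p x = G * orient k a b p - F * orient k b c p"
    unfolding ox by (simp add: orient_rotate[of k b p a] orient_swap'[of k b p c])
  then have 1: "orient k b p x = 0" using N by (simp add: F_def G_def)
  have "N * orient k c q x = H * orient k b c q - G * orient k c a q"
    unfolding ox by (simp add: orient_rotate[of k c q b] orient_swap'[of k c q a])
  then have 2: "orient k c q x = 0" using N by (simp add: H_def G_def)
  have "N * orient k a r x = F * orient k c a r - H * orient k a b r"
    unfolding ox by (simp add: orient_rotate[of k a r c] orient_swap'[of k a r b])
  also have "\<dots> = 0" using eq unfolding F_def H_def by (simp only: mult.assoc diff_self)
  finally have 3: "orient k a r x = 0" using N by simp
  have "b \<noteq> p" "c \<noteq> q" "a \<noteq> r" using p q r by auto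
  then have "x \<in> affine hull {b, p}" "x \<in> affine hull {c, q}" "x \<in> affine hull {a, r}"
    using 1 2 3 by (simp_all add: collinear_3_affine_hull[symmetric] collinear_iff_orient[of _ _ _ k])
  then show ?thesis by blast
qed

lemma radial_sort:
  assumes fin: "finite B" and ab: "orient k s a b > 0"
    and B: "\<And>p. p \<in> B \<Longrightarrow> orient k s a p > 0" "\<And>p. p \<in> B \<Longrightarrow> orient k s p b > 0"
    and ne: "\<And>p q. p \<in> B \<Longrightarrow> q \<in> B \<Longrightarrow> p \<noteq> q \<Longrightarrow> orient k s p q \<noteq> 0"
  obtains A where "set A = B" "distinct A" "sorted_wrt (\<lambda>p q. orient k s p q > 0) (a # A @ [b])"
proof -
  \<comment> \<open>By the Pluecker relation in \<open>step\<close>, this quotient grows with the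
    angle at \<open>s\<close> from \<open>a\<close> towards \<open>b\<close>; it serves as a sort
    key in place of the angle.\<close>
  define \<kappa> where "\<kappa> p = orient k s a p / orient k s p b" for p
  obtain xs where xs: "set xs = B" "distinct xs" using finite_distinct_list[OF fin] by blast
  define A where "A = sort_key \<kappa> xs"
  have A: "set A = B" "distinct A" "sorted (map \<kappa> A)"
    using xs by (simp_all add: A_def)
  have step: "orient k s p q > 0" if "p \<in> B" "q \<in> B" "p \<noteq> q" "\<kappa> p \<le> \<kappa> q" for p q
  proof -
    have "orient k s a p * orient k s q b \<le> orient k s a q * orient k s p b"
      using that(4) B(2)[OF that(1)] B(2)[OF that(2)] unfolding \<kappa>_def
      by (simp add: pos_divide_le_eq pos_le_divide_eq mult_ac)
    moreover have "orient k s a b * orient k s p q = orient k s a q * orient k s p b - orient k s a p * orient k s q b"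
      unfolding orient_def by algebra
    ultimately have "orient k s a b * orient k s p q \<ge> 0" by simp
    then show ?thesis using ab ne[OF that(1-3)] by (simp add: zero_le_mult_iff)
  qed
  have "sorted_wrt (\<lambda>p q. orient k s p q > 0) A"
    unfolding sorted_wrt_iff_nth_less
  proof (intro allI impI)
    fix i j assume ij: "i < j" "j < length A"
    then have "A ! i \<in> B" "A ! j \<in> B" "A ! i \<noteq> A ! j" using A(1,2) by (auto simp: nth_eq_iff_index_eq)
    moreover have "\<kappa> (A ! i) \<le> \<kappa> (A ! j)" using sorted_nth_mono[OF A(3), of i j] ij by simp
    ultimately show "orient k s (A ! i) (A ! j) > 0" by (rule step)
  qed
  then have "sorted_wrt (\<lambda>p q. orient k s p q > 0) (a # A @ [b])"
    using A(1) B ab by (auto simp: sorted_wrt_append)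
  with A(1,2) show ?thesis by (rule that)
qed

section \<open>Triangulating a radially monotone pocket\<close>

context star_configuration
begin

text \<open>The apex over the base \<open>(a, b)\<close> is the vertex \<open>t\<close> nearest to
  the line of the base. A vertex beyond the chord from \<open>a\<close> to \<open>t\<close>, or from
  \<open>t\<close> to \<open>b\<close>, would be even nearer, so both chords inherit the hypothesis
  and the recursion continues on either side.\<close>

lemma ex_polygon_triangulation_above:
  assumes "a < b" "b \<le> m c" "\<And>l. a < l \<Longrightarrow> l < b \<Longrightarrow> orient k (u c a) (u c b) (u c l) > 0"
  shows "\<exists>D. polygon_triangulation a b D \<and>
    (\<forall>i j l. (i, j) \<in> D \<longrightarrow> i < l \<longrightarrow> l < j \<longrightarrow> orient k (u c i) (u c j) (u c l) > 0)"
  using assms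
proof (induction "b - a" arbitrary: a b rule: less_induct)
  case less
  show ?case
  proof (cases "b = Suc a")
    case True
    then show ?thesis
      using less.prems(3) by (intro exI[of _ "{(a, b)}"]) (auto intro: polygon_triangulation.edge)
  next
    case False
    let ?F = "\<lambda>l::nat. orient k (u c a) (u c b) (u c l)"
    have "Suc a \<in> {a<..<b}" using False less.prems(1) by simp
    then have "{a<..<b} \<noteq> {}" by blast
    then obtain t where t: "t \<in> {a<..<b}" "\<And>l. l \<in> {a<..<b} \<Longrightarrow> ?F t \<le> ?F l"
      using finite_ex_minimizer[of "{a<..<b}" ?F] by blast
    let ?Fs = "orient k (u c a) (u c b) s"
    \<comment> \<open>\<open>?F\<close> is the height over the base up to scaling. Since
      \<open>s\<close> is higher than the vertices between, the height decreases outwards along the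
      rays to them; the difference is the positive factor in the identities for \<open>left\<close>
      and \<open>right\<close>.\<close>
    have below: "?F l < ?Fs" if "a < l" "l < b" for l
    proof -
      have "?Fs - ?F l = orient k s (u c a) (u c l) + orient k s (u c l) (u c b)"
        unfolding orient_def by algebra
      then show ?thesis using radial[of a l c] radial[of l b c] that less.prems(2) by simp
    qed
    have left: "orient k (u c a) (u c t) (u c l) > 0" if "a < l" "l < t" for l
    proof -
      have "orient k (u c a) (u c t) (u c l) * (?Fs - ?F l)
        = orient k s (u c l) (u c t) * ?F l + orient k s (u c a) (u c l) * (?F l - ?F t)"
        unfolding orient_def by algebra
      moreover have "orient k s (u c l) (u c t) * ?F l > 0"
        using radial[of l t c] less.prems that t by simp
      moreover have "orient k s (u c a) (u c l) * (?F l - ?F t) \<ge> 0"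
        using radial[of a l c] less.prems that t by simp
      ultimately have "orient k (u c a) (u c t) (u c l) * (?Fs - ?F l) > 0" by linarith
      then show ?thesis using below[of l] that t by (simp add: zero_less_mult_iff)
    qed
    have right: "orient k (u c t) (u c b) (u c l) > 0" if "t < l" "l < b" for l
    proof -
      have "orient k (u c t) (u c b) (u c l) * (?Fs - ?F l)
        = orient k s (u c t) (u c l) * ?F l + orient k s (u c l) (u c b) * (?F l - ?F t)"
        unfolding orient_def by algebra
      moreover have "orient k s (u c t) (u c l) * ?F l > 0"
        using radial[of t l c] less.prems that t by simp
      moreover have "orient k s (u c l) (u c b) * (?F l - ?F t) \<ge> 0"
        using radial[of l b c] less.prems that t by simp
      ultimately have "orient k (u c t) (u c b) (u c l) * (?Fs - ?F l) > 0" by linarith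
      then show ?thesis using below[of l] that t by (simp add: zero_less_mult_iff)
    qed
    from t less.prems have "t - a < b - a" "a < t" "t \<le> m c" "b - t < b - a" "t < b" by auto
    then obtain D1 D2 where
      D1: "polygon_triangulation a t D1" "\<forall>i j l. (i, j) \<in> D1 \<longrightarrow> i < l \<longrightarrow> l < j \<longrightarrow> orient k (u c i) (u c j) (u c l) > 0" and
      D2: "polygon_triangulation t b D2" "\<forall>i j l. (i, j) \<in> D2 \<longrightarrow> i < l \<longrightarrow> l < j \<longrightarrow> orient k (u c i) (u c j) (u c l) > 0"
      using less.hyps[of t a] less.hyps[of b t] left right less.prems(2) by blast
    have "polygon_triangulation a b (insert (a, b) (D1 \<union> D2))"
      using D1(1) D2(1) by (rule polygon_triangulation.split)
    then show ?thesis using D1(2) D2(2) less.prems(3) by blast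
  qed
qed

end

section \<open>Periodic families made of three values\<close>

definition cyclic3 :: "'a \<Rightarrow> 'a \<Rightarrow> 'a \<Rightarrow> nat \<Rightarrow> 'a" where
  "cyclic3 x y z n = (if n mod 3 = 0 then x else if n mod 3 = 1 then y else z)"

lemma cyclic3_simps [simp]:
  "cyclic3 x y z 0 = x" "cyclic3 x y z (Suc 0) = y" "cyclic3 x y z (Suc (Suc 0)) = z"
  "cyclic3 x y z (Suc (Suc (Suc n))) = cyclic3 x y z n"
proof -
  have "Suc (Suc (Suc n)) = n + 3" by simp
  then have "Suc (Suc (Suc n)) mod 3 = n mod 3" by (simp only: mod_add_self2)
  then show "cyclic3 x y z (Suc (Suc (Suc n))) = cyclic3 x y z n" by (simp add: cyclic3_def)
qed (simp_all add: cyclic3_def)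

lemma cyclic3_periodic: "cyclic3 x y z (n + 3) = cyclic3 x y z n"
  by (simp add: numeral_3_eq_3)

lemma mod_3_exhaust:
  obtains "n mod (3::nat) = 0" | "n mod 3 = 1" | "n mod 3 = 2"
proof -
  have "n mod 3 < 3" by simp
  then have "n mod 3 = 0 \<or> n mod 3 = 1 \<or> n mod 3 = 2" by linarith
  then show ?thesis by (elim disjE) (rule that, assumption)+
qed

lemma chain_cyclic3_cases:
  assumes "R (chain (cyclic3 a b c) (cyclic3 A0 A1 A2) 0)" "R (chain (cyclic3 a b c) (cyclic3 A0 A1 A2) (Suc 0))"
    "R (chain (cyclic3 a b c) (cyclic3 A0 A1 A2) (Suc (Suc 0)))"
  shows "R (chain (cyclic3 a b c) (cyclic3 A0 A1 A2) n)"
  using assms by (cases rule: mod_3_exhaust[of n]) (simp_all add: chain_def cyclic3_def mod_Suc)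

lemma chain_points_cyclic3:
  "chain_points (cyclic3 a b c) (cyclic3 A0 A1 A2) = set (a # A0 @ b # A1 @ c # A2)"
proof
  have "set (chain (cyclic3 a b c) (cyclic3 A0 A1 A2) n) \<subseteq> set (a # A0 @ b # A1 @ c # A2)" for n
    by (rule chain_cyclic3_cases) (auto simp: chain_def)
  then show "chain_points (cyclic3 a b c) (cyclic3 A0 A1 A2) \<subseteq> set (a # A0 @ b # A1 @ c # A2)"
    unfolding chain_points_def by blast
  have "set (chain (cyclic3 a b c) (cyclic3 A0 A1 A2) n) \<subseteq> chain_points (cyclic3 a b c) (cyclic3 A0 A1 A2)" for n
    unfolding chain_points_def by (rule UN_upper) simp
  from this[of 0] this[of "Suc 0"] this[of "Suc (Suc 0)"]
  show "set (a # A0 @ b # A1 @ c # A2) \<subseteq> chain_points (cyclic3 a b c) (cyclic3 A0 A1 A2)"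
    by (simp add: chain_def)
qed

lemma chain_triangle_cyclic3:
  assumes dist: "distinct (a # A0 @ b # A1 @ c # A2)" and pos: "orient k a b c > 0"
    and gp: "general_position (set (a # A0 @ b # A1 @ c # A2))"
    and hull: "set (a # A0 @ b # A1 @ c # A2) \<subseteq> convex hull {a, b, c}"
  shows "chain_triangle k (cyclic3 a b c) (cyclic3 A0 A1 A2)"
proof (rule chain_triangle.intro)
  let ?V = "cyclic3 a b c" and ?A = "cyclic3 A0 A1 A2"
  have pos': "orient k b c a > 0" "orient k c a b > 0"
    using pos by (simp_all add: orient_rotate[of k b c a] orient_rotate'[of k c a b])
  have "orient k a b x \<ge> 0" "orient k b c x \<ge> 0" "orient k c a x \<ge> 0" if "x \<in> convex hull {a, b, c}" for x
    using pos pos' by (auto intro!: orient_nonneg_convex_hull[OF that])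
  then show "orient k (?V n) (?V (Suc n)) x \<ge> 0" if "x \<in> chain_points ?V ?A" for n x
    using that hull unfolding chain_points_cyclic3
    by (cases rule: mod_3_exhaust[of n]) (auto simp: cyclic3_def mod_Suc)
  show "distinct (?V n # ?A n @ ?V (Suc n) # ?A (Suc n) @ ?V (Suc (Suc n)) # ?A (Suc (Suc n)))" for n
    using dist by (cases rule: mod_3_exhaust[of n]) (auto simp: cyclic3_def mod_Suc)
  show "orient k (?V n) (?V (Suc n)) (?V (Suc (Suc n))) > 0" for n
    using pos pos' by (cases rule: mod_3_exhaust[of n]) (simp_all add: cyclic3_def mod_Suc)
  show "general_position (chain_points ?V ?A)" using gp unfolding chain_points_cyclic3 .
qed (simp_all add: cyclic3_periodic)

text \<open>The last chain ends in the vertex with which the cycle begins. Closing the list with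
  \<open>hd vs\<close> turns every chain into a contiguous block of it.\<close>

lemma cycle_edges_infix:
  assumes eq: "vs @ [hd vs] = xs @ ys @ zs" and i: "Suc i < length ys"
  shows "{ys ! i, ys ! Suc i} \<in> cycle_edges vs"
proof -
  let ?j = "length xs + i"
  have len: "Suc (length vs) = length xs + length ys + length zs" using arg_cong[OF eq, of length] by simp
  then have j: "?j < length vs" using i by simp
  have nth: "(vs @ [hd vs]) ! (length xs + t) = ys ! t" if "t < length ys" for t
    unfolding eq using that by (simp add: nth_append)
  have "vs ! ?j = ys ! i" using nth[of i] i j by (simp add: nth_append)
  moreover have "vs ! (Suc ?j mod length vs) = ys ! Suc i"
  proof (cases "Suc ?j < length vs")
    case True
    then show ?thesis using nth[of "Suc i"] i by (simp add: nth_append)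
  next
    case False
    with j have "Suc ?j = length vs" by simp
    moreover have "vs \<noteq> []" using j by auto
    ultimately show ?thesis using nth[of "Suc i"] i by (simp add: nth_append hd_conv_nth)
  qed
  ultimately show ?thesis unfolding cycle_edges_def using j by (intro CollectI exI[of _ ?j]) simp
qed

section \<open>Strictly optimal partitions and the centre given by their prices\<close>

lemma orient_product_difference:
  "orient k a b p * orient k b c q - orient k b c p * orient k a b q = orient k a b c * orient k b p q"
  unfolding orient_def by algebra

text \<open>Three classes admit five exchange cycles, namely three swaps and two rotations. A strict
  inequality for each of them is what the construction of the prices needs.\<close>

lemma ex_strictly_optimal_partition:
  assumes abc: "orient k a b c > 0"
    and I: "finite I" "a \<notin> I" "b \<notin> I" "c \<notin> I"
    and gp: "general_position ({a, b, c} \<union> I)" and conc: "no_three_concurrent_lines ({a, b, c} \<union> I)"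
    and inside: "\<And>p. p \<in> I \<Longrightarrow> orient k a b p > 0" "\<And>p. p \<in> I \<Longrightarrow> orient k b c p > 0"
      "\<And>p. p \<in> I \<Longrightarrow> orient k c a p > 0"
    and card: "card I = n0 + n1 + n2"
    and F: "F = orient k a b" and G: "G = orient k b c" and H: "H = orient k c a"
  obtains B0 B1 B2 where "B0 \<union> B1 \<union> B2 = I" "B0 \<inter> B1 = {}" "B1 \<inter> B2 = {}" "B0 \<inter> B2 = {}"
    "card B0 = n0" "card B1 = n1" "card B2 = n2"
    "\<And>p q. p \<in> B0 \<Longrightarrow> q \<in> B1 \<Longrightarrow> F p * G q < G p * F q"
    "\<And>p q. p \<in> B1 \<Longrightarrow> q \<in> B2 \<Longrightarrow> G p * H q < H p * G q"
    "\<And>p q. p \<in> B2 \<Longrightarrow> q \<in> B0 \<Longrightarrow> H p * F q < F p * H q"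
    "\<And>p q r. p \<in> B0 \<Longrightarrow> q \<in> B1 \<Longrightarrow> r \<in> B2 \<Longrightarrow> F p * (G q * H r) < G p * (H q * F r)"
    "\<And>p q r. p \<in> B0 \<Longrightarrow> q \<in> B1 \<Longrightarrow> r \<in> B2 \<Longrightarrow> F p * (H r * G q) < H p * (G r * F q)"
proof -
  have pos: "F p > 0" "G p > 0" "H p > 0" if "p \<in> I" for p using inside that by (simp_all add: F G H)
  \<comment> \<open>The two sides of a swap inequality differ by a multiple of the orientation with
    the corner common to the two edges: \<open>b\<close> for classes 0 and 1, \<open>c\<close> for 1
    and 2, \<open>a\<close> for 2 and 0.\<close>
  have FG: "F p * G q - G p * F q = orient k a b c * orient k b p q" for p q
    unfolding F G by (rule orient_product_difference)
  have GH: "G p * H q - H p * G q = orient k a b c * orient k c p q" for p q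
    unfolding G H using orient_product_difference[of k b c p a q] by (simp add: orient_rotate[of k b c a])
  have HF: "H p * F q - F p * H q = orient k a b c * orient k a p q" for p q
    unfolding F H using orient_product_difference[of k c a p b q] by (simp add: orient_rotate'[of k c a b])
  obtain g where g3: "\<And>p. p \<in> I \<Longrightarrow> g p < (3::nat)"
    and g_card: "\<And>t. t < 3 \<Longrightarrow> card {p \<in> I. g p = t} = cyclic3 n0 n1 n2 t"
    and two: "\<And>p q. \<lbrakk>p \<in> I; q \<in> I; g p \<noteq> g q\<rbrakk> \<Longrightarrow>
      cyclic3 F G H (g p) p * cyclic3 F G H (g q) q \<le> cyclic3 F G H (g q) p * cyclic3 F G H (g p) q"
    and three: "\<And>p q r. \<lbrakk>p \<in> I; q \<in> I; r \<in> I; g p \<noteq> g q; g q \<noteq> g r; g p \<noteq> g r\<rbrakk> \<Longrightarrow>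
      cyclic3 F G H (g p) p * (cyclic3 F G H (g q) q * cyclic3 F G H (g r) r)
      \<le> cyclic3 F G H (g q) p * (cyclic3 F G H (g r) q * cyclic3 F G H (g p) r)"
    by (rule optimal_assignment[of I "cyclic3 n0 n1 n2" "cyclic3 F G H"])
      (use I(1) card pos in \<open>auto simp: numeral_2_eq_2 cyclic3_def\<close>)
  define B0 B1 B2 where "B0 = {p \<in> I. g p = 0}" and "B1 = {p \<in> I. g p = 1}" and "B2 = {p \<in> I. g p = 2}"
  have B_union: "B0 \<union> B1 \<union> B2 = I"
  proof -
    have "g p = 0 \<or> g p = 1 \<or> g p = 2" if "p \<in> I" for p using g3[OF that] by linarith
    then show ?thesis unfolding B0_def B1_def B2_def by blast
  qed
  have B_disj: "B0 \<inter> B1 = {}" "B1 \<inter> B2 = {}" "B0 \<inter> B2 = {}" unfolding B0_def B1_def B2_def by auto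
  have B_card: "card B0 = n0" "card B1 = n1" "card B2 = n2"
    using g_card[of 0] g_card[of 1] g_card[of 2] unfolding B0_def B1_def B2_def by (simp_all add: cyclic3_def)
  have B_I: "p \<in> B0 \<Longrightarrow> p \<in> I" "p \<in> B1 \<Longrightarrow> p \<in> I" "p \<in> B2 \<Longrightarrow> p \<in> I" for p using B_union by auto
  have orient_ne: "orient k a b c * orient k x p q \<noteq> 0" if "x \<in> {a, b, c}" "p \<in> I" "q \<in> I" "p \<noteq> q" for x p q
  proof -
    have "orient k x p q \<noteq> 0" by (rule general_position_orient[OF gp]) (use that I in auto)
    then show ?thesis using abc by simp
  qed
  have s01: "F p * G q < G p * F q" if "p \<in> B0" "q \<in> B1" for p q
  proof -
    have "F p * G q \<le> G p * F q" using two[of p q] that by (simp add: B0_def B1_def cyclic3_def)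
    moreover have "F p * G q - G p * F q \<noteq> 0"
      unfolding FG by (rule orient_ne) (use that B_I B_disj in auto)
    ultimately show ?thesis by simp
  qed
  have s12: "G p * H q < H p * G q" if "p \<in> B1" "q \<in> B2" for p q
  proof -
    have "G p * H q \<le> H p * G q" using two[of p q] that by (simp add: B1_def B2_def cyclic3_def)
    moreover have "G p * H q - H p * G q \<noteq> 0"
      unfolding GH by (rule orient_ne) (use that B_I B_disj in auto)
    ultimately show ?thesis by simp
  qed
  have s20: "H p * F q < F p * H q" if "p \<in> B2" "q \<in> B0" for p q
  proof -
    have "H p * F q \<le> F p * H q" using two[of p q] that by (simp add: B0_def B2_def cyclic3_def)
    moreover have "H p * F q - F p * H q \<noteq> 0"
      unfolding HF by (rule orient_ne) (use that B_I B_disj in auto)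
    ultimately show ?thesis by simp
  qed
  have no_conc: "affine hull {b, p} \<inter> affine hull {c, q} \<inter> affine hull {a, r} = {}"
    if "p \<in> I" "q \<in> I" "r \<in> I" "p \<noteq> q" "q \<noteq> r" "p \<noteq> r" for p q r
  proof -
    have "distinct [b, p, c, q, a, r]" using that I abc by auto
    moreover have "set [b, p, c, q, a, r] \<subseteq> {a, b, c} \<union> I" using that by simp
    ultimately show ?thesis using conc unfolding no_three_concurrent_lines_def by blast
  qed
  have s012: "F p * (G q * H r) < G p * (H q * F r)" if "p \<in> B0" "q \<in> B1" "r \<in> B2" for p q r
  proof -
    have pqr: "p \<in> I" "q \<in> I" "r \<in> I" "p \<noteq> q" "q \<noteq> r" "p \<noteq> r" using that B_disj B_I by auto
    have "F p * (G q * H r) \<le> G p * (H q * F r)"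
      using three[of p q r] that by (simp add: B0_def B1_def B2_def cyclic3_def)
    moreover have "F p * (G q * H r) \<noteq> G p * (H q * F r)"
    proof
      assume "F p * (G q * H r) = G p * (H q * F r)"
      then have "affine hull {b, p} \<inter> affine hull {c, q} \<inter> affine hull {a, r} \<noteq> {}"
        unfolding F G H using pqr abc inside by (intro concurrent_of_product_eq[of k])
      with no_conc[OF pqr] show False by simp
    qed
    ultimately show ?thesis by simp
  qed
  have s021: "F p * (H r * G q) < H p * (G r * F q)" if "p \<in> B0" "q \<in> B1" "r \<in> B2" for p q r
  proof -
    have pqr: "q \<in> I" "r \<in> I" "p \<in> I" "q \<noteq> r" "r \<noteq> p" "q \<noteq> p" using that B_disj B_I by auto
    \<comment> \<open>The second rotation is a mirror image of the first: exchanging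
      \<open>a\<close> with \<open>b\<close> and the two axes brings it under
      \<open>concurrent_of_product_eq\<close>.\<close>
    have swap: "orient (other_axis k) y x = orient k x y" for x y
      by (simp add: fun_eq_iff orient_swap_axes orient_swap[of k x y])
    have "F p * (H r * G q) \<le> H p * (G r * F q)"
      using three[of p r q] that by (simp add: B0_def B1_def B2_def cyclic3_def)
    moreover have "F p * (H r * G q) \<noteq> H p * (G r * F q)"
    proof
      assume "F p * (H r * G q) = H p * (G r * F q)"
      then have "affine hull {a, p} \<inter> affine hull {c, r} \<inter> affine hull {b, q} \<noteq> {}"
        by (intro concurrent_of_product_eq[of "other_axis k"])
          (use pqr abc inside in \<open>simp_all add: swap F G H orient_rotate[of k b c a]\<close>)
      with no_conc[OF pqr] show False by blast
    qed
    ultimately show ?thesis by simp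
  qed
  show ?thesis
    by (rule that[of B0 B1 B2]) (use B_union B_disj B_card s01 s12 s20 s012 s021 in auto)
qed

text \<open>The centre gets barycentric weights proportional to \<alpha>, \<beta>, 1 at
  \<open>a\<close>, \<open>b\<close>, \<open>c\<close>, so that \<open>F x\<close>,
  \<open>G x\<close>, \<open>H x\<close> are in the ratio 1 : \<alpha> : \<beta>. A point
  \<open>p\<close> of \<open>B0\<close> is in the sector over the edge from \<open>a\<close> to
  \<open>b\<close> if \<open>F p / F x\<close> is the least of the three quotients, that is, if
  \<alpha> and \<beta> are below \<open>G p / F p\<close> and \<open>H p / F p\<close>.\<close>

lemma ex_weighted_center:
  assumes abc: "orient k a b c > 0"
    and F: "F = orient k a b" and G: "G = orient k b c" and H: "H = orient k c a"
    and B_fin: "finite B0" "finite B1" "finite B2" and B_ne: "B0 \<noteq> {}" "B1 \<noteq> {}" "B2 \<noteq> {}"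
    and pos: "\<And>p. p \<in> B0 \<union> B1 \<union> B2 \<Longrightarrow> F p > 0" "\<And>p. p \<in> B0 \<union> B1 \<union> B2 \<Longrightarrow> G p > 0"
      "\<And>p. p \<in> B0 \<union> B1 \<union> B2 \<Longrightarrow> H p > 0"
    and s01: "\<And>p q. p \<in> B0 \<Longrightarrow> q \<in> B1 \<Longrightarrow> F p * G q < G p * F q"
    and s12: "\<And>p q. p \<in> B1 \<Longrightarrow> q \<in> B2 \<Longrightarrow> G p * H q < H p * G q"
    and s20: "\<And>p q. p \<in> B2 \<Longrightarrow> q \<in> B0 \<Longrightarrow> H p * F q < F p * H q"
    and s012: "\<And>p q r. p \<in> B0 \<Longrightarrow> q \<in> B1 \<Longrightarrow> r \<in> B2 \<Longrightarrow> F p * (G q * H r) < G p * (H q * F r)"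
    and s021: "\<And>p q r. p \<in> B0 \<Longrightarrow> q \<in> B1 \<Longrightarrow> r \<in> B2 \<Longrightarrow> F p * (H r * G q) < H p * (G r * F q)"
  obtains x where "F x > 0" "G x > 0" "H x > 0"
    "\<And>p. p \<in> B0 \<Longrightarrow> orient k a p x > 0 \<and> orient k p b x > 0"
    "\<And>p. p \<in> B1 \<Longrightarrow> orient k b p x > 0 \<and> orient k p c x > 0"
    "\<And>p. p \<in> B2 \<Longrightarrow> orient k c p x > 0 \<and> orient k p a x > 0"
proof -
  have FG: "F p * G q - G p * F q = orient k a b c * orient k b p q" for p q
    unfolding F G by (rule orient_product_difference)
  have GH: "G p * H q - H p * G q = orient k a b c * orient k c p q" for p q
    unfolding G H using orient_product_difference[of k b c p a q] by (simp add: orient_rotate[of k b c a])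
  have HF: "H p * F q - F p * H q = orient k a b c * orient k a p q" for p q
    unfolding F H using orient_product_difference[of k c a p b q] by (simp add: orient_rotate'[of k c a b])
  have ratio_min: "\<exists>w>0. (\<exists>p\<in>B. w = f p / h p) \<and> (\<forall>p\<in>B. w \<le> f p / h p)"
    if B: "finite B" "B \<noteq> {}" "\<And>p. p \<in> B \<Longrightarrow> f p > 0" "\<And>p. p \<in> B \<Longrightarrow> h p > 0" for B and f h :: "point \<Rightarrow> real"
  proof -
    obtain p where p: "p \<in> B" "\<And>q. q \<in> B \<Longrightarrow> f p / h p \<le> f q / h q"
      using finite_ex_minimizer[OF B(1,2), of "\<lambda>p. f p / h p"] by blast
    then show ?thesis using B(3,4) by (intro exI[of _ "f p / h p"]) auto
  qed
  \<comment> \<open>Each class needs only its tightest bound, the least ratio. As the minimum is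
    attained, the strict exchange inequalities can be applied to the minimizing points, which differ
    from ratio to ratio.\<close>
  obtain w01 p01 where w01: "w01 > 0" "p01 \<in> B0" "w01 = G p01 / F p01" "\<And>p. p \<in> B0 \<Longrightarrow> w01 \<le> G p / F p"
    using ratio_min[OF B_fin(1) B_ne(1), of G F] pos by blast
  obtain w02 p02 where w02: "w02 > 0" "p02 \<in> B0" "w02 = H p02 / F p02" "\<And>p. p \<in> B0 \<Longrightarrow> w02 \<le> H p / F p"
    using ratio_min[OF B_fin(1) B_ne(1), of H F] pos by blast
  obtain w10 p10 where w10: "w10 > 0" "p10 \<in> B1" "w10 = F p10 / G p10" "\<And>p. p \<in> B1 \<Longrightarrow> w10 \<le> F p / G p"
    using ratio_min[OF B_fin(2) B_ne(2), of F G] pos by blast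
  obtain w12 p12 where w12: "w12 > 0" "p12 \<in> B1" "w12 = H p12 / G p12" "\<And>p. p \<in> B1 \<Longrightarrow> w12 \<le> H p / G p"
    using ratio_min[OF B_fin(2) B_ne(2), of H G] pos by blast
  obtain w20 p20 where w20: "w20 > 0" "p20 \<in> B2" "w20 = F p20 / H p20" "\<And>p. p \<in> B2 \<Longrightarrow> w20 \<le> F p / H p"
    using ratio_min[OF B_fin(3) B_ne(3), of F H] pos by blast
  obtain w21 p21 where w21: "w21 > 0" "p21 \<in> B2" "w21 = G p21 / H p21" "\<And>p. p \<in> B2 \<Longrightarrow> w21 \<le> G p / H p"
    using ratio_min[OF B_fin(3) B_ne(3), of G H] pos by blast
  note p_pos = pos[OF UnI1[OF UnI1[OF w01(2)]]] pos[OF UnI1[OF UnI1[OF w02(2)]]] pos[OF UnI1[OF UnI2[OF w10(2)]]]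
    pos[OF UnI1[OF UnI2[OF w12(2)]]] pos[OF UnI2[OF w20(2)]] pos[OF UnI2[OF w21(2)]]
  have frac2: "x / y * (z / t) > 1" if "y * t < x * z" "y > 0" "t > 0" for x y z t :: real
    using that by (simp add: less_divide_eq)
  have frac3: "x / y * (z / t) * (v / r) > 1" if "y * (t * r) < x * (z * v)" "y > 0" "t > 0" "r > 0" for x y z t v r :: real
    using that by (simp add: less_divide_eq mult_ac)
  have h: "w01 * w10 > 1" "w02 * w20 > 1" "w12 * w21 > 1"
    unfolding w01(3) w10(3) w02(3) w20(3) w12(3) w21(3)
    using s01[OF w01(2) w10(2)] s20[OF w20(2) w02(2)] s12[OF w12(2) w21(2)] p_pos
    by (auto intro!: frac2 simp: mult.commute)
  have h': "w01 * w12 * w20 > 1" "w02 * w21 * w10 > 1"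
    unfolding w01(3) w10(3) w02(3) w20(3) w12(3) w21(3)
    by (rule frac3[OF s012[OF w01(2) w12(2) w20(2)]] frac3[OF s021[OF w02(2) w10(2) w21(2)]]; rule p_pos)+
  obtain \<alpha> \<beta> where ab: "\<alpha> > 0" "\<beta> > 0" "\<alpha> < w01" "1 < \<alpha> * w10" "\<beta> < w02" "1 < \<beta> * w20" "\<beta> < \<alpha> * w12" "\<alpha> < \<beta> * w21"
    by (rule strict_potentials[OF w01(1) w10(1) w02(1) w20(1) w12(1) w21(1) h h']) (rule that)
  define N where "N = 1 + \<alpha> + \<beta>"
  have N: "N > 0" using ab by (simp add: N_def)
  define x where "x = (1 / N) *\<^sub>R (\<alpha> *\<^sub>R a + \<beta> *\<^sub>R b + c)"
  have xi: "N * x $ i = \<alpha> * a $ i + \<beta> * b $ i + c $ i" for i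
    using N by (simp add: x_def)
  have ox: "N * orient k v w x = \<alpha> * orient k v w a + \<beta> * orient k v w b + orient k v w c" for v w
    using xi[of k] xi[of "other_axis k"] N_def unfolding orient_def by algebra
  have NF: "N * F x = orient k a b c" unfolding F ox by simp
  have NG: "N * G x = \<alpha> * orient k a b c" unfolding G ox by (simp add: orient_rotate[of k b c a])
  have NH: "N * H x = \<beta> * orient k a b c" unfolding H ox by (simp add: orient_rotate'[of k c a b])
  have scale: "y > 0" if "N * y = z" "z > 0" for y z
    using that N by (auto simp: zero_less_mult_iff)
  have Fx: "F x > 0" "G x > 0" "H x > 0"
    using abc ab by (auto intro: scale[OF NF] scale[OF NG] scale[OF NH])
  have D: "y = z" if "orient k a b c * y = orient k a b c * z" for y z
    using that abc by simp
  have oa: "N * orient k a p x = z" if "z = H p - \<beta> * F p" for p z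
  proof (rule D)
    have "orient k a b c * (N * orient k a p x) = N * (orient k a b c * orient k a p x)" by simp
    also have "\<dots> = H p * (N * F x) - F p * (N * H x)" unfolding HF[symmetric] by (simp add: algebra_simps)
    also have "\<dots> = orient k a b c * z" unfolding NF NH that by (simp add: algebra_simps)
    finally show "orient k a b c * (N * orient k a p x) = orient k a b c * z" .
  qed
  have ob: "N * orient k b p x = z" if "z = \<alpha> * F p - G p" for p z
  proof (rule D)
    have "orient k a b c * (N * orient k b p x) = N * (orient k a b c * orient k b p x)" by simp
    also have "\<dots> = F p * (N * G x) - G p * (N * F x)" unfolding FG[symmetric] by (simp add: algebra_simps)
    also have "\<dots> = orient k a b c * z" unfolding NF NG that by (simp add: algebra_simps)
    finally show "orient k a b c * (N * orient k b p x) = orient k a b c * z" .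
  qed
  have oc: "N * orient k c p x = z" if "z = \<beta> * G p - \<alpha> * H p" for p z
  proof (rule D)
    have "orient k a b c * (N * orient k c p x) = N * (orient k a b c * orient k c p x)" by simp
    also have "\<dots> = G p * (N * H x) - H p * (N * G x)" unfolding GH[symmetric] by (simp add: algebra_simps)
    also have "\<dots> = orient k a b c * z" unfolding NH NG that by (simp add: algebra_simps)
    finally show "orient k a b c * (N * orient k c p x) = orient k a b c * z" .
  qed
  have neg: "y > 0" if "N * (- y) = z" "z < 0" for y z
    using scale[of y "- z"] that by simp
  have m0: "\<beta> * F p < H p" "\<alpha> * F p < G p" if "p \<in> B0" for p
  proof -
    have "\<beta> < H p / F p" "\<alpha> < G p / F p" using ab w01(4)[OF that] w02(4)[OF that] by linarith+
    then show "\<beta> * F p < H p" "\<alpha> * F p < G p" using pos[of p] that by (simp_all add: less_divide_eq)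
  qed
  have m1: "G p < \<alpha> * F p" "\<beta> * G p < \<alpha> * H p" if "p \<in> B1" for p
  proof -
    have "\<alpha> * w10 \<le> \<alpha> * (F p / G p)" "\<alpha> * w12 \<le> \<alpha> * (H p / G p)"
      using ab w10(4)[OF that] w12(4)[OF that] by (auto intro!: mult_left_mono simp del: times_divide_eq_right)
    then have "1 < \<alpha> * F p / G p" "\<beta> < \<alpha> * H p / G p" using ab by simp_all
    then show "G p < \<alpha> * F p" "\<beta> * G p < \<alpha> * H p" using pos[of p] that by (simp_all add: less_divide_eq)
  qed
  have m2: "H p < \<beta> * F p" "\<alpha> * H p < \<beta> * G p" if "p \<in> B2" for p
  proof -
    have "\<beta> * w20 \<le> \<beta> * (F p / H p)" "\<beta> * w21 \<le> \<beta> * (G p / H p)"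
      using ab w20(4)[OF that] w21(4)[OF that] by (auto intro!: mult_left_mono simp del: times_divide_eq_right)
    then have "1 < \<beta> * F p / H p" "\<alpha> < \<beta> * G p / H p" using ab by simp_all
    then show "H p < \<beta> * F p" "\<alpha> * H p < \<beta> * G p" using pos[of p] that by (simp_all add: less_divide_eq)
  qed
  show ?thesis
  proof (rule that[of x])
    fix p assume p: "p \<in> B0"
    have "orient k a p x > 0" by (rule scale[OF oa[OF refl]]) (use m0[OF p] in simp)
    moreover have "orient k p b x > 0" 
      by (rule neg[of _ "\<alpha> * F p - G p"]) (use ob[OF refl, of p] m0[OF p] in \<open>auto simp: orient_swap[of k b p]\<close>)
    ultimately show "orient k a p x > 0 \<and> orient k p b x > 0" ..
  next
    fix p assume p: "p \<in> B1"
    have "orient k b p x > 0" by (rule scale[OF ob[OF refl]]) (use m1[OF p] in simp)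
    moreover have "orient k p c x > 0" 
      by (rule neg[of _ "\<beta> * G p - \<alpha> * H p"]) (use oc[OF refl, of p] m1[OF p] in \<open>auto simp: orient_swap[of k c p]\<close>)
    ultimately show "orient k b p x > 0 \<and> orient k p c x > 0" ..
  next
    fix p assume p: "p \<in> B2"
    have "orient k c p x > 0" by (rule scale[OF oc[OF refl]]) (use m2[OF p] in simp)
    moreover have "orient k p a x > 0" 
      by (rule neg[of _ "H p - \<beta> * F p"]) (use oa[OF refl, of p] m2[OF p] in \<open>auto simp: orient_swap[of k a p]\<close>)
    ultimately show "orient k c p x > 0 \<and> orient k p a x > 0" ..
  qed (use Fx in auto)
qed

text \<open>The conditions on the centre are finitely many strict inequalities, so they define an
  open set in which a generic \<open>s\<close> exists. Genericity also makes the radial order within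
  each group strict.\<close>

lemma ex_star_partition:
  assumes abc: "orient k a b c > 0"
    and I: "finite I" "a \<notin> I" "b \<notin> I" "c \<notin> I"
    and gp: "general_position ({a, b, c} \<union> I)" and conc: "no_three_concurrent_lines ({a, b, c} \<union> I)"
    and inside: "\<And>p. p \<in> I \<Longrightarrow> orient k a b p > 0" "\<And>p. p \<in> I \<Longrightarrow> orient k b c p > 0"
      "\<And>p. p \<in> I \<Longrightarrow> orient k c a p > 0"
    and card: "card I = n0 + n1 + n2" and n: "n0 > 0" "n1 > 0" "n2 > 0"
  obtains A0 A1 A2 s where "length A0 = n0" "length A1 = n1" "length A2 = n2"
    "set A0 \<union> set A1 \<union> set A2 = I" "distinct (a # A0 @ b # A1 @ c # A2)"
    "\<And>n i j. i < j \<Longrightarrow> j < length (chain (cyclic3 a b c) (cyclic3 A0 A1 A2) n) \<Longrightarrow>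
      orient k s (chain (cyclic3 a b c) (cyclic3 A0 A1 A2) n ! i) (chain (cyclic3 a b c) (cyclic3 A0 A1 A2) n ! j) > 0"
    "general_position (insert s ({a, b, c} \<union> I))" "s \<in> convex hull {a, b, c}"
proof -
  let ?X = "{a, b, c} \<union> I"
  obtain B0 B1 B2 where B_union: "B0 \<union> B1 \<union> B2 = I"
    and B_disj: "B0 \<inter> B1 = {}" "B1 \<inter> B2 = {}" "B0 \<inter> B2 = {}"
    and B_card: "card B0 = n0" "card B1 = n1" "card B2 = n2"
    and strict: "\<And>p q. p \<in> B0 \<Longrightarrow> q \<in> B1 \<Longrightarrow> orient k a b p * orient k b c q < orient k b c p * orient k a b q"
    "\<And>p q. p \<in> B1 \<Longrightarrow> q \<in> B2 \<Longrightarrow> orient k b c p * orient k c a q < orient k c a p * orient k b c q"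
    "\<And>p q. p \<in> B2 \<Longrightarrow> q \<in> B0 \<Longrightarrow> orient k c a p * orient k a b q < orient k a b p * orient k c a q"
    "\<And>p q r. p \<in> B0 \<Longrightarrow> q \<in> B1 \<Longrightarrow> r \<in> B2 \<Longrightarrow>
      orient k a b p * (orient k b c q * orient k c a r) < orient k b c p * (orient k c a q * orient k a b r)"
    "\<And>p q r. p \<in> B0 \<Longrightarrow> q \<in> B1 \<Longrightarrow> r \<in> B2 \<Longrightarrow>
      orient k a b p * (orient k c a r * orient k b c q) < orient k c a p * (orient k b c r * orient k a b q)"
    by (rule ex_strictly_optimal_partition[OF abc I gp conc inside card refl refl refl]) (assumption+, rule that)
  have B_ne: "B0 \<noteq> {}" "B1 \<noteq> {}" "B2 \<noteq> {}" using B_card n by auto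
  have B_I: "B0 \<subseteq> I" "B1 \<subseteq> I" "B2 \<subseteq> I" using B_union by auto
  note B_fin = B_I[THEN finite_subset, OF I(1)]
  define W where "W B x y = (\<Inter>p\<in>B. {s. orient k x p s > 0} \<inter> {s. orient k p y s > 0})" for B x y
  have W_open: "open (W B x y)" if "finite B" for B x y
    unfolding W_def using that by (intro open_INT ballI open_Int open_orient_pos)
  let ?U = "({s. orient k a b s > 0} \<inter> {s. orient k b c s > 0} \<inter> {s. orient k c a s > 0})
    \<inter> (W B0 a b \<inter> W B1 b c \<inter> W B2 c a)"
  have U: "open ?U"
    by (intro open_Int W_open open_orient_pos B_fin)
  have U_ne: "?U \<noteq> {}"
  proof -
    obtain x where "orient k a b x > 0" "orient k b c x > 0" "orient k c a x > 0"
      "\<And>p. p \<in> B0 \<Longrightarrow> orient k a p x > 0 \<and> orient k p b x > 0"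
      "\<And>p. p \<in> B1 \<Longrightarrow> orient k b p x > 0 \<and> orient k p c x > 0"
      "\<And>p. p \<in> B2 \<Longrightarrow> orient k c p x > 0 \<and> orient k p a x > 0"
    proof (rule ex_weighted_center[OF abc refl refl refl B_fin B_ne _ _ _ strict])
      fix p assume "p \<in> B0 \<union> B1 \<union> B2"
      then have "p \<in> I" using B_union by simp
      then show "orient k a b p > 0" "orient k b c p > 0" "orient k c a p > 0" by (rule inside)+
    qed (assumption+, rule that)
    then have "x \<in> ?U" unfolding W_def by simp
    then show ?thesis by (rule ex_in_conv[THEN iffD1, OF exI])
  qed
  have "finite ?X" using I(1) by simp
  from general_position_insert_generic[OF this gp U U_ne, of k]
  obtain s where s: "s \<in> ?U" "general_position (insert s ?X)"
    "\<forall>p\<in>?X. \<forall>q\<in>?X. p \<noteq> q \<longrightarrow> orient k p q s \<noteq> 0"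
    by (elim bexE conjE) (rule that)
  have s_tri: "orient k a b s > 0" "orient k b c s > 0" "orient k c a s > 0"
    and s_W: "s \<in> W B0 a b" "s \<in> W B1 b c" "s \<in> W B2 c a" using s(1) by simp_all
  have sort: "\<exists>A. set A = B \<and> distinct A \<and> sorted_wrt (\<lambda>p q. orient k s p q > 0) (x # A @ [y])"
    if B: "finite B" "s \<in> W B x y" "B \<subseteq> I" "orient k x y s > 0" for B x y
  proof -
    have 1: "orient k s x y > 0" using B(4) by (simp add: orient_rotate'[of k s])
    have 2: "orient k s x p > 0" "orient k s p y > 0" if "p \<in> B" for p
      using B(2) that by (auto simp: orient_rotate'[of k s] W_def)
    have 3: "orient k s p q \<noteq> 0" if "p \<in> B" "q \<in> B" "p \<noteq> q" for p q
    proof -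
      have "p \<in> ?X" "q \<in> ?X" using that B(3) by auto
      then have "orient k p q s \<noteq> 0" using that(3) by (rule s(3)[THEN bspec, THEN bspec, THEN mp])
      then show ?thesis by (simp add: orient_rotate'[of k s])
    qed
    show ?thesis by (rule radial_sort[OF B(1) 1 2 3]) blast+
  qed
  obtain A0 where A0: "set A0 = B0" "distinct A0" "sorted_wrt (\<lambda>p q. orient k s p q > 0) (a # A0 @ [b])"
    using sort[OF B_fin(1) s_W(1) B_I(1) s_tri(1)] by blast
  obtain A1 where A1: "set A1 = B1" "distinct A1" "sorted_wrt (\<lambda>p q. orient k s p q > 0) (b # A1 @ [c])"
    using sort[OF B_fin(2) s_W(2) B_I(2) s_tri(2)] by blast
  obtain A2 where A2: "set A2 = B2" "distinct A2" "sorted_wrt (\<lambda>p q. orient k s p q > 0) (c # A2 @ [a])"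
    using sort[OF B_fin(3) s_W(3) B_I(3) s_tri(3)] by blast
  have sorted_chain: "sorted_wrt (\<lambda>p q. orient k s p q > 0) (chain (cyclic3 a b c) (cyclic3 A0 A1 A2) n)" for n
    by (rule chain_cyclic3_cases) (use A0(3) A1(3) A2(3) in \<open>simp_all only: chain_def cyclic3_simps\<close>)
  have radial: "orient k s (chain (cyclic3 a b c) (cyclic3 A0 A1 A2) n ! i) (chain (cyclic3 a b c) (cyclic3 A0 A1 A2) n ! j) > 0"
    if "i < j" "j < length (chain (cyclic3 a b c) (cyclic3 A0 A1 A2) n)" for n i j
    using sorted_wrt_nth_less[OF sorted_chain that] .
  have dist: "distinct (a # A0 @ b # A1 @ c # A2)"
  proof -
    have "a \<noteq> b" "b \<noteq> c" "a \<noteq> c" using abc by auto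
    moreover have "set A0 \<subseteq> I" "set A1 \<subseteq> I" "set A2 \<subseteq> I" using A0 A1 A2 B_union by auto
    ultimately show ?thesis using A0(1,2) A1(1,2) A2(1,2) B_disj I(2-4) by auto
  qed
  show ?thesis
  proof (rule that[of A0 A1 A2 s])
    show "length A0 = n0" "length A1 = n1" "length A2 = n2"
      using A0 A1 A2 B_card distinct_card[of A0] distinct_card[of A1] distinct_card[of A2] by simp_all
    show "set A0 \<union> set A1 \<union> set A2 = I" using A0 A1 A2 B_union by simp
    show "s \<in> convex hull {a, b, c}" using abc s_tri by (intro in_convex_hull_triangle[of k]) auto
  qed (fact dist radial s(2))+
qed

section \<open>Compatible triangulations\<close>

lemma hull_vertices_triangle:
  assumes "orient k a b c \<noteq> 0" "convex hull X = convex hull {a, b, c}"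
  shows "hull_vertices X = {a, b, c}"
proof -
  have "\<not> collinear {a, b, c}" using assms(1) by (simp add: collinear_iff_orient[of _ _ _ k])
  then have "\<not> affine_dependent {a, b, c}" by (auto simp: collinear_3_eq_affine_dependent)
  then show ?thesis
    unfolding hull_vertices_def assms(2) by (auto simp: extreme_point_of_convex_hull_affine_independent)
qed

lemma generalized_double_circleE:
  assumes gdc: "generalized_double_circle c1 c2 c3 S" and c: "c1 > 0" "c2 > 0" "c3 > 0"
  obtains k P1 P2 P3 A1 A2 A3 where "length A1 = c1" "length A2 = c2" "length A3 = c3"
    "distinct (P1 # A1 @ P2 # A2 @ P3 # A3)" "S = set (P1 # A1 @ P2 # A2 @ P3 # A3)"
    "convex hull S = convex hull {P1, P2, P3}" "orient k P1 P2 P3 > 0"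
    "double_circle k (cyclic3 P1 P2 P3) (cyclic3 A1 A2 A3)"
proof -
  obtain P1 P2 P3 A1 A2 A3 where gp: "general_position S"
    and len: "length A1 = c1" "length A2 = c2" "length A3 = c3"
    and dist: "distinct (P1 # A1 @ P2 # A2 @ P3 # A3)"
    and S: "S = set (P1 # A1 @ P2 # A2 @ P3 # A3)"
    and hull: "convex hull S = convex hull {P1, P2, P3}"
    and poly: "convex_polygon (P1 # A1 @ [P2])" "convex_polygon (P2 # A2 @ [P3])" "convex_polygon (P3 # A3 @ [P1])"
    and unav: "\<forall>e \<in> cycle_edges (P1 # A1 @ P2 # A2 @ P3 # A3). unavoidable S e"
    using gdc unfolding generalized_double_circle_def by (elim conjE exE) (rule that)
  have "orient 1 P1 P2 P3 \<noteq> 0"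
    by (rule general_position_orient[OF gp]) (use dist S in auto)
  then obtain k where k: "orient k P1 P2 P3 > 0" by (rule orient_pos_or_swap_axes)
  let ?V = "cyclic3 P1 P2 P3" and ?A = "cyclic3 A1 A2 A3"
  have "chain_triangle k ?V ?A"
  proof (rule chain_triangle_cyclic3[OF dist k])
    show "general_position (set (P1 # A1 @ P2 # A2 @ P3 # A3))" using gp unfolding S .
    show "set (P1 # A1 @ P2 # A2 @ P3 # A3) \<subseteq> convex hull {P1, P2, P3}"
      using hull_subset[of S convex] unfolding hull unfolding S .
  qed
  then interpret chain_triangle k ?V ?A .
  have points: "chain_points ?V ?A = S" unfolding chain_points_cyclic3 S ..
  have "double_circle k ?V ?A"
  proof (rule double_circle.intro[OF \<open>chain_triangle k ?V ?A\<close> double_circle_axioms.intro])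
    show "?A n \<noteq> []" for n
      using len c by (cases rule: mod_3_exhaust[of n]) (auto simp: cyclic3_def)
    show "convex_polygon (chain ?V ?A n)" for n
      by (rule chain_cyclic3_cases) (use poly in \<open>simp_all only: chain_def cyclic3_simps\<close>)
    have "\<forall>i. Suc i < length (chain ?V ?A n) \<longrightarrow>
        {chain ?V ?A n ! i, chain ?V ?A n ! Suc i} \<in> cycle_edges (P1 # A1 @ P2 # A2 @ P3 # A3)" for n
    proof (rule chain_cyclic3_cases; intro allI impI)
      fix i
      assume "Suc i < length (chain ?V ?A 0)"
      then show "{chain ?V ?A 0 ! i, chain ?V ?A 0 ! Suc i} \<in> cycle_edges (P1 # A1 @ P2 # A2 @ P3 # A3)"
        by (rule cycle_edges_infix[of _ "[]" _ "A2 @ P3 # A3 @ [P1]", rotated]) (simp add: chain_def)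
    next
      fix i
      assume "Suc i < length (chain ?V ?A (Suc 0))"
      then show "{chain ?V ?A (Suc 0) ! i, chain ?V ?A (Suc 0) ! Suc i} \<in> cycle_edges (P1 # A1 @ P2 # A2 @ P3 # A3)"
        by (rule cycle_edges_infix[of _ "P1 # A1" _ "A3 @ [P1]", rotated]) (simp add: chain_def)
    next
      fix i
      assume "Suc i < length (chain ?V ?A (Suc (Suc 0)))"
      then show "{chain ?V ?A (Suc (Suc 0)) ! i, chain ?V ?A (Suc (Suc 0)) ! Suc i} \<in> cycle_edges (P1 # A1 @ P2 # A2 @ P3 # A3)"
        by (rule cycle_edges_infix[of _ "P1 # A1 @ P2 # A2" _ "[]", rotated]) (simp add: chain_def)
    qed
    then show "unavoidable (chain_points ?V ?A) {chain ?V ?A n ! i, chain ?V ?A n ! Suc i}"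
      if "i < Suc (length (?A n))" for n i
      using that unav unfolding points by (simp add: length_chain)
  qed
  with len dist S hull k show ?thesis by (rule that)
qed

section \<open>Transport between the two point sets and assembly\<close>

lemma ex_map_eq:
  assumes "distinct xs" "length xs = length ys"
  obtains f where "map f xs = ys"
proof -
  have "map (\<lambda>x. the (map_of (zip xs ys) x)) xs = ys"
    by (rule nth_equalityI) (use assms in \<open>simp_all add: map_of_zip_nth\<close>)
  then show ?thesis by (rule that)
qed

lemma map_star_edges:
  assumes 1: "star_triangulation k s u m D" and 2: "star_triangulation k' s' u' m D"
    and "f s = s'" and u: "\<And>c i. i \<le> m c \<Longrightarrow> u' c i = f (u c i)"
  shows "star_triangulation.edges s' u' m D = (`) f ` star_triangulation.edges s u m D"
proof -
  interpret P: star_triangulation k s u m D by (rule 1)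
  interpret Q: star_triangulation k' s' u' m D by (rule 2)
  have chain: "{u' c i, u' c j} = f ` {u c i, u c j}" if "(i, j) \<in> D c" for c i j
    using P.D_range[OF that] u[of i c] u[of j c] by simp
  have star: "{s', u' c i} = f ` {s, u c i}" if "i \<le> m c" for c i
    using u[OF that] \<open>f s = s'\<close> by simp
  show ?thesis
  proof (intro equalityI subsetI)
    fix e assume "e \<in> Q.edges"
    then show "e \<in> (`) f ` P.edges"
    proof (cases rule: Q.edgesE)
      case (1 c i)
      then show ?thesis using star[of i c] P.star_edge_in_edges[of i c] by blast
    next
      case (2 c i j)
      then show ?thesis using chain[of i j c] P.chain_edge_in_edges[of i j c] by blast
    qed
  next
    fix e assume "e \<in> (`) f ` P.edges"
    then obtain e' where e: "e = f ` e'" and "e' \<in> P.edges" by (elim imageE)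
    from this(2) show "e \<in> Q.edges"
    proof (cases rule: P.edgesE)
      case (1 c i)
      then show ?thesis using star[of i c] Q.star_edge_in_edges[of i c] e by simp
    next
      case (2 c i j)
      then show ?thesis using chain[of i j c] Q.chain_edge_in_edges[of i j c] e by simp
    qed
  qed
qed

text \<open>Injectivity of \<open>f\<close> on \<open>X\<close> recovers an edge from its image, so
  no pair outside \<open>T\<close> is mapped to an edge.\<close>

lemma compatible_triangulation_image:
  assumes f: "bij_betw f X Y" and T: "triangulation X T" "triangulation Y ((`) f ` T)"
  shows "compatible_triangulation X Y f T ((`) f ` T)"
  unfolding compatible_triangulation_def
proof (intro conjI ballI T)
  fix p p' assume p: "p \<in> X" "p' \<in> X"
  have sub: "e \<subseteq> X" if "e \<in> T" for e
    using T(1) that unfolding triangulation_def segments_def by blast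
  show "{p, p'} \<in> T \<longleftrightarrow> {f p, f p'} \<in> (`) f ` T"
  proof
    assume "{p, p'} \<in> T"
    then have "f ` {p, p'} \<in> (`) f ` T" by (rule imageI)
    then show "{f p, f p'} \<in> (`) f ` T" by simp
  next
    assume "{f p, f p'} \<in> (`) f ` T"
    then obtain e where e: "f ` {p, p'} = f ` e" "e \<in> T" by auto
    have "{p, p'} = e"
      using inj_on_image_eq_iff[OF bij_betw_imp_inj_on[OF f], of "{p, p'}" e] e p sub by auto
    with e(2) show "{p, p'} \<in> T" by simp
  qed
qed

theorem theorem12:
  fixes c1 c2 c3 :: nat and P Q :: "point set" and f0 :: "point \<Rightarrow> point"
  assumes "c1 > 0" and "c2 > 0" and "c3 > 0"
    and "generalized_double_circle c1 c2 c3 P"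
    and "finite Q" and "general_position Q"
    and "card Q = card P"
    and "card (hull_vertices Q) = 3"
    and "no_three_concurrent_lines Q"
    and "cyclic_bijection P Q f0"
  shows "steiner_number P Q f0 \<le> 1"
proof -
  obtain k P1 P2 P3 A1 A2 A3 where len: "length A1 = c1" "length A2 = c2" "length A3 = c3"
    and dist: "distinct (P1 # A1 @ P2 # A2 @ P3 # A3)" and P: "P = set (P1 # A1 @ P2 # A2 @ P3 # A3)"
    and hull_P: "convex hull P = convex hull {P1, P2, P3}" and k: "orient k P1 P2 P3 > 0"
    and dc: "double_circle k (cyclic3 P1 P2 P3) (cyclic3 A1 A2 A3)"
    by (rule generalized_double_circleE[OF assms(4,1-3)])
  let ?V = "cyclic3 P1 P2 P3" and ?A = "cyclic3 A1 A2 A3"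
  interpret P: double_circle k ?V ?A by (rule dc)
  have points_P: "chain_points ?V ?A = P" unfolding chain_points_cyclic3 P ..
  obtain s where s: "star_configuration k s P.u P.m" "s \<in> convex hull {?V 0, ?V 1, ?V 2}"
    "general_position (insert s P)"
    using P.ex_star_center unfolding points_P by blast

  define a b c where "a = f0 P1" and "b = f0 P2" and "c = f0 P3"
  have "hull_vertices P = {P1, P2, P3}" using k hull_P by (intro hull_vertices_triangle[of k]) auto
  then have f0: "bij_betw f0 {P1, P2, P3} (hull_vertices Q)"
    using assms(10) unfolding cyclic_bijection_def by simp
  then have verts_Q: "hull_vertices Q = {a, b, c}"
    unfolding a_def b_def c_def bij_betw_def by auto
  have abc_ne: "a \<noteq> b" "b \<noteq> c" "a \<noteq> c"
    using assms(8) unfolding verts_Q by (auto simp: card_insert_if split: if_splits)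
  have abc_Q: "a \<in> Q" "b \<in> Q" "c \<in> Q"
    using verts_Q extreme_point_of_convex_hull unfolding hull_vertices_def by blast+
  have hull_Q: "convex hull Q = convex hull {a, b, c}"
    using Krein_Milman_polytope[OF assms(5)] verts_Q unfolding hull_vertices_def by simp
  have "orient 1 a b c \<noteq> 0"
    by (rule general_position_orient[OF assms(6) abc_Q abc_ne])
  then obtain k' where k': "orient k' a b c > 0" by (rule orient_pos_or_swap_axes)
  define I where "I = Q - {a, b, c}"
  have Q_eq: "{a, b, c} \<union> I = Q" using abc_Q unfolding I_def by auto
  have Q_hull: "x \<in> convex hull {a, b, c}" if "x \<in> Q" for x
    using hull_inc[OF that, of convex] unfolding hull_Q .
  have inside: "orient k' a b p > 0" "orient k' b c p > 0" "orient k' c a p > 0" if "p \<in> I" for p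
  proof -
    have p: "p \<in> Q" "p \<noteq> a" "p \<noteq> b" "p \<noteq> c" using that unfolding I_def by auto
    have rot: "orient k' b c a > 0" "orient k' c a b > 0"
      using k' by (simp_all add: orient_rotate[of k' b c a] orient_rotate'[of k' c a b])
    have "orient k' a b p \<ge> 0" "orient k' b c p \<ge> 0" "orient k' c a p \<ge> 0"
      using k' rot by (auto intro!: orient_nonneg_convex_hull[OF Q_hull[OF p(1)]])
    moreover have "orient k' a b p \<noteq> 0" "orient k' b c p \<noteq> 0" "orient k' c a p \<noteq> 0"
      using general_position_orient[OF assms(6)] abc_Q abc_ne p by metis+
    ultimately show "orient k' a b p > 0" "orient k' b c p > 0" "orient k' c a p > 0" by simp_all
  qed
  have "card P = 3 + (c1 + c2 + c3)" using distinct_card[OF dist] len unfolding P by simp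
  moreover have "card I = card Q - 3"
    using abc_Q abc_ne unfolding I_def by (subst card_Diff_subset) auto
  ultimately have card_I: "card I = c1 + c2 + c3" using assms(7) by simp
  have I: "finite I" "a \<notin> I" "b \<notin> I" "c \<notin> I" using assms(5) unfolding I_def by auto
  \<comment> \<open>The group sizes are those of \<open>P\<close>, so corresponding chains have the
    same length.\<close>
  obtain B1 B2 B3 s' where len': "length B1 = c1" "length B2 = c2" "length B3 = c3"
    and B: "set B1 \<union> set B2 \<union> set B3 = I" and dist': "distinct (a # B1 @ b # B2 @ c # B3)"
    and radial': "\<And>n i j. i < j \<Longrightarrow> j < length (chain (cyclic3 a b c) (cyclic3 B1 B2 B3) n) \<Longrightarrow>
      orient k' s' (chain (cyclic3 a b c) (cyclic3 B1 B2 B3) n ! i) (chain (cyclic3 a b c) (cyclic3 B1 B2 B3) n ! j) > 0"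
    and gp': "general_position (insert s' ({a, b, c} \<union> I))" and s'_hull: "s' \<in> convex hull {a, b, c}"
    by (rule ex_star_partition[OF k' I _ _ inside card_I assms(1-3)]) (use assms(6,9) Q_eq in auto)
  let ?V' = "cyclic3 a b c" and ?A' = "cyclic3 B1 B2 B3"
  have Q: "Q = set (a # B1 @ b # B2 @ c # B3)" using Q_eq B by auto
  have "chain_triangle k' ?V' ?A'"
  proof (rule chain_triangle_cyclic3[OF dist' k'])
    show "general_position (set (a # B1 @ b # B2 @ c # B3))" using assms(6) unfolding Q .
    show "set (a # B1 @ b # B2 @ c # B3) \<subseteq> convex hull {a, b, c}" using Q_hull unfolding Q by (rule subsetI)
  qed
  then interpret Q: chain_triangle k' ?V' ?A' .
  have points_Q: "chain_points ?V' ?A' = Q" unfolding chain_points_cyclic3 Q ..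
  have star_Q: "star_configuration k' s' Q.u Q.m"
  proof (rule Q.star_configurationI)
    show "orient k' s' (Q.u n i) (Q.u n j) > 0" if "i < j" "j \<le> Q.m n" for n i j
      using that by (intro radial') (simp_all add: Q.length_chain)
    show "general_position (insert s' (chain_points ?V' ?A'))" using gp' unfolding points_Q Q_eq .
  qed
  interpret SQ: star_configuration k' s' Q.u Q.m by (rule star_Q)
  interpret SP: star_configuration k s P.u P.m by (rule s(1))
  have len_eq: "length (?A' n) = length (?A n)" for n
    using len len' by (cases rule: mod_3_exhaust[of n]) (simp_all add: cyclic3_def)

  have "\<exists>D. polygon_triangulation 0 (Q.m n) D \<and>
      (\<forall>i j l. (i, j) \<in> D \<longrightarrow> i < l \<longrightarrow> l < j \<longrightarrow> orient k' (Q.u n i) (Q.u n j) (Q.u n l) > 0)" for n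
  proof (rule SQ.ex_polygon_triangulation_above)
    \<comment> \<open>The base chord is a hull edge, so the other vertices of its chain are strictly
      on the inner side.\<close>
    fix l assume l: "0 < l" "l < Q.m n"
    have "Q.u n l \<noteq> Q.u n 0" "Q.u n l \<noteq> Q.u n (Q.m n)" using l by (simp_all only: Q.u_eq_iff)
    then show "orient k' (Q.u n 0) (Q.u n (Q.m n)) (Q.u n l) > 0"
      unfolding Q.u_zero Q.u_last using l by (intro Q.strictly_in_hull Q.u_in_points) simp_all
  qed simp_all
  then obtain E where E: "\<And>n. polygon_triangulation 0 (Q.m n) (E n)"
    "\<And>n i j l. (i, j) \<in> E n \<Longrightarrow> i < l \<Longrightarrow> l < j \<Longrightarrow> orient k' (Q.u n i) (Q.u n j) (Q.u n l) > 0"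
    by metis
  \<comment> \<open>\<open>E\<close> is chosen separately for every index; reducing the index modulo
    3 makes the choice periodic.\<close>
  define D where "D n = E (n mod 3)" for n
  have D: "polygon_triangulation 0 (Q.m n) (D n)"
    and D_above: "(i, j) \<in> D n \<Longrightarrow> i < l \<Longrightarrow> l < j \<Longrightarrow> orient k' (Q.u n i) (Q.u n j) (Q.u n l) > 0" for n i j l
  proof -
    have eq: "Q.u (n mod 3) = Q.u n" "Q.m (n mod 3) = Q.m n"
      by (rule periodic_cong_mod_3[of Q.u, OF SQ.u_periodic] periodic_cong_mod_3[of Q.m, OF SQ.m_periodic]; simp)+
    show "polygon_triangulation 0 (Q.m n) (D n)" using E(1)[of "n mod 3"] unfolding D_def eq .
    show "orient k' (Q.u n i) (Q.u n j) (Q.u n l) > 0" if "(i, j) \<in> D n" "i < l" "l < j"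
      using E(2)[of i j "n mod 3" l] that unfolding D_def eq by simp
  qed
  \<comment> \<open>Stated with \<open>P.m\<close>, which equals \<open>Q.m\<close> by
    \<open>len_eq\<close>, so that the two triangulations share \<open>m\<close> and
    \<open>D\<close>.\<close>
  have ST_Q: "star_triangulation k' s' Q.u P.m D"
  proof (rule star_triangulation.intro[OF star_Q[unfolded len_eq] star_triangulation_axioms.intro])
    show "D (n + 3) = D n" for n unfolding D_def by simp
    show "polygon_triangulation 0 (P.m n) (D n)" for n using D[of n] unfolding len_eq .
  qed (rule D_above)
  have ST_P: "star_triangulation k s P.u P.m D"
  proof (rule star_triangulation.intro[OF s(1) star_triangulation_axioms.intro])
    show "D (n + 3) = D n" for n unfolding D_def by simp
    show "polygon_triangulation 0 (P.m n) (D n)" for n using D[of n] unfolding len_eq .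
    \<comment> \<open>In \<open>P\<close> each chord has the intermediate chain vertices on its
      inner side, so the triangulation built for \<open>Q\<close> meets the requirement.\<close>
    fix i j n l assume ij: "(i, j) \<in> D n" "i < l" "l < j"
    have "j \<le> P.m n" using polygon_triangulation_range[OF D ij(1)] unfolding len_eq by simp
    then have "orient k (P.u n i) (P.u n l) (P.u n j) < 0" by (rule P.chain_concave[OF ij(2,3)])
    then show "orient k (P.u n i) (P.u n j) (P.u n l) > 0"
      by (simp add: orient_swap'[of k _ "P.u n j"])
  qed
  interpret TP: star_triangulation k s P.u P.m D by (rule ST_P)
  interpret TQ: star_triangulation k' s' Q.u P.m D by (rule ST_Q)

  have s_notin: "s \<notin> P" "s' \<notin> Q"
    using SP.s_distinct SQ.s_distinct unfolding points_P[symmetric] points_Q[symmetric] P.points_eq Q.points_eq by auto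
  \<comment> \<open>The cyclic lists are matched entry by entry and \<open>s\<close> goes to
    \<open>s'\<close>. Since \<open>a\<close>, \<open>b\<close>, \<open>c\<close> are the images of
    \<open>P1\<close>, \<open>P2\<close>, \<open>P3\<close> under \<open>f0\<close>, the map extends
    \<open>f0\<close> on the hull vertices.\<close>
  obtain f where f: "map f (s # P1 # A1 @ P2 # A2 @ P3 # A3) = s' # a # B1 @ b # B2 @ c # B3"
    by (rule ex_map_eq[of "s # P1 # A1 @ P2 # A2 @ P3 # A3" "s' # a # B1 @ b # B2 @ c # B3"])
      (use dist s_notin(1) len len' P in auto)
  then have f_eq: "f s = s'" "f P1 = a" "map f A1 = B1" "f P2 = b" "map f A2 = B2" "f P3 = c" "map f A3 = B3"
    using len len' by (simp_all add: append_eq_append_conv)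
  have set_P: "set (s # P1 # A1 @ P2 # A2 @ P3 # A3) = P \<union> {s}" unfolding P by auto
  have set_Q: "set (s' # a # B1 @ b # B2 @ c # B3) = Q \<union> {s'}" unfolding Q by auto
  have "distinct (s' # a # B1 @ b # B2 @ c # B3)" using dist' s_notin(2) unfolding Q by simp
  then have "inj_on f (P \<union> {s})" unfolding f[symmetric] distinct_map set_P by blast
  moreover have "f ` (P \<union> {s}) = Q \<union> {s'}" unfolding set_P[symmetric] set_Q[symmetric] f[symmetric] by (simp add: image_Un)
  ultimately have f_bij: "bij_betw f (P \<union> {s}) (Q \<union> {s'})" unfolding bij_betw_def by blast
  have chain_eq: "chain ?V' ?A' n = map f (chain ?V ?A n)" for n
    by (cases rule: mod_3_exhaust[of n]) (simp_all add: chain_def cyclic3_def mod_Suc f_eq)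
  have edges: "TQ.edges = (`) f ` TP.edges"
  proof (rule map_star_edges[where f = f, OF ST_P ST_Q f_eq(1)])
    show "Q.u n i = f (P.u n i)" if "i \<le> P.m n" for n i
      unfolding chain_eq using that by (intro nth_map) (simp add: P.length_chain)
  qed
  have "triangulation (P \<union> {s}) TP.edges"
    using TP.triangulation_edges unfolding P.points_eq[symmetric] points_P by simp
  moreover have "triangulation (Q \<union> {s'}) TQ.edges"
    using TQ.triangulation_edges unfolding len_eq[symmetric] Q.points_eq[symmetric] points_Q by simp
  ultimately have comp: "compatible_triangulation (P \<union> {s}) (Q \<union> {s'}) f TP.edges ((`) f ` TP.edges)"
    unfolding edges by (intro compatible_triangulation_image f_bij)
  have "compatible_with_steiner_points P Q f0 1"
    unfolding compatible_with_steiner_points_def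
  proof (intro exI conjI)
    show "compatible_triangulation (P \<union> {s}) (Q \<union> {s'}) f TP.edges ((`) f ` TP.edges)" by (rule comp)
    show "bij_betw f (P \<union> {s}) (Q \<union> {s'})" by (rule f_bij)
    show "general_position (P \<union> {s})" using s(3) by simp
    show "general_position (Q \<union> {s'})" using gp' unfolding Q_eq by simp
    show "{s} \<subseteq> convex hull P" using s(2) unfolding hull_P by (simp add: numeral_2_eq_2)
    show "{s'} \<subseteq> convex hull Q" using s'_hull unfolding hull_Q by simp
    show "\<forall>p\<in>hull_vertices P. f p = f0 p"
      unfolding \<open>hull_vertices P = {P1, P2, P3}\<close> using f_eq by (simp add: a_def b_def c_def)
  qed (use s_notin in simp_all)
  then have "enat 1 \<in> {enat k |k. compatible_with_steiner_points P Q f0 k}" by blast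
  then have "steiner_number P Q f0 \<le> enat 1" unfolding steiner_number_def by (rule Inf_lower)
  then show ?thesis by (simp add: one_enat_def)
qed

end
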